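(* Consider the spatially discretized ideal vorticity ODE with velocity $\vec v\in H^{\mathrm{Div}}(\tau_h)$, and assume: (i) either $w\in H^1_{\tilde p}(\tau_h)$ is governed by the continuous Galerkin formulation $$\int_\Omega \psi\,(\partial_t w+\vec v\cdot\nabla w)\,dV=0\qquad\forall\,\psi\in H^1_{\tilde p}(\tau_h),$$ or $w\in L^2_{\tilde p}(\tau_h)$ is governed by the discontinuous Galerkin formulation without upwinding $$\int_\Omega \eta\,(\partial_t w+\vec v\cdot\nabla w)\,dV-\int_\Gamma (\vec v\cdot\vec n_\Gamma)\,\{\eta\}\,[\![w]\!]\,dS=0\qquad\forall\,\eta\in L^2_{\tilde p}(\tau_h);$$ (ii) $\nabla\cdot\vec v=0$ in $\Omega$; (iii) periodic or homogeneous Dirichlet boundary conditions (or a mixture thereof) hold for $w$ and $\vec v\cdot\vec n_{\partial\Omega}$. If this ODE system for the coefficients of $w$ is evolved in discrete time with a symplectic integrator, then enstrophy is conserved in discrete time: the iterates $w_0,w_1,w_2,\dots$ satisfy $$\tfrac12\int_\Omega w_{n+1}^2\,dV=\tfrac12\int_\Omega w_n^2\,dV\qquad\text{for all } n.$$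
   Context: $\Omega$ is a bounded polygonal/polyhedral domain with outward unit normal $\vec n_{\partial\Omega}$, and $\tau_h$ is a conforming finite element mesh of $\Omega$ with cells $K$. $\Gamma$ is the union of the internal faces between cells (periodically identified boundary faces count as internal faces), and $\vec n_\Gamma$ is a fixed unit normal on each face of $\Gamma$. For a piecewise smooth $\eta$, let $\eta^+$ and $\eta^-$ be the one-sided values on $\Gamma$ from the upwind side (the side $\vec n_\Gamma$ points out of) and the downwind side (the side $\vec n_\Gamma$ points into), respectively. The jump and average are $[\![\eta]\!]=\eta^+-\eta^-$ and $\{\eta\}=(\eta^++\eta^-)/2$. Spaces: $L^2_{q}(\tau_h)$ is the space of functions that are polynomial of order $\le q$ on each cell, possibly discontinuous across $\Gamma$; $H^1_{q}(\tau_h)$ is the subspace of continuous ones; $H^{\mathrm{Div}}(\tau_h)$ is the space of piecewise polynomial vector fields whose normal component is continuous across $\Gamma$. Derivatives are taken cell by cell. When boundary conditions on $w$ are imposed, the trial and test spaces are the corresponding subspaces satisfying these conditions (for periodic conditions, $\vec v$ is periodic too; on the Dirichlet part, $w=0$ and $\vec v\cdot\vec n_{\partial\Omega}=0$). The velocity may depend on time and on the current vorticity, $\vec v=\vec v(t,w)$; assumptions (ii) and (iii) are understood for every velocity entering the scheme, including at intermediate stages. Expanding $w$ in a basis turns the weak formulation into an ODE system $\dot{\boldsymbol w}=\boldsymbol f(t,\boldsymbol w)$ for the coefficient vector (the mass matrix is invertible). A symplectic integrator means a symplectic Runge–Kutta method, i.e. one whose coefficients $(a_{ij}),(b_i)$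 satisfy $b_ia_{ij}+b_ja_{ji}=b_ib_j$ for all $i,j$ (for example, Gauss–Legendre methods such as the implicit midpoint rule), with the stage equations solved exactly (solutions of the stage equations are assumed to exist). *)

theory Defs
  imports "HOL-Analysis.Analysis"
begin

section \<open>Domain and mesh\<close>

text \<open>The condition \<open>interior (closure \<Omega>) = \<Omega>\<close> rules out slits, on which the outward
  normal would be two-valued.\<close>

definition polyhedral_domain :: "'a::euclidean_space set \<Rightarrow> bool" where
  "polyhedral_domain \<Omega> \<longleftrightarrow>
     (DIM('a) = 2 \<or> DIM('a) = 3) \<and>
     \<Omega> \<noteq> {} \<and> open \<Omega> \<and> connected \<Omega> \<and> bounded \<Omega> \<and> interior (closure \<Omega>) = \<Omega> \<and>
     (\<exists>\<P>. finite \<P> \<and> (\<forall>Q\<in>\<P>. polytope Q) \<and> closure \<Omega> = \<Union>\<P>)"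

text \<open>The face condition (for both orders of \<open>K\<close> and \<open>L\<close>) forces the interiors of distinct
  cells to be disjoint and excludes hanging nodes.\<close>

definition conforming_mesh :: "'a::euclidean_space set \<Rightarrow> 'a set set \<Rightarrow> bool" where
  "conforming_mesh \<Omega> \<K> \<longleftrightarrow>
     finite \<K> \<and> \<Union>\<K> = closure \<Omega> \<and>
     (\<forall>K\<in>\<K>. polytope K \<and> interior K \<noteq> {}) \<and>
     (\<forall>K\<in>\<K>. \<forall>L\<in>\<K>. (K \<inter> L) face_of K)"

definition mesh_facets :: "'a::euclidean_space set set \<Rightarrow> 'a set set" where
  "mesh_facets \<K> = {F. \<exists>K\<in>\<K>. F facet_of K}"

definition interior_facets :: "'a::euclidean_space set set \<Rightarrow> 'a set set" where
  "interior_facets \<K> = {F. \<exists>K\<in>\<K>. \<exists>L\<in>\<K>. K \<noteq> L \<and> F facet_of K \<and> F facet_of L}"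

definition boundary_facets :: "'a::euclidean_space set set \<Rightarrow> 'a set set" where
  "boundary_facets \<K> = mesh_facets \<K> - interior_facets \<K>"

definition outward_normal :: "'a::euclidean_space set \<Rightarrow> 'a set \<Rightarrow> 'a \<Rightarrow> bool" where
  "outward_normal K F n \<longleftrightarrow> norm n = 1 \<and> (\<forall>x\<in>K. \<forall>y\<in>F. n \<bullet> x \<le> n \<bullet> y)"

text \<open>A pair \<open>(F, s)\<close> in \<open>P\<close> says that the boundary facet \<open>F\<close> is periodically identified with
  the boundary facet \<open>F + s\<close> by the translation \<open>x \<mapsto> x + s\<close>; the domain lies on opposite
  sides of the two. \<open>D\<close> collects the facets carrying Dirichlet conditions. Every boundary
  facet has exactly one of the roles: in \<open>D\<close>, first member of one pair, second member of one
  pair.\<close>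

definition boundary_splitting ::
    "'a::euclidean_space set set \<Rightarrow> ('a set \<times> 'a) set \<Rightarrow> 'a set set \<Rightarrow> bool" where
  "boundary_splitting \<K> P D \<longleftrightarrow>
     (let P1 = fst ` P; P2 = (\<lambda>(F, s). (+) s ` F) ` P in
      inj_on fst P \<and> inj_on (\<lambda>(F, s). (+) s ` F) P \<and>
      P1 \<inter> P2 = {} \<and> D \<inter> P1 = {} \<and> D \<inter> P2 = {} \<and>
      D \<union> P1 \<union> P2 = boundary_facets \<K>) \<and>
     (\<forall>(F, s)\<in>P. \<forall>K\<in>\<K>. \<forall>L\<in>\<K>. \<forall>n.
        F facet_of K \<and> (+) s ` F facet_of L \<and> outward_normal K F n
          \<longrightarrow> outward_normal L ((+) s ` F) (- n))"

text \<open>The faces making up \<open>\<Gamma>\<close>, each given as a facet \<open>F\<close> with a shift \<open>s\<close>: \<open>s = 0\<close> for a facet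
  between two cells; for periodically identified facets, \<open>F\<close> represents the pair
  \<open>F\<close>, \<open>F + s\<close>.\<close>

definition Gam :: "'a::euclidean_space set set \<Rightarrow> ('a set \<times> 'a) set \<Rightarrow> ('a set \<times> 'a) set" where
  "Gam \<K> P = interior_facets \<K> \<times> {0} \<union> P"

definition unit_normal_field ::
    "'a::euclidean_space set set \<Rightarrow> ('a set \<times> 'a) set \<Rightarrow> ('a set \<Rightarrow> 'a) \<Rightarrow> bool" where
  "unit_normal_field \<K> P \<nu> \<longleftrightarrow>
     (\<forall>(F, s)\<in>Gam \<K> P. norm (\<nu> F) = 1 \<and> (\<forall>x\<in>F. \<forall>y\<in>F. \<nu> F \<bullet> (x - y) = 0))"


section \<open>One-sided values, jump and average\<close>

text \<open>Functions are only meaningful up to their values on the cell boundaries, so boundary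
  values are limits from the interior of a cell.\<close>

definition cell_trace ::
    "'a::euclidean_space set \<Rightarrow> ('a \<Rightarrow> 'b::real_normed_vector) \<Rightarrow> 'a \<Rightarrow> 'b" where
  "cell_trace K \<eta> x = Lim (at x within interior K) \<eta>"

text \<open>The value on a face \<open>(F, s)\<close> of \<open>\<Gamma>\<close> from the side that \<open>n\<close> points out of, i.e. from the
  cell for which \<open>n\<close> is the outward normal. On a periodic face that cell touches either
  \<open>F\<close> (\<open>r = 0\<close>) or \<open>F + s\<close> (\<open>r = s\<close>).\<close>

definition one_sided ::
    "'a::euclidean_space set set \<Rightarrow> 'a set \<times> 'a \<Rightarrow> 'a \<Rightarrow> ('a \<Rightarrow> 'b::real_normed_vector) \<Rightarrow> 'a \<Rightarrow> 'b"
  where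
  "one_sided \<K> \<gamma> n \<eta> x =
     (let (K, r) = (THE (K, r). K \<in> \<K> \<and> r \<in> {0, snd \<gamma>} \<and> (+) r ` fst \<gamma> facet_of K \<and>
                                outward_normal K ((+) r ` fst \<gamma>) n)
      in cell_trace K \<eta> (r + x))"

definition upwind ::
    "'a::euclidean_space set set \<Rightarrow> ('a set \<Rightarrow> 'a) \<Rightarrow> 'a set \<times> 'a \<Rightarrow> ('a \<Rightarrow> 'b::real_normed_vector) \<Rightarrow> 'a \<Rightarrow> 'b"
  where "upwind \<K> \<nu> \<gamma> = one_sided \<K> \<gamma> (\<nu> (fst \<gamma>))"

definition downwind ::
    "'a::euclidean_space set set \<Rightarrow> ('a set \<Rightarrow> 'a) \<Rightarrow> 'a set \<times> 'a \<Rightarrow> ('a \<Rightarrow> 'b::real_normed_vector) \<Rightarrow> 'a \<Rightarrow> 'b"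
  where "downwind \<K> \<nu> \<gamma> = one_sided \<K> \<gamma> (- \<nu> (fst \<gamma>))"

definition face_jump ::
    "'a::euclidean_space set set \<Rightarrow> ('a set \<Rightarrow> 'a) \<Rightarrow> 'a set \<times> 'a \<Rightarrow> ('a \<Rightarrow> real) \<Rightarrow> 'a \<Rightarrow> real" where
  "face_jump \<K> \<nu> \<gamma> \<eta> x = upwind \<K> \<nu> \<gamma> \<eta> x - downwind \<K> \<nu> \<gamma> \<eta> x"

definition face_avg ::
    "'a::euclidean_space set set \<Rightarrow> ('a set \<Rightarrow> 'a) \<Rightarrow> 'a set \<times> 'a \<Rightarrow> ('a \<Rightarrow> real) \<Rightarrow> 'a \<Rightarrow> real" where
  "face_avg \<K> \<nu> \<gamma> \<eta> x = (upwind \<K> \<nu> \<gamma> \<eta> x + downwind \<K> \<nu> \<gamma> \<eta> x) / 2"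


section \<open>Surface integrals over flat faces\<close>

text \<open>For a unit vector \<open>n\<close>, this is the (d-1)-dimensional Lebesgue measure on the hyperplane
  \<open>n \<bullet> x = c\<close>: by Fubini, the area of a subset of the hyperplane is the volume of the right
  prism of height 1 over it. Hence the measure is the image of Lebesgue measure on the slab
  \<open>c \<le> n \<bullet> y \<le> c + 1\<close> under orthogonal projection onto the hyperplane.\<close>

definition hyperplane_measure :: "'a::euclidean_space \<Rightarrow> real \<Rightarrow> 'a measure" where
  "hyperplane_measure n c =
     distr (restrict_space lborel {y. c \<le> n \<bullet> y \<and> n \<bullet> y \<le> c + 1}) borel
           (\<lambda>y. y - (n \<bullet> y - c) *\<^sub>R n)"

definition surface_integral :: "'a::euclidean_space set \<Rightarrow> 'a \<Rightarrow> ('a \<Rightarrow> real) \<Rightarrow> real" where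
  "surface_integral F n g = (LINT x:F|hyperplane_measure n (n \<bullet> (SOME y. y \<in> F)). g x)"


section \<open>Finite element spaces\<close>

definition polys :: "nat \<Rightarrow> ('a::euclidean_space \<Rightarrow> real) set" where
  "polys q = {p. \<exists>c. \<forall>x. p x =
     (\<Sum>\<alpha> | \<alpha> \<in> Basis \<rightarrow>\<^sub>E {..q} \<and> sum \<alpha> Basis \<le> q. c \<alpha> * (\<Prod>b\<in>Basis. (x \<bullet> b) ^ \<alpha> b))}"

text \<open>The spaces contain every representative of a piecewise polynomial: values on the cell
  boundaries are left open here and are ignored by all integrals and traces.\<close>

definition L2_fe :: "'a::euclidean_space set set \<Rightarrow> nat \<Rightarrow> ('a \<Rightarrow> real) set" where
  "L2_fe \<K> q = {w. \<forall>K\<in>\<K>. \<exists>p\<in>polys q. \<forall>x\<in>interior K. w x = p x}"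

text \<open>On facets between two cells the jump condition already follows from continuity on
  \<open>\<Omega>\<close>; it adds continuity across the periodically identified facets.\<close>

definition H1_fe ::
    "'a::euclidean_space set \<Rightarrow> 'a set set \<Rightarrow> ('a set \<times> 'a) set \<Rightarrow> ('a set \<Rightarrow> 'a) \<Rightarrow> nat
      \<Rightarrow> ('a \<Rightarrow> real) set" where
  "H1_fe \<Omega> \<K> P \<nu> q = {w \<in> L2_fe \<K> q.
     continuous_on \<Omega> w \<and> (\<forall>\<gamma>\<in>Gam \<K> P. \<forall>x\<in>fst \<gamma>. face_jump \<K> \<nu> \<gamma> w x = 0)}"

definition HDiv_fe ::
    "'a::euclidean_space set set \<Rightarrow> ('a set \<times> 'a) set \<Rightarrow> ('a set \<Rightarrow> 'a) \<Rightarrow> ('a \<Rightarrow> 'a) set" where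
  "HDiv_fe \<K> P \<nu> = {v.
     (\<forall>K\<in>\<K>. \<exists>p. polynomial_function p \<and> (\<forall>x\<in>interior K. v x = p x)) \<and>
     (\<forall>\<gamma>\<in>Gam \<K> P. \<forall>x\<in>fst \<gamma>.
        upwind \<K> \<nu> \<gamma> v x \<bullet> \<nu> (fst \<gamma>) = downwind \<K> \<nu> \<gamma> v x \<bullet> \<nu> (fst \<gamma>))}"

definition dirichlet0 :: "'a::euclidean_space set set \<Rightarrow> 'a set set \<Rightarrow> ('a \<Rightarrow> real) \<Rightarrow> bool" where
  "dirichlet0 \<K> D w \<longleftrightarrow> (\<forall>F\<in>D. \<forall>K\<in>\<K>. F facet_of K \<longrightarrow> (\<forall>x\<in>F. cell_trace K w x = 0))"

definition no_flux :: "'a::euclidean_space set set \<Rightarrow> 'a set set \<Rightarrow> ('a \<Rightarrow> 'a) \<Rightarrow> bool" where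
  "no_flux \<K> D v \<longleftrightarrow> (\<forall>F\<in>D. \<forall>K\<in>\<K>. \<forall>n. F facet_of K \<and> outward_normal K F n
       \<longrightarrow> (\<forall>x\<in>F. cell_trace K v x \<bullet> n = 0))"

text \<open>At interior points of a cell the derivatives below are those of the polynomial on that
  cell; the remaining points form a null set.\<close>

definition grad :: "('a::euclidean_space \<Rightarrow> real) \<Rightarrow> 'a \<Rightarrow> 'a" where
  "grad w x = (\<Sum>b\<in>Basis. frechet_derivative w (at x) b *\<^sub>R b)"

definition divergence :: "('a::euclidean_space \<Rightarrow> 'a) \<Rightarrow> 'a \<Rightarrow> real" where
  "divergence v x = (\<Sum>b\<in>Basis. frechet_derivative v (at x) b \<bullet> b)"

definition div_free :: "'a::euclidean_space set set \<Rightarrow> ('a \<Rightarrow> 'a) \<Rightarrow> bool" where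
  "div_free \<K> v \<longleftrightarrow> (\<forall>K\<in>\<K>. \<forall>x\<in>interior K. divergence v x = 0)"


section \<open>Weak formulations and the coefficient ODE\<close>

text \<open>\<open>V\<close> is the common trial and test space, \<open>wt\<close> stands for \<open>\<partial>\<^sub>t w\<close>.\<close>

definition cg_weak ::
    "'a::euclidean_space set \<Rightarrow> ('a \<Rightarrow> real) set \<Rightarrow> ('a \<Rightarrow> real) \<Rightarrow> ('a \<Rightarrow> 'a) \<Rightarrow> ('a \<Rightarrow> real) \<Rightarrow> bool"
  where
  "cg_weak \<Omega> V wt v w \<longleftrightarrow>
     (\<forall>\<psi>\<in>V. (LINT x:\<Omega>|lebesgue. \<psi> x * (wt x + v x \<bullet> grad w x)) = 0)"

text \<open>\<open>v \<bullet> \<nu>\<close> is single-valued on \<open>\<Gamma>\<close> for \<open>v\<close> in \<open>HDiv_fe\<close>; its upwind value is used.\<close>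

definition dg_weak ::
    "'a::euclidean_space set \<Rightarrow> 'a set set \<Rightarrow> ('a set \<times> 'a) set \<Rightarrow> ('a set \<Rightarrow> 'a) \<Rightarrow> ('a \<Rightarrow> real) set
      \<Rightarrow> ('a \<Rightarrow> real) \<Rightarrow> ('a \<Rightarrow> 'a) \<Rightarrow> ('a \<Rightarrow> real) \<Rightarrow> bool" where
  "dg_weak \<Omega> \<K> P \<nu> V wt v w \<longleftrightarrow>
     (\<forall>\<eta>\<in>V. (LINT x:\<Omega>|lebesgue. \<eta> x * (wt x + v x \<bullet> grad w x))
        - (\<Sum>\<gamma>\<in>Gam \<K> P. surface_integral (fst \<gamma>) (\<nu> (fst \<gamma>))
             (\<lambda>x. (upwind \<K> \<nu> \<gamma> v x \<bullet> \<nu> (fst \<gamma>)) * face_avg \<K> \<nu> \<gamma> \<eta> x * face_jump \<K> \<nu> \<gamma> w x))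
        = 0)"

definition expand :: "nat \<Rightarrow> (nat \<Rightarrow> 'a \<Rightarrow> real) \<Rightarrow> (nat \<Rightarrow> real) \<Rightarrow> 'a \<Rightarrow> real" where
  "expand N \<phi> y x = (\<Sum>k<N. y k * \<phi> k x)"

text \<open>A basis modulo equality almost everywhere. Coefficient vectors are the entries below
  \<open>N\<close>; \<open>N = 0\<close> is possible since boundary conditions may leave only the zero function.\<close>

definition fe_basis ::
    "'a::euclidean_space set \<Rightarrow> ('a \<Rightarrow> real) set \<Rightarrow> nat \<Rightarrow> (nat \<Rightarrow> 'a \<Rightarrow> real) \<Rightarrow> bool" where
  "fe_basis \<Omega> V N \<phi> \<longleftrightarrow>
     (\<forall>k<N. \<phi> k \<in> V) \<and>
     (\<forall>y. (AE x\<in>\<Omega> in lebesgue. expand N \<phi> y x = 0) \<longrightarrow> (\<forall>k<N. y k = 0)) \<and>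
     (\<forall>w\<in>V. \<exists>y. AE x\<in>\<Omega> in lebesgue. w x = expand N \<phi> y x)"

text \<open>\<open>f\<close> is the right-hand side of the coefficient ODE. Since the mass matrix is invertible,
  the entries of \<open>f t y\<close> below \<open>N\<close> are uniquely determined.\<close>

definition cg_ode ::
    "'a::euclidean_space set \<Rightarrow> ('a \<Rightarrow> real) set \<Rightarrow> nat \<Rightarrow> (nat \<Rightarrow> 'a \<Rightarrow> real)
      \<Rightarrow> (real \<Rightarrow> ('a \<Rightarrow> real) \<Rightarrow> 'a \<Rightarrow> 'a) \<Rightarrow> (real \<Rightarrow> (nat \<Rightarrow> real) \<Rightarrow> nat \<Rightarrow> real) \<Rightarrow> bool" where
  "cg_ode \<Omega> V N \<phi> v f \<longleftrightarrow>
     (\<forall>t y. cg_weak \<Omega> V (expand N \<phi> (f t y)) (v t (expand N \<phi> y)) (expand N \<phi> y))"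

definition dg_ode ::
    "'a::euclidean_space set \<Rightarrow> 'a set set \<Rightarrow> ('a set \<times> 'a) set \<Rightarrow> ('a set \<Rightarrow> 'a) \<Rightarrow> ('a \<Rightarrow> real) set
      \<Rightarrow> nat \<Rightarrow> (nat \<Rightarrow> 'a \<Rightarrow> real)
      \<Rightarrow> (real \<Rightarrow> ('a \<Rightarrow> real) \<Rightarrow> 'a \<Rightarrow> 'a) \<Rightarrow> (real \<Rightarrow> (nat \<Rightarrow> real) \<Rightarrow> nat \<Rightarrow> real) \<Rightarrow> bool" where
  "dg_ode \<Omega> \<K> P \<nu> V N \<phi> v f \<longleftrightarrow>
     (\<forall>t y. dg_weak \<Omega> \<K> P \<nu> V (expand N \<phi> (f t y)) (v t (expand N \<phi> y)) (expand N \<phi> y))"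


section \<open>Symplectic Runge--Kutta integrators\<close>

definition symplectic_rk :: "nat \<Rightarrow> (nat \<Rightarrow> nat \<Rightarrow> real) \<Rightarrow> (nat \<Rightarrow> real) \<Rightarrow> bool" where
  "symplectic_rk m a b \<longleftrightarrow> (\<forall>i<m. \<forall>j<m. b i * a i j + b j * a j i = b i * b j)"

text \<open>One step of size \<open>h\<close> from \<open>y\<close> at time \<open>t\<close> to \<open>y'\<close> for \<open>N\<close>-dimensional \<open>f\<close>, with internal
  stages \<open>Y i\<close> for \<open>i < m\<close>.\<close>

definition rk_step ::
    "nat \<Rightarrow> (nat \<Rightarrow> nat \<Rightarrow> real) \<Rightarrow> (nat \<Rightarrow> real) \<Rightarrow> (nat \<Rightarrow> real)
      \<Rightarrow> nat \<Rightarrow> (real \<Rightarrow> (nat \<Rightarrow> real) \<Rightarrow> nat \<Rightarrow> real) \<Rightarrow> real \<Rightarrow> real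
      \<Rightarrow> (nat \<Rightarrow> real) \<Rightarrow> (nat \<Rightarrow> nat \<Rightarrow> real) \<Rightarrow> (nat \<Rightarrow> real) \<Rightarrow> bool" where
  "rk_step m a b c N f t h y Y y' \<longleftrightarrow>
     (\<forall>i<m. \<forall>k<N. Y i k = y k + h * (\<Sum>j<m. a i j * f (t + c j * h) (Y j) k)) \<and>
     (\<forall>k<N. y' k = y k + h * (\<Sum>j<m. b j * f (t + c j * h) (Y j) k))"

end

theory Submission
  imports Defs
begin

text \<open>Testing the weak form with the vorticity itself leaves the transport term
  \<open>\<integral> w (v \<bullet> grad w)\<close> minus the face terms. Since \<open>v\<close> is divergence free, on each cell
  \<open>w (v \<bullet> grad w)\<close> is the divergence of \<open>(w\<^sup>2 / 2) v\<close>, so the divergence theorem turns the transport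
  term into facet integrals; the two sides of a face contribute the jump of \<open>w\<^sup>2 / 2\<close>, i.e. average
  times jump of \<open>w\<close>, times the single-valued normal flux. This is exactly the face term (and it
  vanishes for continuous \<open>w\<close>). Hence the quadratic form \<open>\<integral> w\<^sup>2\<close> is a first integral of the
  coefficient ODE, and symplectic Runge--Kutta methods preserve quadratic first integrals.

  The divergence theorem on a polytope is obtained from cones: integrating in polar coordinates
  around an interior point \<open>x0\<close> gives \<open>\<integral>\<^sub>K div (f (x - x0)) = \<Sum>\<^sub>F h\<^sub>F \<integral>\<^sub>F f\<close>, where \<open>h\<^sub>F\<close> is the
  distance of \<open>x0\<close> from the facet \<open>F\<close>; both sides are affine in \<open>x0\<close>, and comparing base points
  gives the theorem for constant directions.\<close>

section \<open>Lebesgue measure on hyperplanes\<close>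

text \<open>The surface measure is the projection of a slab of height 1, so the natural tool is
  Fubini in the normal direction of one hyperplane; cones fit it because their slices parallel to a
  facet are rescaled copies of that facet. In dimension \<open>d\<close>, along a ray from
  \<open>x0\<close>, \<open>t ^ (d - 1) * (d * f + g \<bullet> (x - x0))\<close> is the derivative
  of \<open>t ^ d * f\<close>, so the radial integral is evaluated exactly. Nonnegative integrals
  spare integrability proofs until the facet formula is in place; signs are restored by adding a
  large constant to \<open>f\<close>. Base points range over an open set, which leaves room for the
  displacement that compares two of them.

  Functions are free on cell boundaries, so on each cell everything is replaced by its polynomial
  extension to the whole space, and traces become values of that polynomial.
  \<open>one_sided\<close> rests on a definite description, so each orientation of a face must be
  shown to single out one cell and one shift. Runge-Kutta stages need not lie on a solution curve;
  the semidiscrete law is therefore used state by state, as orthogonality of \<open>w\<close> and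
  its time derivative.\<close>

lemma nn_integral_lborel_affine:
  fixes u :: "'a::euclidean_space"
  assumes [measurable]: "f \<in> borel_measurable borel" and c: "c \<noteq> 0"
  shows "(\<integral>\<^sup>+x. f x \<partial>lborel) = ennreal (\<bar>c\<bar> ^ DIM('a)) * (\<integral>\<^sup>+x. f (u + c *\<^sub>R x) \<partial>lborel)"
  by (subst lborel_affine[OF c, of u])
     (simp add: nn_integral_density nn_integral_distr nn_integral_cmult)

lemma nn_integral_lborel_translation:
  fixes u :: "'a::euclidean_space"
  assumes [measurable]: "f \<in> borel_measurable borel"
  shows "(\<integral>\<^sup>+x. f (x + u) \<partial>lborel) = (\<integral>\<^sup>+x. f x \<partial>lborel)"
  using nn_integral_lborel_affine[OF assms, of 1 u] by (simp add: add.commute)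

lemma sets_hyperplane_measure [measurable_cong]:
  "sets (hyperplane_measure n c) = sets borel"
  by (simp add: hyperplane_measure_def)

lemma space_hyperplane_measure [simp]: "space (hyperplane_measure n c) = UNIV"
  by (simp add: hyperplane_measure_def)

text \<open>Unfolds the image measure into a volume integral over the slab; the changes of variables
  below are carried out in this \<open>lborel\<close> integral.\<close>

lemma nn_integral_hyperplane:
  assumes [measurable]: "f \<in> borel_measurable borel"
  shows "(\<integral>\<^sup>+x. f x \<partial>hyperplane_measure n c) =
    (\<integral>\<^sup>+y. indicator {0..1} (n \<bullet> y - c) * f (y - (n \<bullet> y - c) *\<^sub>R n) \<partial>lborel)"
proof -
  have [measurable]: "{y. c \<le> n \<bullet> y \<and> n \<bullet> y \<le> c + 1} \<in> sets lborel"
    by measurable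
  have "(\<integral>\<^sup>+x. f x \<partial>hyperplane_measure n c) =
      (\<integral>\<^sup>+y. f (y - (n \<bullet> y - c) *\<^sub>R n) * indicator {y. c \<le> n \<bullet> y \<and> n \<bullet> y \<le> c + 1} y \<partial>lborel)"
    unfolding hyperplane_measure_def
    by (subst nn_integral_distr) (auto simp: nn_integral_restrict_space intro!: measurable_restrict_space1)
  then show ?thesis
    by (simp add: mult.commute indicator_def algebra_simps cong: if_cong conj_cong)
qed

lemma nn_integral_hyperplane_translation:
  assumes [measurable]: "f \<in> borel_measurable borel"
  shows "(\<integral>\<^sup>+x. f (x + u) \<partial>hyperplane_measure n c) = (\<integral>\<^sup>+x. f x \<partial>hyperplane_measure n (c + n \<bullet> u))"
proof -
  have "(\<integral>\<^sup>+x. f x \<partial>hyperplane_measure n (c + n \<bullet> u)) =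
    (\<integral>\<^sup>+y. indicator {0..1} (n \<bullet> (y + u) - (c + n \<bullet> u)) * f ((y + u) - (n \<bullet> (y + u) - (c + n \<bullet> u)) *\<^sub>R n) \<partial>lborel)"
    by (subst nn_integral_hyperplane, simp, subst nn_integral_lborel_translation[where u=u]) simp_all
  also have "\<dots> = (\<integral>\<^sup>+x. f (x + u) \<partial>hyperplane_measure n c)"
    by (subst nn_integral_hyperplane) (simp_all add: inner_add_right algebra_simps)
  finally show ?thesis ..
qed

text \<open>With the normal reversed, the slab lies on the other side of the same hyperplane.
  Translation by \<open>n\<close> carries one slab onto the other and leaves the projection
  unchanged.\<close>

lemma nn_integral_hyperplane_uminus:
  assumes n: "norm n = 1" and [measurable]: "f \<in> borel_measurable borel"
  shows "(\<integral>\<^sup>+x. f x \<partial>hyperplane_measure (- n) (- c)) = (\<integral>\<^sup>+x. f x \<partial>hyperplane_measure n c)"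
proof -
  have nn: "n \<bullet> n = 1" using n by (simp add: norm_eq_1)
  have "(\<integral>\<^sup>+x. f x \<partial>hyperplane_measure (- n) (- c)) =
     (\<integral>\<^sup>+y. indicator {0..1} (c - n \<bullet> y) * f (y - (n \<bullet> y - c) *\<^sub>R n) \<partial>lborel)"
    by (subst nn_integral_hyperplane) (simp_all add: algebra_simps)
  also have "\<dots> = (\<integral>\<^sup>+y. indicator {0..1} (c - n \<bullet> (y - n)) * f ((y - n) - (n \<bullet> (y - n) - c) *\<^sub>R n) \<partial>lborel)"
    by (subst nn_integral_lborel_translation[where u="-n", symmetric]) simp_all
  also have "\<dots> = (\<integral>\<^sup>+y. indicator {0..1} (n \<bullet> y - c) * f (y - (n \<bullet> y - c) *\<^sub>R n) \<partial>lborel)"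
  proof (intro nn_integral_cong arg_cong2[where f="(*)"] arg_cong[where f=f])
    fix y
    show "indicator {0..1} (c - n \<bullet> (y - n)) = (indicator {0..1} (n \<bullet> y - c) :: ennreal)"
      by (auto simp: indicator_def inner_diff_right nn)
    show "y - n - (n \<bullet> (y - n) - c) *\<^sub>R n = y - (n \<bullet> y - c) *\<^sub>R n"
      by (simp add: inner_diff_right nn algebra_simps)
  qed
  also have "\<dots> = (\<integral>\<^sup>+x. f x \<partial>hyperplane_measure n c)"
    by (simp add: nn_integral_hyperplane)
  finally show ?thesis .
qed

text \<open>Since \<open>norm n = 1\<close>, the projection sends the whole slab onto
  \<open>n \<bullet> x = c\<close>; the measure, although defined on the full space, sees only
  values there.\<close>

lemma nn_integral_hyperplane_cong:
  assumes "norm n = 1" "f \<in> borel_measurable borel" "g \<in> borel_measurable borel"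
    and "\<And>x. n \<bullet> x = c \<Longrightarrow> f x = g x"
  shows "(\<integral>\<^sup>+x. f x \<partial>hyperplane_measure n c) = (\<integral>\<^sup>+x. g x \<partial>hyperplane_measure n c)"
proof -
  have nn: "n \<bullet> n = 1" using assms(1) by (simp add: norm_eq_1)
  show ?thesis
    using assms(2-3) unfolding nn_integral_hyperplane[OF assms(2)] nn_integral_hyperplane[OF assms(3)]
    by (intro nn_integral_cong arg_cong2[where f="(*)"] refl assms(4)) (simp add: inner_diff_right nn)
qed

text \<open>The normal position is described twice, by \<open>\<tau>\<close> and by the slab
  variable. Translating \<open>\<tau>\<close> and then \<open>y\<close> moves all dependence on
  \<open>\<tau>\<close> into the indicator, where it ranges over an interval of length 1; the height
  1 of the slab is what makes the normalisation come out right.\<close>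

lemma nn_integral_hyperplane_Fubini:
  fixes n :: "'a::euclidean_space"
  assumes n: "norm n = 1" and [measurable]: "f \<in> borel_measurable borel"
  shows "(\<integral>\<^sup>+x. f x \<partial>lborel) =
    (\<integral>\<^sup>+\<tau>. (\<integral>\<^sup>+z. f (z + \<tau> *\<^sub>R n) \<partial>hyperplane_measure n c) \<partial>lborel)"
proof -
  have nn: "n \<bullet> n = 1" using n by (simp add: norm_eq_1)
  have "(\<integral>\<^sup>+\<tau>. (\<integral>\<^sup>+z. f (z + \<tau> *\<^sub>R n) \<partial>hyperplane_measure n c) \<partial>lborel)
    = (\<integral>\<^sup>+\<tau>. (\<integral>\<^sup>+y. indicator {0..1} (n \<bullet> y - c) *
        f (y + (\<tau> + (c - n \<bullet> y)) *\<^sub>R n) \<partial>lborel) \<partial>lborel)"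
    by (subst nn_integral_hyperplane) (simp_all add: algebra_simps)
  also have "\<dots> = (\<integral>\<^sup>+y. (\<integral>\<^sup>+\<tau>. indicator {0..1} (n \<bullet> y - c) *
        f (y + (\<tau> + (c - n \<bullet> y)) *\<^sub>R n) \<partial>(lborel::real measure)) \<partial>lborel)"
    by (rule lborel_pair.Fubini') measurable
  also have "\<dots> = (\<integral>\<^sup>+y. (\<integral>\<^sup>+\<tau>. indicator {0..1} (n \<bullet> y - c) *
        f (y + \<tau> *\<^sub>R n) \<partial>(lborel::real measure)) \<partial>lborel)"
  proof (rule nn_integral_cong)
    fix y
    show "(\<integral>\<^sup>+\<tau>. indicator {0..1} (n \<bullet> y - c) * f (y + (\<tau> + (c - n \<bullet> y)) *\<^sub>R n) \<partial>(lborel::real measure))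
      = (\<integral>\<^sup>+\<tau>. indicator {0..1} (n \<bullet> y - c) * f (y + \<tau> *\<^sub>R n) \<partial>(lborel::real measure))"
      using nn_integral_lborel_translation[of "\<lambda>\<tau>. indicator {0..1} (n \<bullet> y - c) * f (y + \<tau> *\<^sub>R n)" "c - n \<bullet> y"]
      by simp
  qed
  also have "\<dots> = (\<integral>\<^sup>+\<tau>. (\<integral>\<^sup>+y. indicator {0..1} (n \<bullet> y - c) *
        f (y + \<tau> *\<^sub>R n) \<partial>lborel) \<partial>(lborel::real measure))"
    by (rule lborel_pair.Fubini') measurable
  also have "\<dots> = (\<integral>\<^sup>+\<tau>. (\<integral>\<^sup>+y. indicator {0..1} (n \<bullet> y - \<tau> - c) * f y \<partial>lborel) \<partial>(lborel::real measure))"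
  proof (rule nn_integral_cong)
    fix \<tau> :: real
    show "(\<integral>\<^sup>+y. indicator {0..1} (n \<bullet> y - c) * f (y + \<tau> *\<^sub>R n) \<partial>lborel) =
      (\<integral>\<^sup>+y. indicator {0..1} (n \<bullet> y - \<tau> - c) * f y \<partial>lborel)"
      by (subst nn_integral_lborel_translation[where u="\<tau> *\<^sub>R n", symmetric]) (simp_all add: inner_add_right nn)
  qed
  also have "\<dots> = (\<integral>\<^sup>+y. (\<integral>\<^sup>+\<tau>. indicator {0..1} (n \<bullet> y - \<tau> - c) * f y \<partial>(lborel::real measure)) \<partial>lborel)"
    by (rule lborel_pair.Fubini') measurable
  also have "\<dots> = (\<integral>\<^sup>+y. f y \<partial>lborel)"
  proof (rule nn_integral_cong)
    fix y
    have "(\<integral>\<^sup>+\<tau>. indicator {0..1} (n \<bullet> y - \<tau> - c) * f y \<partial>(lborel::real measure))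
      = (\<integral>\<^sup>+\<tau>. f y * indicator {n \<bullet> y - c - 1..n \<bullet> y - c} \<tau> \<partial>(lborel::real measure))"
      by (intro nn_integral_cong) (auto simp: indicator_def)
    also have "\<dots> = f y"
      by (subst nn_integral_cmult_indicator) auto
    finally show "(\<integral>\<^sup>+\<tau>. indicator {0..1} (n \<bullet> y - \<tau> - c) * f y \<partial>(lborel::real measure)) = f y" .
  qed
  finally show ?thesis ..
qed

text \<open>The exponent comes from two effects: scaling volume gives \<open>t ^ DIM('a)\<close>,
  while the unit slab becomes a slab of height \<open>1 / t\<close>, which by Fubini contributes
  that factor.\<close>

lemma nn_integral_hyperplane_scale:
  fixes n :: "'a::euclidean_space"
  assumes n: "norm n = 1" and t: "t > 0" and [measurable]: "f \<in> borel_measurable borel"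
  shows "ennreal (t ^ (DIM('a) - 1)) * (\<integral>\<^sup>+x. f (t *\<^sub>R x) \<partial>hyperplane_measure n 0)
    = (\<integral>\<^sup>+x. f x \<partial>hyperplane_measure n 0)"
proof -
  have nn: "n \<bullet> n = 1" using n by (simp add: norm_eq_1)
  let ?g = "\<lambda>y. f (t *\<^sub>R (y - (n \<bullet> y) *\<^sub>R n))"
  let ?I = "\<integral>\<^sup>+x. f (t *\<^sub>R x) \<partial>hyperplane_measure n 0"
  have "(\<integral>\<^sup>+x. f x \<partial>hyperplane_measure n 0) =
      (\<integral>\<^sup>+y. indicator {0..1} (n \<bullet> y) * f (y - (n \<bullet> y) *\<^sub>R n) \<partial>lborel)"
    by (simp add: nn_integral_hyperplane)
  also have "\<dots> = ennreal (t ^ DIM('a)) *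
      (\<integral>\<^sup>+y. indicator {0..1} (n \<bullet> (t *\<^sub>R y)) * f (t *\<^sub>R y - (n \<bullet> (t *\<^sub>R y)) *\<^sub>R n) \<partial>lborel)"
    using t by (subst nn_integral_lborel_affine[where c=t and u=0]) simp_all
  also have "(\<integral>\<^sup>+y. indicator {0..1} (n \<bullet> (t *\<^sub>R y)) * f (t *\<^sub>R y - (n \<bullet> (t *\<^sub>R y)) *\<^sub>R n) \<partial>lborel)
     = (\<integral>\<^sup>+y. indicator {0..1/t} (n \<bullet> y) * ?g y \<partial>lborel)"
    using t by (intro nn_integral_cong arg_cong2[where f="(*)"])
      (auto simp: indicator_def field_simps zero_le_mult_iff scaleR_diff_right)
  also have "\<dots> = (\<integral>\<^sup>+\<tau>. (\<integral>\<^sup>+z. indicator {0..1/t} (n \<bullet> (z + \<tau> *\<^sub>R n)) * ?g (z + \<tau> *\<^sub>R n) \<partial>hyperplane_measure n 0) \<partial>lborel)"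
    by (rule nn_integral_hyperplane_Fubini[OF n]) measurable
  also have "\<dots> = (\<integral>\<^sup>+\<tau>. (\<integral>\<^sup>+z. indicator {0..1/t} \<tau> * f (t *\<^sub>R z) \<partial>hyperplane_measure n 0) \<partial>lborel)"
    by (intro nn_integral_cong nn_integral_hyperplane_cong[OF n]) (simp_all add: inner_add_right nn)
  also have "\<dots> = (\<integral>\<^sup>+\<tau>. ?I * indicator {0..1/t} \<tau> \<partial>lborel)"
    by (subst nn_integral_cmult) (simp_all add: mult.commute)
  also have "\<dots> = ?I * ennreal (1 / t)"
    using t by (subst nn_integral_cmult_indicator) auto
  finally have "(\<integral>\<^sup>+x. f x \<partial>hyperplane_measure n 0) = ennreal (t ^ DIM('a)) * (?I * ennreal (1 / t))" .
  also have "\<dots> = ennreal (t ^ DIM('a) * (1 / t)) * ?I"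
    using t by (subst ennreal_mult) (simp_all add: mult_ac)
  also have "t ^ DIM('a) * (1 / t) = t ^ (DIM('a) - 1)"
    using t by (simp add: power_diff)
  finally show ?thesis ..
qed

text \<open>Coordinates \<open>x = x0 + t *\<^sub>R (y - x0)\<close> with \<open>y\<close> on
  \<open>n \<bullet> y = c\<close>: the slice through \<open>x\<close> has height
  \<open>h * t\<close> above \<open>x0\<close> and is the hyperplane dilated by \<open>t\<close>,
  whence the Jacobian \<open>h * t ^ (DIM('a) - 1)\<close>.\<close>

lemma nn_integral_cone_Fubini:
  fixes n :: "'a::euclidean_space"
  assumes n: "norm n = 1" and h: "h > 0" "h = c - n \<bullet> x0"
    and [measurable]: "f \<in> borel_measurable borel"
  shows "(\<integral>\<^sup>+x. indicator {0<..} (n \<bullet> (x - x0)) * f x \<partial>lborel) =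
    (\<integral>\<^sup>+t. indicator {0<..} t * ennreal (h * t ^ (DIM('a) - 1)) *
       (\<integral>\<^sup>+y. f (x0 + t *\<^sub>R (y - x0)) \<partial>hyperplane_measure n c) \<partial>lborel)"
proof -
  have nn: "n \<bullet> n = 1" using n by (simp add: norm_eq_1)
  let ?d = "DIM('a) - 1"
  have "(\<integral>\<^sup>+x. indicator {0<..} (n \<bullet> (x - x0)) * f x \<partial>lborel)
     = (\<integral>\<^sup>+x. indicator {0<..} (n \<bullet> x) * f (x + x0) \<partial>lborel)"
    by (subst nn_integral_lborel_translation[where u=x0, symmetric]) simp_all
  also have "\<dots> = (\<integral>\<^sup>+\<tau>. (\<integral>\<^sup>+z. indicator {0<..} (n \<bullet> (z + \<tau> *\<^sub>R n)) * f ((z + \<tau> *\<^sub>R n) + x0) \<partial>hyperplane_measure n 0) \<partial>lborel)"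
    by (rule nn_integral_hyperplane_Fubini[OF n]) measurable
  also have "\<dots> = (\<integral>\<^sup>+\<tau>. (\<integral>\<^sup>+z. indicator {0<..} \<tau> * f ((z + \<tau> *\<^sub>R n) + x0) \<partial>hyperplane_measure n 0) \<partial>lborel)"
    by (intro nn_integral_cong nn_integral_hyperplane_cong[OF n]) (simp_all add: inner_add_right nn)
  also have "\<dots> = (\<integral>\<^sup>+\<tau>. indicator {0<..} \<tau> * (\<integral>\<^sup>+z. f ((z + \<tau> *\<^sub>R n) + x0) \<partial>hyperplane_measure n 0) \<partial>lborel)"
    by (subst nn_integral_cmult) simp_all
  also have "\<dots> = (\<integral>\<^sup>+\<tau>. indicator {0<..} \<tau> *
     (\<integral>\<^sup>+z. indicator {0..1} (n \<bullet> z) * f (((z - (n \<bullet> z) *\<^sub>R n) + \<tau> *\<^sub>R n) + x0) \<partial>lborel) \<partial>lborel)"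
    by (subst nn_integral_hyperplane) simp_all
  \<comment> \<open>The height is replaced by \<open>h * t\<close>, so that \<open>t = 1\<close> is
    the hyperplane \<open>n \<bullet> x = c\<close> itself.\<close>
  also have "\<dots> = ennreal h * (\<integral>\<^sup>+t. indicator {0<..} (h * t) *
     (\<integral>\<^sup>+z. indicator {0..1} (n \<bullet> z) * f (((z - (n \<bullet> z) *\<^sub>R n) + (h * t) *\<^sub>R n) + x0) \<partial>lborel) \<partial>lborel)"
    using h(1) by (subst nn_integral_real_affine[where c=h and t=0]) simp_all
  also have "\<dots> = ennreal h * (\<integral>\<^sup>+t. indicator {0<..} t *
     (\<integral>\<^sup>+z. f ((z + (h * t) *\<^sub>R n) + x0) \<partial>hyperplane_measure n 0) \<partial>lborel)"
    using h(1) by (subst nn_integral_hyperplane)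
      (simp_all add: indicator_def zero_less_mult_iff cong: if_cong)
  also have "\<dots> = ennreal h * (\<integral>\<^sup>+t. indicator {0<..} t * ennreal (t ^ ?d) *
     (\<integral>\<^sup>+y. f (x0 + t *\<^sub>R (y - x0)) \<partial>hyperplane_measure n c) \<partial>lborel)"
  proof (intro arg_cong[where f="\<lambda>x. ennreal h * x"] nn_integral_cong)
    fix t :: real
    have "(\<integral>\<^sup>+z. f ((z + (h * t) *\<^sub>R n) + x0) \<partial>hyperplane_measure n 0) =
       ennreal (t ^ ?d) * (\<integral>\<^sup>+y. f (x0 + t *\<^sub>R (y - x0)) \<partial>hyperplane_measure n c)" if t: "t > 0"
    proof -
      have "(\<integral>\<^sup>+z. f ((z + (h * t) *\<^sub>R n) + x0) \<partial>hyperplane_measure n 0) =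
        ennreal (t ^ ?d) * (\<integral>\<^sup>+z. f ((t *\<^sub>R z + (h * t) *\<^sub>R n) + x0) \<partial>hyperplane_measure n 0)"
        by (rule nn_integral_hyperplane_scale[OF n t, symmetric]) measurable
      also have "(\<integral>\<^sup>+z. f ((t *\<^sub>R z + (h * t) *\<^sub>R n) + x0) \<partial>hyperplane_measure n 0) =
         (\<integral>\<^sup>+z. f (x0 + t *\<^sub>R ((z + (x0 + h *\<^sub>R n)) - x0)) \<partial>hyperplane_measure n 0)"
        by (simp add: algebra_simps)
      also have "\<dots> = (\<integral>\<^sup>+y. f (x0 + t *\<^sub>R (y - x0)) \<partial>hyperplane_measure n (0 + n \<bullet> (x0 + h *\<^sub>R n)))"
        by (rule nn_integral_hyperplane_translation) measurable
      also have "0 + n \<bullet> (x0 + h *\<^sub>R n) = c"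
        by (simp add: inner_add_right nn h(2))
      finally show ?thesis .
    qed
    then show "indicator {0<..} t * (\<integral>\<^sup>+z. f ((z + (h * t) *\<^sub>R n) + x0) \<partial>hyperplane_measure n 0) =
       indicator {0<..} t * ennreal (t ^ ?d) * (\<integral>\<^sup>+y. f (x0 + t *\<^sub>R (y - x0)) \<partial>hyperplane_measure n c)"
      by (auto simp: indicator_def)
  qed
  also have "\<dots> = (\<integral>\<^sup>+t. ennreal h * (indicator {0<..} t * ennreal (t ^ ?d) *
     (\<integral>\<^sup>+y. f (x0 + t *\<^sub>R (y - x0)) \<partial>hyperplane_measure n c)) \<partial>lborel)"
    by (subst nn_integral_hyperplane, simp, subst nn_integral_cmult) (simp_all add: nn_integral_hyperplane)
  also have "\<dots> = (\<integral>\<^sup>+t. indicator {0<..} t * ennreal (h * t ^ ?d) *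
       (\<integral>\<^sup>+y. f (x0 + t *\<^sub>R (y - x0)) \<partial>hyperplane_measure n c) \<partial>lborel)"
    using h(1) by (intro nn_integral_cong) (auto simp: indicator_def ennreal_mult' mult_ac)
  finally show ?thesis .
qed

section \<open>Cones over facets\<close>

text \<open>After unfolding the slab both integrations are against \<open>lborel\<close>, so this is
  Fubini for a sigma-finite pair.\<close>

lemma nn_integral_hyperplane_swap:
  assumes [measurable]: "(\<lambda>(t, y). f t y) \<in> borel_measurable (borel \<Otimes>\<^sub>M borel)"
  shows "(\<integral>\<^sup>+t. (\<integral>\<^sup>+y. f t y \<partial>hyperplane_measure n c) \<partial>(lborel :: real measure)) =
    (\<integral>\<^sup>+y. (\<integral>\<^sup>+t. f t y \<partial>lborel) \<partial>hyperplane_measure n c)"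
proof -
  have "(\<integral>\<^sup>+t. (\<integral>\<^sup>+y. f t y \<partial>hyperplane_measure n c) \<partial>(lborel :: real measure)) =
    (\<integral>\<^sup>+t. (\<integral>\<^sup>+y. indicator {0..1} (n \<bullet> y - c) * f t (y - (n \<bullet> y - c) *\<^sub>R n) \<partial>lborel) \<partial>lborel)"
    by (subst nn_integral_hyperplane) simp_all
  also have "\<dots> = (\<integral>\<^sup>+y. (\<integral>\<^sup>+t. indicator {0..1} (n \<bullet> y - c) * f t (y - (n \<bullet> y - c) *\<^sub>R n) \<partial>lborel) \<partial>lborel)"
    by (rule lborel_pair.Fubini') measurable
  also have "\<dots> = (\<integral>\<^sup>+y. (\<integral>\<^sup>+t. f t y \<partial>lborel) \<partial>hyperplane_measure n c)"
    by (subst nn_integral_hyperplane) (simp_all add: nn_integral_cmult)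
  finally show ?thesis .
qed

text \<open>The prism of height 1 over a set of radius \<open>R\<close> lies in a ball of radius
  \<open>R + 1\<close>.\<close>

lemma emeasure_hyperplane_bounded:
  fixes S :: "'a::euclidean_space set"
  assumes n: "norm n = 1" and "bounded S" and [measurable]: "S \<in> sets borel"
  shows "emeasure (hyperplane_measure n c) S < \<infinity>"
proof -
  obtain R where R: "\<And>x. x \<in> S \<Longrightarrow> norm x \<le> R"
    using \<open>bounded S\<close> by (auto simp: bounded_iff)
  have "emeasure (hyperplane_measure n c) S = (\<integral>\<^sup>+x. indicator S x \<partial>hyperplane_measure n c)"
    by (simp add: nn_integral_indicator sets_hyperplane_measure)
  also have "\<dots> = (\<integral>\<^sup>+y. indicator {0..1} (n \<bullet> y - c) * indicator S (y - (n \<bullet> y - c) *\<^sub>R n) \<partial>lborel)"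
    by (rule nn_integral_hyperplane) measurable
  also have "\<dots> \<le> (\<integral>\<^sup>+y. indicator (cball (0::'a) (R + 1)) y \<partial>lborel)"
  proof (intro nn_integral_mono)
    fix y
    have "norm y \<le> R + 1" if "0 \<le> n \<bullet> y - c" "n \<bullet> y - c \<le> 1" "y - (n \<bullet> y - c) *\<^sub>R n \<in> S"
    proof -
      have "norm y \<le> norm (y - (n \<bullet> y - c) *\<^sub>R n) + norm ((n \<bullet> y - c) *\<^sub>R n)"
        by (metis diff_add_cancel norm_triangle_ineq)
      also have "\<dots> \<le> R + 1"
        using that n by (intro add_mono R) auto
      finally show ?thesis .
    qed
    then show "indicator {0..1} (n \<bullet> y - c) * indicator S (y - (n \<bullet> y - c) *\<^sub>R n)
        \<le> (indicator (cball 0 (R + 1)) y :: ennreal)"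
      by (auto simp: indicator_def)
  qed
  also have "\<dots> = emeasure lborel (cball (0::'a) (R + 1))"
    by simp
  also have "\<dots> < \<infinity>"
    by (rule emeasure_bounded_finite) simp
  finally show ?thesis .
qed

lemma integrable_compact_times:
  fixes f :: "'a::euclidean_space \<Rightarrow> real"
  assumes M: "sets M = sets borel" "emeasure M S < \<infinity>" and "compact S" "continuous_on UNIV f"
  shows "integrable M (\<lambda>x. indicator S x * f x)"
proof -
  have S: "S \<in> sets borel" using \<open>compact S\<close> by (rule borel_compact)
  have [measurable]: "f \<in> borel_measurable M" "S \<in> sets M"
    using S assms by (auto simp: M(1) cong: measurable_cong_sets intro: borel_measurable_continuous_onI)
  have "bounded (f ` S)"
    using assms continuous_on_subset by (blast intro: compact_imp_bounded compact_continuous_image)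
  then obtain B where "\<And>x. x \<in> S \<Longrightarrow> norm (f x) \<le> B" by (auto simp: bounded_iff)
  then show ?thesis
    using M by (intro integrableI_bounded_set[where A=S and B=B]) (auto simp: indicator_def)
qed

lemma integrable_hyperplane_compact:
  fixes f :: "'a::euclidean_space \<Rightarrow> real"
  assumes "norm n = 1" "compact S" "continuous_on UNIV f"
  shows "integrable (hyperplane_measure n c) (\<lambda>x. indicator S x * f x)"
  using assms by (intro integrable_compact_times emeasure_hyperplane_bounded)
    (auto simp: sets_hyperplane_measure compact_imp_bounded borel_compact)

lemma integrable_lborel_compact:
  fixes f :: "'a::euclidean_space \<Rightarrow> real"
  assumes "compact S" "continuous_on UNIV f"
  shows "integrable lborel (\<lambda>x. indicator S x * f x)"
  using assms by (intro integrable_compact_times emeasure_bounded_finite) (auto simp: compact_imp_bounded)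

text \<open>A small step from \<open>x\<close> in the direction \<open>n\<close> stays in
  \<open>K\<close> and strictly increases \<open>n \<bullet> x\<close>.\<close>

lemma outward_normal_interior_less:
  assumes "outward_normal K F n" "y \<in> F" "x \<in> interior K"
  shows "n \<bullet> x < n \<bullet> y"
proof -
  obtain e where e: "e > 0" "ball x e \<subseteq> K" using assms(3) mem_interior by blast
  have n: "n \<bullet> n = 1" and le: "\<And>z. z \<in> K \<Longrightarrow> n \<bullet> z \<le> n \<bullet> y"
    using assms by (auto simp: outward_normal_def norm_eq_1)
  then have "norm n = 1" by (simp add: norm_eq_1)
  then have "x + (e/2) *\<^sub>R n \<in> K"
    using e by (intro subsetD[OF e(2)]) (auto simp: dist_norm)
  from le[OF this] show ?thesis using e n by (simp add: inner_add_right)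
qed

lemma outward_normal_const:
  assumes "outward_normal K F n" "F facet_of K" "x \<in> F" "y \<in> F"
  shows "n \<bullet> x = n \<bullet> y"
proof -
  have "F \<subseteq> K" by (rule facet_of_imp_subset[OF assms(2)])
  then show ?thesis
    using assms unfolding outward_normal_def by (meson antisym subsetD)
qed

text \<open>Faces of polyhedra are exposed, so a supporting functional exists; it is nonzero because
  \<open>F\<close> is neither empty nor all of \<open>K\<close>, and can be normalised.\<close>

lemma facet_outward_normal_exists:
  assumes "polytope K" "interior K \<noteq> {}" "F facet_of K"
  obtains n where "outward_normal K F n"
proof -
  have face: "F face_of K" "F \<noteq> {}" "F \<noteq> K"
    using assms(3) by (auto simp: facet_of_def)
  then have "F exposed_face_of K"
    using assms(1) by (simp add: exposed_face_of_polyhedron polytope_imp_polyhedron)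
  then obtain a b where ab: "K \<subseteq> {x. a \<bullet> x \<le> b}" "F = K \<inter> {x. a \<bullet> x = b}"
    by (auto simp: exposed_face_of_def)
  have "a \<noteq> 0" using ab face by auto
  then have "outward_normal K F (a /\<^sub>R norm a)"
    using ab by (auto simp: outward_normal_def divide_right_mono divide_simps)
  then show ?thesis using that by blast
qed

lemma mem_convex_hull_insert:
  assumes "convex S" "S \<noteq> {}"
  shows "x \<in> convex hull (insert a S) \<longleftrightarrow>
    (\<exists>s y. 0 \<le> s \<and> s \<le> 1 \<and> y \<in> S \<and> x = a + s *\<^sub>R (y - a))"
proof -
  have "convex hull S = S" using assms by (simp add: hull_same)
  then have "x \<in> convex hull (insert a S) \<longleftrightarrow>
      (\<exists>s y. 0 \<le> s \<and> s \<le> 1 \<and> y \<in> S \<and> x = (1 - s) *\<^sub>R a + s *\<^sub>R y)"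
    using assms unfolding convex_hull_insert_alt by auto
  moreover have "(1 - s) *\<^sub>R a + s *\<^sub>R y = a + s *\<^sub>R (y - a)" for s y
    by (simp add: algebra_simps)
  ultimately show ?thesis by simp
qed

text \<open>The integrand is the divergence of the radial field
  \<open>f x *\<^sub>R (x - x0)\<close>, which is tangent to the lateral sides of the cone, so only
  the base contributes. Nonnegativity permits working in \<open>ennreal\<close>.\<close>

lemma cone_nn_integral:
  fixes n :: "'a::euclidean_space"
  assumes n: "norm n = 1" and F: "compact F" "convex F" "F \<noteq> {}" "\<And>y. y \<in> F \<Longrightarrow> n \<bullet> y = c"
    and h: "h > 0" "h = c - n \<bullet> x0"
    and f: "\<And>x. (f has_derivative (\<lambda>u. g x \<bullet> u)) (at x)" and g: "continuous_on UNIV g"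
    and nonneg: "\<And>x. x \<in> convex hull (insert x0 F) \<Longrightarrow> 0 \<le> real DIM('a) * f x + g x \<bullet> (x - x0)"
      "\<And>x. x \<in> F \<Longrightarrow> 0 \<le> f x"
  shows "(\<integral>\<^sup>+x. indicator (convex hull (insert x0 F)) x * ennreal (real DIM('a) * f x + g x \<bullet> (x - x0)) \<partial>lborel)
     = (\<integral>\<^sup>+y. indicator F y * ennreal (h * f y) \<partial>hyperplane_measure n c)"
proof -
  let ?C = "convex hull (insert x0 F)" and ?d = "DIM('a) - 1"
  define e where "e x = real DIM('a) * f x + g x \<bullet> (x - x0)" for x
  note hull = mem_convex_hull_insert[OF F(2,3), where a=x0]
  have "continuous_on UNIV f"
    by (intro continuous_at_imp_continuous_on ballI has_derivative_continuous[OF f])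
  then have [measurable]: "f \<in> borel_measurable borel" "g \<in> borel_measurable borel"
    using g by (auto intro: borel_measurable_continuous_onI)
  have [measurable]: "e \<in> borel_measurable borel" unfolding e_def by measurable
  have "compact ?C" using F by (intro compact_convex_hull compact_insert)
  then have [measurable]: "?C \<in> sets borel" "F \<in> sets borel" using F by (auto intro: borel_compact)
  \<comment> \<open>Except for its apex the cone lies in the open half space over which the cone
    coordinates integrate; the hyperplane through the apex is discarded as a null set.\<close>
  have "n \<noteq> 0" using n by auto
  then have "negligible {x. n \<bullet> x = n \<bullet> x0}" by (simp add: negligible_hyperplane)
  then have AE0: "AE x in lborel. n \<bullet> x \<noteq> n \<bullet> x0"
    using AE_not_in[of "{x. n \<bullet> x = n \<bullet> x0}" lebesgue]
    by (simp add: negligible_iff_null_sets AE_completion_iff)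
  have "(\<integral>\<^sup>+x. indicator ?C x * ennreal (e x) \<partial>lborel)
     = (\<integral>\<^sup>+x. indicator {0<..} (n \<bullet> (x - x0)) * (indicator ?C x * ennreal (e x)) \<partial>lborel)"
  proof (rule nn_integral_cong_AE, use AE0 in eventually_elim)
    fix x assume x: "n \<bullet> x \<noteq> n \<bullet> x0"
    have "n \<bullet> (x - x0) > 0" if x_in: "x \<in> ?C"
    proof -
      obtain s y where "0 \<le> s \<and> s \<le> 1 \<and> y \<in> F \<and> x = x0 + s *\<^sub>R (y - x0)"
        using x_in hull by metis
      then have sy: "0 \<le> s" "y \<in> F" "x = x0 + s *\<^sub>R (y - x0)" by simp_all
      have "n \<bullet> (x - x0) = s * h" unfolding sy(3) h(2) by (simp add: inner_diff_right F(4)[OF sy(2)])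
      moreover have "s \<noteq> 0" using sy(3) x by (cases "s = 0") simp_all
      ultimately show ?thesis using sy(1) h(1) by (simp add: zero_less_mult_iff less_le)
    qed
    then show "indicator ?C x * ennreal (e x) =
        indicator {0<..} (n \<bullet> (x - x0)) * (indicator ?C x * ennreal (e x))"
      by (cases "x \<in> ?C") simp_all
  qed
  also have "\<dots> = (\<integral>\<^sup>+t. indicator {0<..} t * ennreal (h * t ^ ?d) *
       (\<integral>\<^sup>+y. indicator ?C (x0 + t *\<^sub>R (y - x0)) * ennreal (e (x0 + t *\<^sub>R (y - x0))) \<partial>hyperplane_measure n c) \<partial>lborel)"
    using nn_integral_cone_Fubini[OF n h, of "\<lambda>x. indicator ?C x * ennreal (e x)"] by simp
  also have "\<dots> = (\<integral>\<^sup>+t. indicator {0<..} t * ennreal (h * t ^ ?d) *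
       (\<integral>\<^sup>+y. indicator {..1} t * indicator F y * ennreal (e (x0 + t *\<^sub>R (y - x0))) \<partial>hyperplane_measure n c) \<partial>lborel)"
  proof (rule nn_integral_cong)
    fix t :: real
    have "(\<integral>\<^sup>+y. indicator ?C (x0 + t *\<^sub>R (y - x0)) * ennreal (e (x0 + t *\<^sub>R (y - x0))) \<partial>hyperplane_measure n c)
       = (\<integral>\<^sup>+y. indicator {..1} t * indicator F y * ennreal (e (x0 + t *\<^sub>R (y - x0))) \<partial>hyperplane_measure n c)"
      if t: "t > 0"
    proof (rule nn_integral_hyperplane_cong[OF n])
      fix y assume y: "n \<bullet> y = c"
      have "x0 + t *\<^sub>R (y - x0) \<in> ?C \<longleftrightarrow> t \<le> 1 \<and> y \<in> F"
      proof
        assume "x0 + t *\<^sub>R (y - x0) \<in> ?C"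
        then obtain s z where "0 \<le> s \<and> s \<le> 1 \<and> z \<in> F \<and> x0 + t *\<^sub>R (y - x0) = x0 + s *\<^sub>R (z - x0)"
          by (metis hull)
        then have sz: "s \<le> 1" "z \<in> F" "t *\<^sub>R (y - x0) = s *\<^sub>R (z - x0)" by simp_all
        \<comment> \<open>\<open>y\<close> and \<open>z\<close> have the same height above
          \<open>x0\<close>, so applying \<open>n\<close> identifies the two ray parameters.\<close>
        from arg_cong[OF sz(3), of "\<lambda>x. n \<bullet> x"] have "t * h = s * h"
          using y F(4)[OF sz(2)] h by (simp add: inner_diff_right)
        then have "t = s" using h(1) by simp
        then show "t \<le> 1 \<and> y \<in> F" using sz t by simp
      next
        assume "t \<le> 1 \<and> y \<in> F"
        then show "x0 + t *\<^sub>R (y - x0) \<in> ?C"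
          unfolding hull using t by (intro exI[of _ t] exI[of _ y]) simp
      qed
      then show "indicator ?C (x0 + t *\<^sub>R (y - x0)) * ennreal (e (x0 + t *\<^sub>R (y - x0))) =
          indicator {..1} t * indicator F y * ennreal (e (x0 + t *\<^sub>R (y - x0)))"
        by (auto simp: indicator_def)
    qed measurable
    then show "indicator {0<..} t * ennreal (h * t ^ ?d) *
       (\<integral>\<^sup>+y. indicator ?C (x0 + t *\<^sub>R (y - x0)) * ennreal (e (x0 + t *\<^sub>R (y - x0))) \<partial>hyperplane_measure n c)
      = indicator {0<..} t * ennreal (h * t ^ ?d) *
       (\<integral>\<^sup>+y. indicator {..1} t * indicator F y * ennreal (e (x0 + t *\<^sub>R (y - x0))) \<partial>hyperplane_measure n c)"
      by (auto simp: indicator_def)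
  qed
  also have "\<dots> = (\<integral>\<^sup>+t. (\<integral>\<^sup>+y. indicator {0<..} t * ennreal (h * t ^ ?d) *
       (indicator {..1} t * indicator F y * ennreal (e (x0 + t *\<^sub>R (y - x0)))) \<partial>hyperplane_measure n c) \<partial>lborel)"
    by (intro nn_integral_cong nn_integral_cmult[symmetric]) measurable
  also have "\<dots> = (\<integral>\<^sup>+y. (\<integral>\<^sup>+t. indicator {0<..} t * ennreal (h * t ^ ?d) *
       (indicator {..1} t * indicator F y * ennreal (e (x0 + t *\<^sub>R (y - x0)))) \<partial>lborel) \<partial>hyperplane_measure n c)"
    by (rule nn_integral_hyperplane_swap) measurable
  also have "\<dots> = (\<integral>\<^sup>+y. indicator F y * ennreal (h * f y) \<partial>hyperplane_measure n c)"
  proof (rule nn_integral_cong)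
    fix y
    let ?p = "\<lambda>t. x0 + t *\<^sub>R (y - x0)"
    show "(\<integral>\<^sup>+t. indicator {0<..} t * ennreal (h * t ^ ?d) *
       (indicator {..1} t * indicator F y * ennreal (e (?p t))) \<partial>lborel) = indicator F y * ennreal (h * f y)"
    proof (cases "y \<in> F")
      case True
      have e: "0 \<le> e (?p t)" if "0 \<le> t" "t \<le> 1" for t
        unfolding e_def using that True by (intro nonneg(1)) (auto simp only: hull)
      have "(\<integral>\<^sup>+t. indicator {0<..} t * ennreal (h * t ^ ?d) *
          (indicator {..1} t * indicator F y * ennreal (e (?p t))) \<partial>lborel) =
          (\<integral>\<^sup>+t. ennreal (h * (t ^ ?d * e (?p t))) * indicator {0..1} t \<partial>lborel)"
      proof (rule nn_integral_cong_AE)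
        have "AE t in lborel. t \<noteq> (0::real)" by (rule AE_lborel_singleton)
        then show "AE t in lborel. indicator {0<..} t * ennreal (h * t ^ ?d) *
          (indicator {..1} t * indicator F y * ennreal (e (?p t))) =
          ennreal (h * (t ^ ?d * e (?p t))) * indicator {0..1} t"
        proof eventually_elim
          case (elim t)
          then show ?case
            using True h(1) e[of t] by (auto simp: indicator_def ennreal_mult[symmetric] mult.assoc)
        qed
      qed
      \<comment> \<open>The antiderivative vanishes at \<open>t = 0\<close> because the dimension is
        positive; \<open>t = 1\<close> gives the value on the facet.\<close>
      also have "\<dots> = ennreal (h * (1 ^ DIM('a) * f (?p 1)) - h * (0 ^ DIM('a) * f (?p 0)))"
      proof (rule nn_integral_FTC_Icc)
        fix t :: real
        assume "t \<in> {0..1}"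
        then have t: "0 \<le> t" "t \<le> 1" by auto
        show "0 \<le> h * (t ^ ?d * e (?p t))" using h(1) t(1) e[OF t] by simp
        have "((\<lambda>t. f (?p t)) has_derivative (\<lambda>u. g (?p t) \<bullet> (u *\<^sub>R (y - x0)))) (at t)"
          by (rule has_derivative_compose[OF _ f]) (auto intro!: derivative_eq_intros)
        then have D: "((\<lambda>t. f (?p t)) has_real_derivative (g (?p t) \<bullet> (y - x0))) (at t)"
          by (rule has_derivative_imp_has_field_derivative) simp
        have dd: "t ^ DIM('a) = t * t ^ ?d"
          using DIM_positive[where 'a='a] by (cases "DIM('a)") simp_all
        show "((\<lambda>t. h * (t ^ DIM('a) * f (?p t))) has_real_derivative h * (t ^ ?d * e (?p t))) (at t)"
          using DERIV_cmult[OF DERIV_mult[OF DERIV_pow[of "DIM('a)" t] D], of h]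
          by (simp add: e_def dd algebra_simps)
      qed simp_all
      finally show ?thesis using True by (simp add: power_0_left)
    qed simp
  qed
  finally show ?thesis by (simp add: e_def)
qed

text \<open>Distinct facets meet in a proper face of each, of codimension at least 2 in
  \<open>K\<close>; joining one apex raises the dimension by at most 1, so the cone has empty
  interior.\<close>

lemma Int_facets_cone_negligible:
  fixes K :: "'a::euclidean_space set"
  assumes K: "polytope K" and F: "F facet_of K" "F' facet_of K" "F \<noteq> F'"
  shows "negligible (convex hull (insert x0 (F \<inter> F')))"
proof -
  have face: "F face_of K" "F' face_of K" and dim: "aff_dim F = aff_dim K - 1" "aff_dim F' = aff_dim K - 1"
    using F by (auto simp: facet_of_def)
  have "F \<inter> F' face_of F"
    using face by (meson face_of_Int face_of_imp_subset face_of_subset inf_le1)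
  moreover have "F \<inter> F' \<noteq> F"
  proof
    assume "F \<inter> F' = F"
    then have "F face_of F'"
      using face by (metis face_of_imp_subset face_of_subset inf_le2)
    then have "aff_dim F < aff_dim F'"
      using F(3) face by (intro face_of_aff_dim_lt) (auto intro: face_of_imp_convex)
    then show False using dim by simp
  qed
  ultimately have "aff_dim (F \<inter> F') < aff_dim F"
    using face by (intro face_of_aff_dim_lt) (auto intro: face_of_imp_convex)
  moreover have "aff_dim K \<le> DIM('a)" by (rule aff_dim_le_DIM)
  ultimately have "aff_dim (insert x0 (F \<inter> F')) < DIM('a)"
    using dim aff_dim_insert[of x0 "F \<inter> F'"] by (auto split: if_splits)
  then have "interior (convex hull (insert x0 (F \<inter> F'))) = {}"
    using aff_dim_nonempty_interior[of "convex hull (insert x0 (F \<inter> F'))"]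
    by (metis aff_dim_convex_hull order_less_irrefl)
  then show ?thesis
    by (simp add: negligible_convex_interior)
qed

lemma polytope_facet_props:
  assumes "polytope K" "F facet_of K"
  shows "compact F" "convex F" "F \<noteq> {}" "F \<subseteq> K"
  using assms face_of_imp_subset[of F K] face_of_imp_convex[of F K]
    polytope_imp_compact[of F] face_of_polytope_polytope[of K F]
  by (auto simp: facet_of_def)

text \<open>The ray from \<open>x0\<close> through a point of \<open>K\<close> leaves
  \<open>K\<close> in a facet, and the point lies in the cone over it. Two such facets would have to
  share the exit point, so ambiguity is confined to cones over intersections of facets.\<close>

lemma polytope_cone_indicator:
  fixes K :: "'a::euclidean_space set"
  assumes K: "polytope K" and x0: "x0 \<in> interior K"
  shows "AE x in lborel. indicator K x =
    (\<Sum>F | F facet_of K. indicator (convex hull (insert x0 F)) x :: ennreal)"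
proof -
  let ?C = "\<lambda>F. convex hull (insert x0 F)"
  \<comment> \<open>The exceptional set: the apex, which determines no ray, and the cones over
    intersections of distinct facets.\<close>
  define N where "N = {x0} \<union> (\<Union>(F, F') \<in> {(F, F'). F facet_of K \<and> F' facet_of K \<and> F \<noteq> F'}. ?C (F \<inter> F'))"
  have fin: "finite {F. F facet_of K}" using K by (rule finite_polytope_facets)
  have conv: "convex K" and bdd: "bounded K" and clo: "closed K"
    using K by (auto simp: polytope_imp_convex polytope_imp_bounded polytope_imp_closed)
  have ne: "interior K \<noteq> {}" using x0 by auto
  note hull = mem_convex_hull_insert[where a=x0]
  have "finite {(F, F'). F facet_of K \<and> F' facet_of K \<and> F \<noteq> F'}"
    by (rule finite_subset[OF _ finite_cartesian_product[OF fin fin]]) auto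
  then have "negligible N"
    unfolding N_def
    by (intro negligible_Un negligible_Union finite_imageI) (auto intro: Int_facets_cone_negligible[OF K])
  then have "AE x in lborel. x \<notin> N"
    using AE_not_in[of N lebesgue] by (simp add: negligible_iff_null_sets AE_completion_iff)
  then show ?thesis
  proof eventually_elim
    case (elim x)
    have xx: "x \<noteq> x0" using elim by (auto simp: N_def)
    show ?case
    proof (cases "x \<in> K")
      case False
      have "x \<notin> ?C F" if "F facet_of K" for F
      proof -
        have "?C F \<subseteq> K"
          using x0 interior_subset polytope_facet_props(4)[OF K that] conv by (intro hull_minimal) auto
        then show ?thesis using False by auto
      qed
      then show ?thesis using False by simp
    next
      case True
      obtain d where d: "0 < d" "x0 + d *\<^sub>R (x - x0) \<in> frontier K"
        using ray_to_frontier[OF bdd x0, of "x - x0"] xx by auto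
      have "frontier K = \<Union>{F. F facet_of K}"
        using rel_frontier_of_polyhedron[OF polytope_imp_polyhedron[OF K]] ne
        by (simp add: rel_frontier_nonempty_interior)
      then obtain F where F: "F facet_of K" "x0 + d *\<^sub>R (x - x0) \<in> F" using d by auto
      \<comment> \<open>A frontier point with \<open>d < 1\<close> would lie strictly between an
        interior point and a point of \<open>K\<close>, hence in the interior.\<close>
      have "d \<ge> 1"
      proof (rule ccontr)
        assume "\<not> d \<ge> 1"
        then have "x - (1 - d) *\<^sub>R (x - x0) \<in> interior K"
          using conv x0 True d(1) by (intro mem_interior_convex_shrink) auto
        moreover have "x - (1 - d) *\<^sub>R (x - x0) = x0 + d *\<^sub>R (x - x0)"
          by (simp add: algebra_simps)
        ultimately show False using d(2) by (simp add: frontier_def)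
      qed
      note Fp = polytope_facet_props[OF K]
      have xF: "x \<in> ?C F"
        unfolding hull[OF Fp(2,3)[OF F(1)]]
      proof (intro exI conjI)
        show "x = x0 + (1 / d) *\<^sub>R ((x0 + d *\<^sub>R (x - x0)) - x0)" using d(1) by simp
      qed (use \<open>d \<ge> 1\<close> F in auto)
      have uniq: "x \<notin> ?C F'" if F': "F' facet_of K" "F' \<noteq> F" for F'
      proof
        \<comment> \<open>The normal of \<open>G\<close> is maximal over \<open>K\<close> along
          \<open>G\<close>, so the ray cannot reach \<open>y'\<close> beyond \<open>G\<close>.
          Exchanging the two facets gives equality of the parameters.\<close>
        have key: "s \<le> s'"
          if sy: "0 < s" "0 < s'" "G facet_of K" "G' facet_of K" "y \<in> G" "y' \<in> G'"
            "x = x0 + s *\<^sub>R (y - x0)" "x = x0 + s' *\<^sub>R (y' - x0)" for s s' y y' G G'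
        proof -
          obtain n where n: "outward_normal K G n" by (rule facet_outward_normal_exists[OF K ne sy(3)])
          have lt: "0 < n \<bullet> (y - x0)"
            using outward_normal_interior_less[OF n sy(5) x0] by (simp add: inner_diff_right)
          have "n \<bullet> y' \<le> n \<bullet> y"
            using n sy(5,6) Fp(4)[OF sy(4)] by (auto simp: outward_normal_def)
          then have le: "n \<bullet> (y' - x0) \<le> n \<bullet> (y - x0)" by (simp add: inner_diff_right)
          have "s *\<^sub>R (y - x0) = s' *\<^sub>R (y' - x0)" using sy(7,8) by simp
          then have "s * (n \<bullet> (y - x0)) = s' * (n \<bullet> (y' - x0))"
            by (metis inner_scaleR_right)
          also have "\<dots> \<le> s' * (n \<bullet> (y - x0))" using le sy(2) by simp
          finally show ?thesis using lt by simp
        qed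
        assume "x \<in> ?C F'"
        then obtain s' y' where y': "0 \<le> s'" "s' \<le> 1" "y' \<in> F'" "x = x0 + s' *\<^sub>R (y' - x0)"
          using hull[OF Fp(2,3)[OF F'(1)]] by metis
        obtain s y where y: "0 \<le> s" "s \<le> 1" "y \<in> F" "x = x0 + s *\<^sub>R (y - x0)"
          using xF hull[OF Fp(2,3)[OF F(1)]] by metis
        have pos: "0 < s" "0 < s'" using y y' xx by (auto simp: less_le)
        have "s = s'"
          using key[OF pos F(1) F'(1) y(3) y'(3) y(4) y'(4)] key[OF pos(2,1) F'(1) F(1) y'(3) y(3) y'(4) y(4)]
          by simp
        then have "y = y'" using y(4) y'(4) pos by simp
        then have "y \<in> F \<inter> F'" using y y' by simp
        moreover have "convex (F \<inter> F')" using Fp(2) F(1) F'(1) by (simp add: convex_Int)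
        ultimately have "x \<in> ?C (F \<inter> F')" using hull[of "F \<inter> F'" x] y by blast
        then have "x \<in> N" using F(1) F' unfolding N_def by blast
        then show False using elim by simp
      qed
      have "(\<Sum>G | G facet_of K. indicator (?C G) x :: ennreal) = (\<Sum>G | G facet_of K. if G = F then 1 else 0)"
        using xF uniq by (intro sum.cong) auto
      then show ?thesis using True fin F by simp
    qed
  qed
qed

lemma polytope_nn_integral:
  fixes K :: "'a::euclidean_space set"
  assumes K: "polytope K" and x0: "x0 \<in> interior K"
    and n: "\<And>F. F facet_of K \<Longrightarrow> outward_normal K F (n F)"
    and c: "\<And>F y. F facet_of K \<Longrightarrow> y \<in> F \<Longrightarrow> n F \<bullet> y = c F"
    and f: "\<And>x. (f has_derivative (\<lambda>u. g x \<bullet> u)) (at x)" and g: "continuous_on UNIV g"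
    and nonneg: "\<And>x. x \<in> K \<Longrightarrow> 0 \<le> real DIM('a) * f x + g x \<bullet> (x - x0)"
      "\<And>x. x \<in> K \<Longrightarrow> 0 \<le> f x"
  shows "(\<integral>\<^sup>+x. indicator K x * ennreal (real DIM('a) * f x + g x \<bullet> (x - x0)) \<partial>lborel) =
    (\<Sum>F | F facet_of K. \<integral>\<^sup>+y. indicator F y * ennreal ((c F - n F \<bullet> x0) * f y) \<partial>hyperplane_measure (n F) (c F))"
proof -
  let ?C = "\<lambda>F. convex hull (insert x0 F)"
  define e where "e x = real DIM('a) * f x + g x \<bullet> (x - x0)" for x
  have "continuous_on UNIV f"
    by (intro continuous_at_imp_continuous_on ballI has_derivative_continuous[OF f])
  then have [measurable]: "f \<in> borel_measurable borel" "g \<in> borel_measurable borel"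
    using g by (auto intro: borel_measurable_continuous_onI)
  have [measurable]: "e \<in> borel_measurable borel" unfolding e_def by measurable
  note Fp = polytope_facet_props[OF K]
  have C: "?C F \<in> sets borel" if "F facet_of K" for F
    using Fp[OF that] by (intro borel_compact compact_convex_hull compact_insert)
  have "(\<integral>\<^sup>+x. indicator K x * ennreal (e x) \<partial>lborel) =
    (\<integral>\<^sup>+x. (\<Sum>F | F facet_of K. indicator (?C F) x * ennreal (e x)) \<partial>lborel)"
    by (intro nn_integral_cong_AE eventually_mono[OF polytope_cone_indicator[OF K x0]])
       (simp add: sum_distrib_right)
  also have "\<dots> = (\<Sum>F | F facet_of K. \<integral>\<^sup>+x. indicator (?C F) x * ennreal (e x) \<partial>lborel)"
    using C by (intro nn_integral_sum) simp
  also have "\<dots> = (\<Sum>F | F facet_of K. \<integral>\<^sup>+y. indicator F y * ennreal ((c F - n F \<bullet> x0) * f y) \<partial>hyperplane_measure (n F) (c F))"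
  proof (intro sum.cong refl)
    fix F assume "F \<in> {F. F facet_of K}"
    then have F: "F facet_of K" by simp
    have hull: "?C F \<subseteq> K"
      using x0 interior_subset Fp(4)[OF F] polytope_imp_convex[OF K] by (intro hull_minimal) auto
    obtain y where y: "y \<in> F" using Fp(3)[OF F] by auto
    show "(\<integral>\<^sup>+x. indicator (?C F) x * ennreal (e x) \<partial>lborel) =
      (\<integral>\<^sup>+y. indicator F y * ennreal ((c F - n F \<bullet> x0) * f y) \<partial>hyperplane_measure (n F) (c F))"
      unfolding e_def
    proof (rule cone_nn_integral[OF _ Fp(1,2,3)[OF F] c[OF F] _ refl f g])
      show "norm (n F) = 1" using n[OF F] by (simp add: outward_normal_def)
      show "0 < c F - n F \<bullet> x0"
        using outward_normal_interior_less[OF n[OF F] y x0] c[OF F y] by simp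
    qed (use hull Fp(4)[OF F] nonneg in auto)
  qed
  finally show ?thesis by (simp add: e_def)
qed

section \<open>The divergence theorem on polytopes\<close>

text \<open>Passes from \<open>ennreal\<close> to real integrals: the data are continuous on compact
  sets, hence integrable, and nonnegativity of both sides allows \<open>ennreal\<close> to be
  stripped.\<close>

lemma polytope_integral_nonneg:
  fixes K :: "'a::euclidean_space set"
  assumes K: "polytope K" and x0: "x0 \<in> interior K"
    and n: "\<And>F. F facet_of K \<Longrightarrow> outward_normal K F (n F)"
    and c: "\<And>F y. F facet_of K \<Longrightarrow> y \<in> F \<Longrightarrow> n F \<bullet> y = c F"
    and f: "\<And>x. (f has_derivative (\<lambda>u. g x \<bullet> u)) (at x)" and g: "continuous_on UNIV g"
    and nonneg: "\<And>x. x \<in> K \<Longrightarrow> 0 \<le> real DIM('a) * f x + g x \<bullet> (x - x0)"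
      "\<And>x. x \<in> K \<Longrightarrow> 0 \<le> f x"
  shows "(LINT x|lborel. indicator K x * (real DIM('a) * f x + g x \<bullet> (x - x0))) =
    (\<Sum>F | F facet_of K. (c F - n F \<bullet> x0) * (LINT y|hyperplane_measure (n F) (c F). indicator F y * f y))"
proof -
  define e where "e x = real DIM('a) * f x + g x \<bullet> (x - x0)" for x
  have contf: "continuous_on UNIV f"
    by (intro continuous_at_imp_continuous_on ballI has_derivative_continuous[OF f])
  have conte: "continuous_on UNIV e"
    unfolding e_def by (intro continuous_intros contf g)
  note Fp = polytope_facet_props[OF K]
  let ?J = "\<lambda>F. (c F - n F \<bullet> x0) * (LINT y|hyperplane_measure (n F) (c F). indicator F y * f y)"
  have F: "(\<integral>\<^sup>+y. indicator F y * ennreal ((c F - n F \<bullet> x0) * f y) \<partial>hyperplane_measure (n F) (c F)) = ennreal (?J F)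
      \<and> 0 \<le> ?J F" if F: "F facet_of K" for F
  proof -
    let ?h = "c F - n F \<bullet> x0"
    obtain y where y: "y \<in> F" using Fp(3)[OF F] by auto
    have h: "0 < ?h"
      using outward_normal_interior_less[OF n[OF F] y x0] c[OF F y] by simp
    have norm: "norm (n F) = 1" using n[OF F] by (simp add: outward_normal_def)
    have pos: "0 \<le> indicator F y * (?h * f y)" for y
      using nonneg(2) Fp(4)[OF F] h by (auto simp: indicator_def)
    have "(\<integral>\<^sup>+y. indicator F y * ennreal (?h * f y) \<partial>hyperplane_measure (n F) (c F))
       = (\<integral>\<^sup>+y. ennreal (indicator F y * (?h * f y)) \<partial>hyperplane_measure (n F) (c F))"
      by (intro nn_integral_cong) (auto simp: indicator_def)
    also have "\<dots> = ennreal (LINT y|hyperplane_measure (n F) (c F). indicator F y * (?h * f y))"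
      by (intro nn_integral_eq_integral integrable_hyperplane_compact continuous_intros contf Fp F norm)
         (use pos in auto)
    also have "(LINT y|hyperplane_measure (n F) (c F). indicator F y * (?h * f y)) = ?J F"
      by (subst integral_mult_right_zero[symmetric]) (simp add: mult_ac)
    finally have "(\<integral>\<^sup>+y. indicator F y * ennreal (?h * f y) \<partial>hyperplane_measure (n F) (c F)) = ennreal (?J F)" .
    moreover have "0 \<le> indicator F y * f y" for y
      using nonneg(2)[of y] Fp(4)[OF F] by (cases "y \<in> F") auto
    then have "0 \<le> ?J F"
      by (intro mult_nonneg_nonneg[OF less_imp_le[OF h]] Bochner_Integration.integral_nonneg)
    ultimately show ?thesis ..
  qed
  have "ennreal (LINT x|lborel. indicator K x * e x) = (\<integral>\<^sup>+x. ennreal (indicator K x * e x) \<partial>lborel)"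
    using nonneg(1)
    by (intro nn_integral_eq_integral[symmetric] integrable_lborel_compact conte polytope_imp_compact K)
       (auto simp: indicator_def e_def)
  also have "\<dots> = (\<integral>\<^sup>+x. indicator K x * ennreal (e x) \<partial>lborel)"
    by (intro nn_integral_cong) (auto simp: indicator_def)
  also have "\<dots> = (\<Sum>F | F facet_of K. \<integral>\<^sup>+y. indicator F y * ennreal ((c F - n F \<bullet> x0) * f y) \<partial>hyperplane_measure (n F) (c F))"
    unfolding e_def by (rule polytope_nn_integral[OF K x0 n c f g nonneg])
  also have "\<dots> = (\<Sum>F | F facet_of K. ennreal (?J F))"
    using F by (intro sum.cong) auto
  also have "\<dots> = ennreal (\<Sum>F | F facet_of K. ?J F)"
    using F by (intro sum_ennreal) auto
  finally show ?thesis
    unfolding e_def using F nonneg(1)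
    by (subst (asm) ennreal_inj) (auto intro!: Bochner_Integration.integral_nonneg sum_nonneg simp: indicator_def)
qed

text \<open>Both sides are linear in \<open>f\<close> together with its gradient. Applying the
  nonnegative case to \<open>f + M\<close> and to the constant \<open>M\<close>, and subtracting,
  removes the sign condition.\<close>

lemma polytope_integral:
  fixes K :: "'a::euclidean_space set"
  assumes K: "polytope K" and x0: "x0 \<in> interior K"
    and n: "\<And>F. F facet_of K \<Longrightarrow> outward_normal K F (n F)"
    and c: "\<And>F y. F facet_of K \<Longrightarrow> y \<in> F \<Longrightarrow> n F \<bullet> y = c F"
    and f: "\<And>x. (f has_derivative (\<lambda>u. g x \<bullet> u)) (at x)" and g: "continuous_on UNIV g"
  shows "(LINT x|lborel. indicator K x * (real DIM('a) * f x + g x \<bullet> (x - x0))) =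
    (\<Sum>F | F facet_of K. (c F - n F \<bullet> x0) * (LINT y|hyperplane_measure (n F) (c F). indicator F y * f y))"
proof -
  let ?d = "real DIM('a)"
  define e where "e x = ?d * f x + g x \<bullet> (x - x0)" for x
  have contf: "continuous_on UNIV f"
    by (intro continuous_at_imp_continuous_on ballI has_derivative_continuous[OF f])
  have conte: "continuous_on UNIV e"
    unfolding e_def by (intro continuous_intros contf g)
  note Fp = polytope_facet_props[OF K]
  have cK: "compact K" using K by (rule polytope_imp_compact)
  have "bounded (f ` K)" "bounded (e ` K)"
    using contf conte cK continuous_on_subset by (blast intro: compact_imp_bounded compact_continuous_image)+
  then obtain B1 B2 where B: "\<And>x. x \<in> K \<Longrightarrow> \<bar>f x\<bar> \<le> B1" "\<And>x. x \<in> K \<Longrightarrow> \<bar>e x\<bar> \<le> B2"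
    by (auto simp: bounded_iff)
  \<comment> \<open>One constant serves both conditions: as the dimension is at least 1,
    \<open>?d * M\<close> dominates \<open>M\<close> and hence the bound for
    \<open>e\<close>.\<close>
  define M where "M = \<bar>B1\<bar> + \<bar>B2\<bar>"
  have M: "M \<ge> 0" by (simp add: M_def)
  have dM: "M \<le> ?d * M"
    using mult_right_mono[of 1 ?d M] M DIM_positive[where 'a='a] by simp
  have pos: "0 \<le> f x + M" "0 \<le> e x + ?d * M" if "x \<in> K" for x
    using B[OF that] dM unfolding M_def by linarith+
  let ?I = "\<lambda>f. \<Sum>F | F facet_of K. (c F - n F \<bullet> x0) * (LINT y|hyperplane_measure (n F) (c F). indicator F y * f y)"
  have "(LINT x|lborel. indicator K x * (?d * (f x + M) + g x \<bullet> (x - x0))) = ?I (\<lambda>y. f y + M)"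
    using pos by (intro polytope_integral_nonneg[OF K x0 n c _ g])
      (auto intro!: derivative_eq_intros f simp: e_def algebra_simps)
  moreover have "(LINT x|lborel. indicator K x * (?d * M + 0 \<bullet> (x - x0))) = ?I (\<lambda>y. M)"
    using M by (intro polytope_integral_nonneg[OF K x0 n c, where g="\<lambda>_. 0" and f="\<lambda>_. M"]) auto
  moreover have "(LINT x|lborel. indicator K x * (?d * (f x + M) + g x \<bullet> (x - x0))) =
     (LINT x|lborel. indicator K x * e x) + (LINT x|lborel. indicator K x * (?d * M))"
    using Bochner_Integration.integral_add[OF integrable_lborel_compact[OF cK conte] integrable_lborel_compact[OF cK continuous_on_const[of _ "?d * M"]]]
    by (simp add: e_def algebra_simps)
  moreover have "?I (\<lambda>y. f y + M) = ?I f + ?I (\<lambda>y. M)"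
  proof -
    have "(LINT y|hyperplane_measure (n F) (c F). indicator F y * (f y + M)) =
      (LINT y|hyperplane_measure (n F) (c F). indicator F y * f y) +
      (LINT y|hyperplane_measure (n F) (c F). indicator F y * M)" if F: "F facet_of K" for F
    proof -
      have norm: "norm (n F) = 1" using n[OF F] by (simp add: outward_normal_def)
      show ?thesis
        using Bochner_Integration.integral_add[OF integrable_hyperplane_compact[OF norm Fp(1)[OF F] contf, of "c F"]
            integrable_hyperplane_compact[OF norm Fp(1)[OF F] continuous_on_const[of _ M], of "c F"]]
        by (simp add: distrib_left)
    qed
    then show ?thesis by (simp add: distrib_left sum.distrib)
  qed
  ultimately show ?thesis by (simp add: e_def)
qed

text \<open>Both sides of the previous identity are affine in \<open>x0\<close>; comparing two base points that
  differ by a multiple of \<open>u\<close> isolates the derivative in direction \<open>u\<close>.\<close>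

lemma polytope_directional_derivative:
  fixes K :: "'a::euclidean_space set"
  assumes K: "polytope K" "interior K \<noteq> {}"
    and n: "\<And>F. F facet_of K \<Longrightarrow> outward_normal K F (n F)"
    and c: "\<And>F y. F facet_of K \<Longrightarrow> y \<in> F \<Longrightarrow> n F \<bullet> y = c F"
    and f: "\<And>x. (f has_derivative (\<lambda>u. g x \<bullet> u)) (at x)" and g: "continuous_on UNIV g"
  shows "(LINT x|lborel. indicator K x * (g x \<bullet> u)) =
    (\<Sum>F | F facet_of K. (n F \<bullet> u) * (LINT y|hyperplane_measure (n F) (c F). indicator F y * f y))"
proof -
  obtain x0 r where x0: "x0 \<in> interior K" and r: "r > 0" "ball x0 r \<subseteq> interior K"
    using K(2) open_interior[of K] by (meson all_not_in_conv openE)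
  \<comment> \<open>Small enough that the shifted base point stays in the ball of radius
    \<open>r\<close>; the summand 1 covers \<open>u = 0\<close>.\<close>
  define \<epsilon> where "\<epsilon> = r / (2 * (norm u + 1))"
  have nu: "norm u + 1 > 0" by (meson add_nonneg_pos norm_ge_zero zero_less_one)
  then have \<epsilon>: "\<epsilon> > 0" using r by (simp add: \<epsilon>_def)
  have "\<epsilon> * norm u \<le> \<epsilon> * (norm u + 1)" using \<epsilon> by simp
  also have "\<dots> = r / 2" using nu by (simp add: \<epsilon>_def field_simps)
  finally have "\<epsilon> * norm u < r" using r by simp
  then have x1: "x0 + \<epsilon> *\<^sub>R u \<in> interior K"
    using r \<epsilon> by (intro subsetD[OF r(2)]) (simp add: dist_norm)
  have contf: "continuous_on UNIV f"
    by (intro continuous_at_imp_continuous_on ballI has_derivative_continuous[OF f])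
  have cont: "continuous_on UNIV (\<lambda>x. real DIM('a) * f x + g x \<bullet> (x - z))" for z
    by (intro continuous_intros contf g)
  note int = integrable_lborel_compact[OF polytope_imp_compact[OF K(1)] cont]
  let ?J = "\<lambda>F. LINT y|hyperplane_measure (n F) (c F). indicator F y * f y"
  have "\<epsilon> * (LINT x|lborel. indicator K x * (g x \<bullet> u)) =
      (LINT x|lborel. indicator K x * (real DIM('a) * f x + g x \<bullet> (x - x0))
        - indicator K x * (real DIM('a) * f x + g x \<bullet> (x - (x0 + \<epsilon> *\<^sub>R u))))"
    by (subst integral_mult_right_zero[symmetric], rule Bochner_Integration.integral_cong)
       (simp_all add: algebra_simps)
  also have "\<dots> = (\<Sum>F | F facet_of K. (c F - n F \<bullet> x0) * ?J F) -
     (\<Sum>F | F facet_of K. (c F - n F \<bullet> (x0 + \<epsilon> *\<^sub>R u)) * ?J F)"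
    using polytope_integral[OF K(1) x0 n c f g] polytope_integral[OF K(1) x1 n c f g]
    by (subst Bochner_Integration.integral_diff[OF int int]) simp
  also have "\<dots> = \<epsilon> * (\<Sum>F | F facet_of K. (n F \<bullet> u) * ?J F)"
    by (simp add: sum_subtractf[symmetric] sum_distrib_left algebra_simps)
  finally show ?thesis using \<epsilon> by simp
qed

section \<open>Gradient and divergence of polynomial fields\<close>

lemma polynomial_gradient:
  fixes f :: "'a::euclidean_space \<Rightarrow> real"
  assumes "real_polynomial_function f"
  obtains g where "polynomial_function g" "\<And>x. (f has_derivative (\<lambda>u. g x \<bullet> u)) (at x)"
proof -
  have "\<exists>g. polynomial_function g \<and> (\<forall>x. (f has_derivative (\<lambda>u. g x \<bullet> u)) (at x))"
    using assms
  proof induction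
    case (linear f)
    \<comment> \<open>The Riesz representative of the linear functional.\<close>
    let ?g = "\<Sum>b\<in>Basis. f b *\<^sub>R b"
    have "?g \<bullet> u = f u" for u
    proof -
      have "f u = f (\<Sum>b\<in>Basis. (u \<bullet> b) *\<^sub>R b)" by (simp add: euclidean_representation)
      also have "\<dots> = (\<Sum>b\<in>Basis. (u \<bullet> b) * f b)"
        using linear by (simp add: linear_sum linear_scale bounded_linear.linear)
      finally show ?thesis by (simp add: inner_sum_left inner_sum_right inner_commute mult.commute)
    qed
    then have "(f has_derivative (\<lambda>u. ?g \<bullet> u)) (at x)" for x
      using bounded_linear_imp_has_derivative[OF linear] by simp
    then show ?case by (intro exI[of _ "\<lambda>_. ?g"]) auto
  next
    case (const c)
    then show ?case by (intro exI[of _ "\<lambda>_. 0"]) auto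
  next
    case (add f1 f2)
    then obtain g1 g2 where "polynomial_function g1" "polynomial_function g2"
      and "\<And>x. (f1 has_derivative (\<lambda>u. g1 x \<bullet> u)) (at x)" "\<And>x. (f2 has_derivative (\<lambda>u. g2 x \<bullet> u)) (at x)"
      by blast
    then show ?case
      by (intro exI[of _ "\<lambda>x. g1 x + g2 x"])
         (auto intro!: derivative_eq_intros simp: inner_add_left)
  next
    case (mult f1 f2)
    then obtain g1 g2 where g: "polynomial_function g1" "polynomial_function g2"
      and d: "\<And>x. (f1 has_derivative (\<lambda>u. g1 x \<bullet> u)) (at x)" "\<And>x. (f2 has_derivative (\<lambda>u. g2 x \<bullet> u)) (at x)"
      by blast
    have "polynomial_function (\<lambda>x. f1 x *\<^sub>R g2 x + f2 x *\<^sub>R g1 x)"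
      using mult(1,2) g by (intro polynomial_function_add polynomial_function_mult)
        (auto simp: real_polynomial_function_eq)
    moreover have "((\<lambda>x. f1 x * f2 x) has_derivative (\<lambda>u. (f1 x *\<^sub>R g2 x + f2 x *\<^sub>R g1 x) \<bullet> u)) (at x)" for x
      by (rule derivative_eq_intros d)+ (simp add: inner_add_left mult.commute)
    ultimately show ?case by blast
  qed
  then show ?thesis using that by blast
qed

lemma continuous_on_polynomial:
  "polynomial_function G \<Longrightarrow> continuous_on S (G :: 'a::euclidean_space \<Rightarrow> 'b::euclidean_space)"
  by (simp add: continuous_on_polymonial_function)

lemma divergence_scaleR:
  assumes f: "f differentiable (at x)" and G: "G differentiable (at x)"
  shows "divergence (\<lambda>x. f x *\<^sub>R G x) x = grad f x \<bullet> G x + f x * divergence G x"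
proof -
  note D = iffD1[OF frechet_derivative_works f] iffD1[OF frechet_derivative_works G]
  have "((\<lambda>x. f x *\<^sub>R G x) has_derivative
      (\<lambda>u. f x *\<^sub>R frechet_derivative G (at x) u + frechet_derivative f (at x) u *\<^sub>R G x)) (at x)"
    by (rule has_derivative_scaleR[OF D])
  then have "divergence (\<lambda>x. f x *\<^sub>R G x) x =
     (\<Sum>b\<in>Basis. (f x *\<^sub>R frechet_derivative G (at x) b + frechet_derivative f (at x) b *\<^sub>R G x) \<bullet> b)"
    unfolding divergence_def by (simp add: frechet_derivative_at[symmetric])
  also have "\<dots> = (\<Sum>b\<in>Basis. frechet_derivative f (at x) b * (G x \<bullet> b)) + f x * divergence G x"
    by (simp add: divergence_def inner_add_left sum.distrib sum_distrib_left add.commute)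
  also have "(\<Sum>b\<in>Basis. frechet_derivative f (at x) b * (G x \<bullet> b)) = grad f x \<bullet> G x"
    by (simp add: grad_def inner_sum_left inner_sum_right inner_commute)
  finally show ?thesis .
qed

lemma surface_integral_eq:
  assumes "y \<in> F" "\<And>x. x \<in> F \<Longrightarrow> n \<bullet> x = n \<bullet> y"
  shows "surface_integral F n g = (LINT x|hyperplane_measure n (n \<bullet> y). indicator F x * g x)"
  using assms(2)[OF someI[of "\<lambda>x. x \<in> F", OF assms(1)]]
  by (simp add: surface_integral_def set_lebesgue_integral_def)

text \<open>Brings the divergence into the form to which the directional identity applies, one
  component and one basis direction at a time; polynomial gradients supply the continuity required
  there.\<close>

lemma polynomial_divergence:
  fixes G :: "'a::euclidean_space \<Rightarrow> 'a"
  assumes G: "polynomial_function G"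
  shows "\<exists>g. (\<forall>b\<in>Basis. polynomial_function (g b) \<and>
      (\<forall>x. ((\<lambda>x. G x \<bullet> b) has_derivative (\<lambda>u. g b x \<bullet> u)) (at x))) \<and>
    (\<forall>x. divergence G x = (\<Sum>b\<in>Basis. g b x \<bullet> b))"
proof -
  have "\<forall>b\<in>Basis. \<exists>g. polynomial_function g \<and>
      (\<forall>x. ((\<lambda>x. G x \<bullet> b) has_derivative (\<lambda>u. g x \<bullet> u)) (at x))"
    using G[unfolded polynomial_function_iff_Basis_inner] by (metis polynomial_gradient)
  then obtain g where g: "\<And>b. b \<in> Basis \<Longrightarrow> polynomial_function (g b)"
    and D: "\<And>b x. b \<in> Basis \<Longrightarrow> ((\<lambda>x. G x \<bullet> b) has_derivative (\<lambda>u. g b x \<bullet> u)) (at x)"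
    by metis
  have DG: "(G has_derivative (\<lambda>u. \<Sum>b\<in>Basis. (g b x \<bullet> u) *\<^sub>R b)) (at x)" for x
    using D by (subst has_derivative_componentwise_within) (auto simp: inner_sum_left inner_Basis if_distrib cong: if_cong)
  then have "frechet_derivative G (at x) = (\<lambda>u. \<Sum>b\<in>Basis. (g b x \<bullet> u) *\<^sub>R b)" for x
    by (rule frechet_derivative_at[symmetric])
  then have div: "divergence G x = (\<Sum>b\<in>Basis. g b x \<bullet> b)" for x
    unfolding divergence_def
    by (intro sum.cong) (auto simp: inner_sum_left inner_Basis if_distrib cong: if_cong)
  show ?thesis using g D div by blast
qed

lemma continuous_on_divergence_polynomial:
  fixes G :: "'a::euclidean_space \<Rightarrow> 'a"
  assumes G: "polynomial_function G"
  shows "continuous_on UNIV (divergence G)"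
proof -
  obtain g where *: "(\<forall>b\<in>Basis. polynomial_function (g b) \<and>
      (\<forall>x. ((\<lambda>x. G x \<bullet> b) has_derivative (\<lambda>u. g b x \<bullet> u)) (at x))) \<and>
    (\<forall>x. divergence G x = (\<Sum>b\<in>Basis. g b x \<bullet> b))"
    using polynomial_divergence[OF G] by (elim exE)
  have "continuous_on UNIV (\<lambda>x. \<Sum>b\<in>Basis. g b x \<bullet> b)"
    using * by (intro continuous_intros continuous_on_polynomial) auto
  moreover have "divergence G = (\<lambda>x. \<Sum>b\<in>Basis. g b x \<bullet> b)"
    using * by (intro ext) blast
  ultimately show ?thesis by simp
qed

text \<open>The directional identity for the component \<open>G x \<bullet> b\<close> in direction
  \<open>b\<close>, summed over the orthonormal basis; the facet coefficients
  \<open>n F \<bullet> b\<close> reassemble the normal flux.\<close>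

theorem polytope_divergence_theorem:
  fixes K :: "'a::euclidean_space set"
  assumes K: "polytope K" "interior K \<noteq> {}"
    and n: "\<And>F. F facet_of K \<Longrightarrow> outward_normal K F (n F)"
    and G: "polynomial_function G"
  shows "(LINT x:K|lborel. divergence G x) =
    (\<Sum>F | F facet_of K. surface_integral F (n F) (\<lambda>x. G x \<bullet> n F))"
proof -
  obtain g where *: "(\<forall>b\<in>Basis. polynomial_function (g b) \<and>
      (\<forall>x. ((\<lambda>x. G x \<bullet> b) has_derivative (\<lambda>u. g b x \<bullet> u)) (at x))) \<and>
    (\<forall>x. divergence G x = (\<Sum>b\<in>Basis. g b x \<bullet> b))"
    using polynomial_divergence[OF G] by (elim exE)
  then have g: "polynomial_function (g b)"
    and D: "((\<lambda>x. G x \<bullet> b) has_derivative (\<lambda>u. g b x \<bullet> u)) (at x)" if "b \<in> Basis" for b x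
    using that by blast+
  have div: "divergence G x = (\<Sum>b\<in>Basis. g b x \<bullet> b)" for x
    using * by blast
  note Fp = polytope_facet_props[OF K(1)]
  \<comment> \<open>The same choice of point as in \<open>surface_integral\<close>, so that the
    measures coincide literally. The choice is immaterial because \<open>n F \<bullet> y\<close> is
    constant for \<open>y\<close> in \<open>F\<close>.\<close>
  define c where "c F = n F \<bullet> (SOME y. y \<in> F)" for F
  have c: "n F \<bullet> y = c F" if "F facet_of K" "y \<in> F" for F y
    using outward_normal_const[OF n[OF that(1)] that(1,2) someI[of "\<lambda>y. y \<in> F", OF that(2)]]
    by (simp add: c_def)
  have contg: "continuous_on UNIV (g b)" if "b \<in> Basis" for b
    using g[OF that] by (rule continuous_on_polynomial)
  have contG: "continuous_on UNIV G" using G by (rule continuous_on_polynomial)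
  let ?M = "\<lambda>F. hyperplane_measure (n F) (c F)"
  have "(LINT x:K|lborel. divergence G x) = (LINT x|lborel. (\<Sum>b\<in>Basis. indicator K x * (g b x \<bullet> b)))"
    by (simp add: set_lebesgue_integral_def div sum_distrib_left)
  also have "\<dots> = (\<Sum>b\<in>Basis. LINT x|lborel. indicator K x * (g b x \<bullet> b))"
    using K by (intro Bochner_Integration.integral_sum integrable_lborel_compact continuous_intros contg)
      (auto intro: polytope_imp_compact)
  also have "\<dots> = (\<Sum>b\<in>Basis. \<Sum>F | F facet_of K. (n F \<bullet> b) * (LINT y|?M F. indicator F y * (G y \<bullet> b)))"
    by (intro sum.cong refl polytope_directional_derivative[OF K n c D contg])
  also have "\<dots> = (\<Sum>F | F facet_of K. \<Sum>b\<in>Basis. (n F \<bullet> b) * (LINT y|?M F. indicator F y * (G y \<bullet> b)))"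
    by (rule sum.swap)
  also have "\<dots> = (\<Sum>F | F facet_of K. surface_integral F (n F) (\<lambda>x. G x \<bullet> n F))"
  proof (intro sum.cong refl)
    fix F assume "F \<in> {F. F facet_of K}"
    then have F: "F facet_of K" by simp
    have norm: "norm (n F) = 1" using n[OF F] by (simp add: outward_normal_def)
    have int: "integrable (?M F) (\<lambda>y. indicator F y * (G y \<bullet> b))" for b
      by (intro integrable_hyperplane_compact norm Fp F continuous_intros contG)
    have "(\<Sum>b\<in>Basis. (n F \<bullet> b) * (LINT y|?M F. indicator F y * (G y \<bullet> b))) =
       (LINT y|?M F. (\<Sum>b\<in>Basis. (n F \<bullet> b) * (indicator F y * (G y \<bullet> b))))"
      using int by (subst Bochner_Integration.integral_sum) auto
    also have "\<dots> = (LINT y|?M F. indicator F y * (G y \<bullet> n F))"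
      by (subst (2) euclidean_inner) (simp add: sum_distrib_left mult_ac)
    also have "\<dots> = surface_integral F (n F) (\<lambda>x. G x \<bullet> n F)"
      by (simp add: surface_integral_def set_lebesgue_integral_def c_def)
    finally show "(\<Sum>b\<in>Basis. (n F \<bullet> b) * (LINT y|?M F. indicator F y * (G y \<bullet> b))) =
      surface_integral F (n F) (\<lambda>x. G x \<bullet> n F)" .
  qed
  finally show ?thesis .
qed

section \<open>Facets and surface integrals\<close>

text \<open>The affine hull lies in the supporting hyperplane, and both have dimension one less than
  the space.\<close>

lemma affine_hull_facet:
  fixes K :: "'a::euclidean_space set"
  assumes K: "interior K \<noteq> {}" and F: "F facet_of K" and n: "outward_normal K F n" and x: "x \<in> F"
  shows "affine hull F = {y. n \<bullet> y = n \<bullet> x}"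
proof (rule affine_dim_equal)
  have "n \<noteq> 0" using n by (auto simp: outward_normal_def)
  have const: "n \<bullet> y = n \<bullet> x" if "y \<in> F" for y
    using outward_normal_const[OF n F that x] .
  show "affine hull F \<subseteq> {y. n \<bullet> y = n \<bullet> x}"
    by (rule hull_minimal) (auto simp: affine_hyperplane const)
  show "aff_dim (affine hull F) = aff_dim {y. n \<bullet> y = n \<bullet> x}"
    using F K \<open>n \<noteq> 0\<close> by (simp add: facet_of_def aff_dim_nonempty_interior aff_dim_hyperplane)
qed (use x in \<open>auto simp: affine_hyperplane\<close>)

text \<open>The part \<open>z\<close> of \<open>m\<close> orthogonal to \<open>n\<close> is tangent
  to the facet, and \<open>m\<close> is constant along the facet; so \<open>m\<close> is orthogonal
  to \<open>z\<close>, which forces \<open>z = 0\<close>.\<close>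

lemma unit_normal_cases:
  fixes K :: "'a::euclidean_space set"
  assumes K: "interior K \<noteq> {}" and F: "F facet_of K" and n: "outward_normal K F n"
    and m: "norm m = 1" "\<And>x y. x \<in> F \<Longrightarrow> y \<in> F \<Longrightarrow> m \<bullet> (x - y) = 0"
  shows "m = n \<or> m = - n"
proof -
  have nn: "n \<bullet> n = 1" using n by (simp add: outward_normal_def norm_eq_1)
  obtain x where x: "x \<in> F" using F by (auto simp: facet_of_def)
  have "m \<bullet> y = m \<bullet> x" if "y \<in> F" for y
    using m(2)[OF that x] by (simp add: inner_diff_right)
  then have "affine hull F \<subseteq> {y. m \<bullet> y = m \<bullet> x}"
    by (intro hull_minimal) (auto simp: affine_hyperplane)
  moreover define z where "z = m - (n \<bullet> m) *\<^sub>R n"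
  have nz: "n \<bullet> z = 0" by (simp add: z_def inner_diff_right nn)
  then have "x + z \<in> affine hull F"
    unfolding affine_hull_facet[OF K F n x] by (simp add: inner_add_right)
  ultimately have "m \<bullet> (x + z) = m \<bullet> x" by blast
  then have "m \<bullet> z = 0" by (simp add: inner_add_right)
  then have "(m - (n \<bullet> m) *\<^sub>R n) \<bullet> z = 0" using nz by (simp add: inner_diff_left)
  then have "z = 0" by (metis inner_eq_zero_iff z_def)
  then have eq: "m = (n \<bullet> m) *\<^sub>R n" by (simp add: z_def)
  then have "norm m = \<bar>n \<bullet> m\<bar> * norm n" by (metis norm_scaleR)
  then have "n \<bullet> m = 1 \<or> n \<bullet> m = -1"
    using m n by (auto simp: outward_normal_def)
  then show ?thesis using eq by auto
qed

lemma outward_normal_uminus: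
  assumes "interior K \<noteq> {}" "F \<noteq> {}" "outward_normal K F n"
  shows "\<not> outward_normal K F (- n)"
proof
  assume m: "outward_normal K F (- n)"
  obtain x y where "x \<in> interior K" "y \<in> F" using assms by auto
  then show False
    using outward_normal_interior_less[OF assms(3), of y x] outward_normal_interior_less[OF m, of y x] by simp
qed

lemma outward_normal_unique:
  fixes K :: "'a::euclidean_space set"
  assumes K: "interior K \<noteq> {}" and F: "F facet_of K" and n: "outward_normal K F n" "outward_normal K F m"
  shows "m = n"
proof -
  have "m = n \<or> m = - n"
  proof (rule unit_normal_cases[OF K F n(1)])
    show "norm m = 1" using n(2) by (simp add: outward_normal_def)
    show "m \<bullet> (x - y) = 0" if "x \<in> F" "y \<in> F" for x y
      using outward_normal_const[OF n(2) F that] by (simp add: inner_diff_right)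
  qed
  then show ?thesis
    using outward_normal_uminus[OF K _ n(1)] F n(2) by (auto simp: facet_of_def)
qed

text \<open>Points just below a relative interior point of the common facet lie in both sets.\<close>

lemma common_facet_interior_meets:
  fixes K L :: "'a::euclidean_space set"
  assumes K: "convex K" "interior K \<noteq> {}" and L: "convex L" "interior L \<noteq> {}"
    and F: "F facet_of K" "F \<subseteq> L" and n: "outward_normal K F n" "outward_normal L F n"
  shows "interior K \<inter> L \<noteq> {}"
proof -
  obtain a b where a: "a \<in> interior K" and b: "b \<in> interior L" using K L by auto
  have "F \<noteq> {}" "F face_of K" "F \<subseteq> K" using F facet_of_imp_subset by (auto simp: facet_of_def)
  then have "rel_interior F \<noteq> {}"
    using K(1) by (meson face_of_imp_convex rel_interior_eq_empty)
  then obtain x e where x: "x \<in> F" and e: "e > 0" "ball x e \<inter> affine hull F \<subseteq> F"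
    by (auto simp: mem_rel_interior_ball)
  define \<alpha> \<beta> where "\<alpha> = n \<bullet> x - n \<bullet> a" and "\<beta> = n \<bullet> x - n \<bullet> b"
  have pos: "\<alpha> > 0" "\<beta> > 0"
    using outward_normal_interior_less[OF n(1) x a] outward_normal_interior_less[OF n(2) x b]
    by (auto simp: \<alpha>_def \<beta>_def)
  \<comment> \<open>The ratio of the depths of \<open>a\<close> and \<open>b\<close> below the
    facet, chosen so that \<open>w\<close> is tangential.\<close>
  define \<rho> where "\<rho> = \<alpha> / \<beta>"
  have \<rho>: "\<rho> > 0" using pos by (simp add: \<rho>_def)
  define w where "w = (a - x) - \<rho> *\<^sub>R (b - x)"
  have nw: "n \<bullet> w = 0"
  proof -
    have "n \<bullet> w = \<rho> * \<beta> - \<alpha>"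
      by (simp add: w_def \<alpha>_def \<beta>_def inner_diff_right algebra_simps)
    then show ?thesis using pos by (simp add: \<rho>_def)
  qed
  \<comment> \<open>Keeps \<open>x + \<delta> *\<^sub>R w\<close> inside the ball in which the
    affine hull belongs to \<open>F\<close>; the bound 1 ensures \<open>\<delta> * t \<le> 1\<close>
    below.\<close>
  define \<delta> where "\<delta> = min 1 (e / (2 * (norm w + 1)))"
  have nw1: "norm w + 1 > 0" by (meson add_nonneg_pos norm_ge_zero zero_less_one)
  have \<delta>: "0 < \<delta>" "\<delta> \<le> 1" using e nw1 by (auto simp: \<delta>_def)
  have "\<delta> * norm w \<le> e / (2 * (norm w + 1)) * (norm w + 1)"
    using \<delta> nw1 e by (intro mult_mono) (auto simp: \<delta>_def)
  also have "\<dots> = e / 2" using nw1 by (simp add: field_simps)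
  finally have "\<delta> * norm w < e" using e by simp
  then have y: "x + \<delta> *\<^sub>R w \<in> F"
    using \<delta> nw by (intro subsetD[OF e(2)])
      (simp add: affine_hull_facet[OF K(2) F(1) n(1) x] dist_norm inner_add_right)
  \<comment> \<open>Determined by \<open>1 - t = \<delta> * \<rho> * t\<close>: then the segment
    from \<open>x + \<delta> *\<^sub>R w\<close> to \<open>b\<close>, inside \<open>L\<close>, meets
    the segment from \<open>x\<close> to \<open>a\<close> in a point interior to
    \<open>K\<close>.\<close>
  define t where "t = 1 / (1 + \<delta> * \<rho>)"
  have d: "1 + \<delta> * \<rho> > 1" using \<delta> \<rho> by simp
  have t: "0 < t" "t \<le> 1" "1 - t = \<delta> * \<rho> * t" using d by (auto simp: t_def field_simps)
  let ?z = "x - (\<delta> * t) *\<^sub>R (x - a)"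
  have "?z \<in> interior K"
    using \<delta> t x \<open>F \<subseteq> K\<close> by (intro mem_interior_convex_shrink K a) (auto simp: mult_le_one)
  moreover have "t *\<^sub>R (x + \<delta> *\<^sub>R w) + (1 - t) *\<^sub>R b \<in> L"
    using y F(2) b interior_subset t by (intro convexD[OF L(1)]) auto
  moreover have "t *\<^sub>R (x + \<delta> *\<^sub>R w) + (1 - t) *\<^sub>R b = ?z"
  proof -
    have "t *\<^sub>R (x + \<delta> *\<^sub>R w) + (1 - t) *\<^sub>R b =
        ((t + \<delta> * \<rho> * t) - \<delta> * t) *\<^sub>R x + (\<delta> * t) *\<^sub>R a + ((1 - t) - \<delta> * \<rho> * t) *\<^sub>R b"
      by (simp add: w_def algebra_simps)
    also have "\<dots> = ?z" unfolding t(3)[symmetric] by (simp add: algebra_simps)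
    finally show ?thesis .
  qed
  ultimately show ?thesis by auto
qed

text \<open>A convex set with interior lies in the closure of its interior, so the limit defining
  the trace is taken along a nontrivial filter and equals the value of any continuous
  extension.\<close>

lemma cell_trace_eq:
  fixes \<eta> p :: "'a::euclidean_space \<Rightarrow> 'b::real_normed_vector"
  assumes K: "convex K" "interior K \<noteq> {}" "x \<in> K"
    and p: "\<And>z. z \<in> interior K \<Longrightarrow> \<eta> z = p z" "continuous_on UNIV p"
  shows "cell_trace K \<eta> x = p x"
proof -
  have "x \<in> closure (interior K)"
    using K convex_closure_interior closure_subset by blast
  then have "x islimpt interior K"
    using interior_limit_point[of x "interior K"] by (auto simp: closure_def)
  then have "at x within interior K \<noteq> bot" by (simp add: trivial_limit_within)
  moreover have "(\<eta> \<longlongrightarrow> p x) (at x within interior K)"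
  proof (rule Lim_transform_eventually)
    show "(p \<longlongrightarrow> p x) (at x within interior K)"
      using p(2) by (metis UNIV_I continuous_on_def subset_UNIV tendsto_within_subset)
    show "\<forall>\<^sub>F z in at x within interior K. p z = \<eta> z"
      using p(1) by (auto simp: eventually_at_filter)
  qed
  ultimately show ?thesis unfolding cell_trace_def by (intro tendsto_Lim)
qed

section \<open>Orientation, translation and additivity of surface integrals\<close>

lemma hyperplane_measure_uminus:
  assumes "norm n = 1"
  shows "hyperplane_measure (- n) (- c) = hyperplane_measure n c"
proof (rule measure_eqI)
  fix A assume "A \<in> sets (hyperplane_measure (- n) (- c))"
  then have A: "A \<in> sets borel" by (simp add: sets_hyperplane_measure)
  then have "(\<integral>\<^sup>+x. indicator A x \<partial>hyperplane_measure (- n) (- c)) = (\<integral>\<^sup>+x. indicator A x \<partial>hyperplane_measure n c)"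
    using assms by (intro nn_integral_hyperplane_uminus) auto
  then show "emeasure (hyperplane_measure (- n) (- c)) A = emeasure (hyperplane_measure n c) A"
    using A by (simp add: sets_hyperplane_measure)
qed (simp add: sets_hyperplane_measure)

lemma distr_hyperplane_measure_translation:
  "distr (hyperplane_measure n c) borel ((+) u) = hyperplane_measure n (c + n \<bullet> u)"
proof (rule measure_eqI)
  fix A :: "'a set" assume "A \<in> sets (distr (hyperplane_measure n c) borel ((+) u))"
  then have [measurable]: "A \<in> sets borel" by simp
  have "emeasure (distr (hyperplane_measure n c) borel ((+) u)) A =
     (\<integral>\<^sup>+x. indicator A x \<partial>distr (hyperplane_measure n c) borel ((+) u))"
    by simp
  also have "\<dots> = (\<integral>\<^sup>+x. indicator A (x + u) \<partial>hyperplane_measure n c)"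
    by (subst nn_integral_distr) (auto simp: add.commute)
  also have "\<dots> = (\<integral>\<^sup>+x. indicator A x \<partial>hyperplane_measure n (c + n \<bullet> u))"
    by (rule nn_integral_hyperplane_translation) measurable
  finally show "emeasure (distr (hyperplane_measure n c) borel ((+) u)) A =
      emeasure (hyperplane_measure n (c + n \<bullet> u)) A"
    by (simp add: sets_hyperplane_measure)
qed (simp add: sets_hyperplane_measure)

lemma surface_integral_cong:
  "(\<And>x. x \<in> F \<Longrightarrow> g x = g' x) \<Longrightarrow> surface_integral F n g = surface_integral F n g'"
  unfolding surface_integral_def set_lebesgue_integral_def
  by (intro Bochner_Integration.integral_cong) (auto simp: indicator_def)

lemma surface_integral_uminus:
  assumes "norm n = 1"
  shows "surface_integral F (- n) g = surface_integral F n g"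
  using assms by (simp add: surface_integral_def hyperplane_measure_uminus)

text \<open>Serves the periodic faces, where the flux through the translated facet is brought back
  to \<open>F\<close>.\<close>

lemma surface_integral_translation:
  fixes F :: "'a::euclidean_space set"
  assumes F: "compact F" "F \<noteq> {}" "\<And>x y. x \<in> F \<Longrightarrow> y \<in> F \<Longrightarrow> n \<bullet> x = n \<bullet> y"
    and g: "continuous_on UNIV g"
  shows "surface_integral ((+) u ` F) n g = surface_integral F n (\<lambda>x. g (u + x))"
proof -
  obtain y where y: "y \<in> F" using F by auto
  have [measurable]: "(+) u ` F \<in> sets borel" "g \<in> borel_measurable borel"
    using g compact_translation[OF F(1), of u]
    by (auto intro: borel_compact borel_measurable_continuous_onI)
  have ind: "indicator ((+) u ` F) (u + x) = (indicator F x :: real)" for x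
    by (auto simp: indicator_def)
  have "surface_integral ((+) u ` F) n g =
      (LINT x|hyperplane_measure n (n \<bullet> (u + y)). indicator ((+) u ` F) x * g x)"
  proof (rule surface_integral_eq)
    show "u + y \<in> (+) u ` F" using y by simp
    show "n \<bullet> x = n \<bullet> (u + y)" if x: "x \<in> (+) u ` F" for x
    proof -
      obtain z where "z \<in> F" "x = u + z" using x by auto
      then show ?thesis using F(3)[OF _ y, of z] by (simp add: inner_add_right)
    qed
  qed
  also have "hyperplane_measure n (n \<bullet> (u + y)) = distr (hyperplane_measure n (n \<bullet> y)) borel ((+) u)"
    by (simp add: distr_hyperplane_measure_translation inner_add_right add.commute)
  also have "(LINT x|\<dots>. indicator ((+) u ` F) x * g x) =
      (LINT x|hyperplane_measure n (n \<bullet> y). indicator ((+) u ` F) (u + x) * g (u + x))"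
    by (rule integral_distr) measurable
  also have "\<dots> = surface_integral F n (\<lambda>x. g (u + x))"
    unfolding ind using F(3) y by (intro surface_integral_eq[symmetric]) blast+
  finally show ?thesis .
qed

lemma surface_integral_add:
  fixes F :: "'a::euclidean_space set"
  assumes n: "norm n = 1" and "compact F" "continuous_on UNIV g" "continuous_on UNIV g'"
  shows "surface_integral F n (\<lambda>x. g x + g' x) = surface_integral F n g + surface_integral F n g'"
  using Bochner_Integration.integral_add[OF integrable_hyperplane_compact[OF n assms(2,3)] integrable_hyperplane_compact[OF n assms(2,4)]]
  by (simp add: surface_integral_def set_lebesgue_integral_def distrib_left)

section \<open>Meshes\<close>

text \<open>A proper face misses the interior of its polytope. The intersection is a face of both
  cells, so a common point interior to \<open>K\<close> makes it all of \<open>K\<close>; then the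
  interior of \<open>K\<close> lies in that of \<open>L\<close>, and the intersection is all of
  \<open>L\<close> too.\<close>

lemma cell_eqI_interior_meets:
  assumes mesh: "conforming_mesh \<Omega> \<K>" and KL: "K \<in> \<K>" "L \<in> \<K>" "interior K \<inter> L \<noteq> {}"
  shows "K = L"
proof -
  have conv: "convex K" "convex L" and int: "interior K \<noteq> {}"
    using mesh KL by (auto simp: conforming_mesh_def polytope_imp_convex)
  have face: "K \<inter> L face_of K" "L \<inter> K face_of L"
    using mesh KL by (auto simp: conforming_mesh_def)
  have "K \<inter> L = K"
  proof (rule ccontr)
    assume "K \<inter> L \<noteq> K"
    then have "(K \<inter> L) \<inter> interior K = {}" using face(1) by (intro face_of_disjoint_interior)
    then show False using KL(3) interior_subset by blast
  qed
  then have sub: "K \<subseteq> L" by blast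
  have "L \<inter> K = L"
  proof (rule ccontr)
    assume "L \<inter> K \<noteq> L"
    then have "(L \<inter> K) \<inter> interior L = {}" using face(2) by (intro face_of_disjoint_interior)
    moreover have "interior K \<subseteq> L \<inter> K \<inter> interior L"
      using sub interior_mono[OF sub] interior_subset by blast
    ultimately show False using int by blast
  qed
  then show ?thesis using sub by blast
qed

text \<open>Cells with the same outward normal on a common facet lie on the same side of it and
  overlap. This is the uniqueness behind the definite description in
  \<open>one_sided\<close>.\<close>

lemma same_outward_normal_imp_eq:
  assumes mesh: "conforming_mesh \<Omega> \<K>" and KL: "K \<in> \<K>" "L \<in> \<K>"
    and F: "F facet_of K" "F facet_of L" and n: "outward_normal K F n" "outward_normal L F n"
  shows "K = L"
proof (rule cell_eqI_interior_meets[OF mesh KL])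
  have "polytope K" "interior K \<noteq> {}" "polytope L" "interior L \<noteq> {}"
    using mesh KL by (auto simp: conforming_mesh_def)
  then show "interior K \<inter> L \<noteq> {}"
    using F n by (intro common_facet_interior_meets) (use facet_of_imp_subset[OF F(2)] in \<open>auto intro: polytope_imp_convex\<close>)
qed

text \<open>Says that \<open>(K, r)\<close> is what the definite description in \<open>one_sided\<close> picks.\<close>

definition is_side ::
  "'a::euclidean_space set set \<Rightarrow> 'a set \<times> 'a \<Rightarrow> 'a \<Rightarrow> 'a set \<Rightarrow> 'a \<Rightarrow> bool" where
  "is_side \<K> \<gamma> n K r \<longleftrightarrow>
     (\<forall>C t. C \<in> \<K> \<and> t \<in> {0, snd \<gamma>} \<and> (+) t ` fst \<gamma> facet_of C \<and> outward_normal C ((+) t ` fst \<gamma>) n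
        \<longleftrightarrow> C = K \<and> t = r)"

lemma is_sideI:
  assumes "K \<in> \<K>" "r \<in> {0, snd \<gamma>}" "(+) r ` fst \<gamma> facet_of K" "outward_normal K ((+) r ` fst \<gamma>) n"
    and "\<And>C t. C \<in> \<K> \<Longrightarrow> t \<in> {0, snd \<gamma>} \<Longrightarrow> (+) t ` fst \<gamma> facet_of C \<Longrightarrow>
      outward_normal C ((+) t ` fst \<gamma>) n \<Longrightarrow> C = K \<and> t = r"
  shows "is_side \<K> \<gamma> n K r"
  unfolding is_side_def
proof (intro allI iffI)
  fix C t
  assume "C \<in> \<K> \<and> t \<in> {0, snd \<gamma>} \<and> (+) t ` fst \<gamma> facet_of C \<and> outward_normal C ((+) t ` fst \<gamma>) n"
  then show "C = K \<and> t = r" by (elim conjE) (rule assms(5))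
next
  fix C t
  assume "C = K \<and> t = r"
  then show "C \<in> \<K> \<and> t \<in> {0, snd \<gamma>} \<and> (+) t ` fst \<gamma> facet_of C \<and> outward_normal C ((+) t ` fst \<gamma>) n"
    using assms(1-4) by simp
qed

lemma is_sideD:
  assumes "is_side \<K> \<gamma> n K r"
  shows "K \<in> \<K>" "(+) r ` fst \<gamma> facet_of K" "outward_normal K ((+) r ` fst \<gamma>) n"
proof -
  have "K \<in> \<K> \<and> r \<in> {0, snd \<gamma>} \<and> (+) r ` fst \<gamma> facet_of K \<and> outward_normal K ((+) r ` fst \<gamma>) n
      \<longleftrightarrow> K = K \<and> r = r"
    using assms unfolding is_side_def by (elim allE)
  then show "K \<in> \<K>" "(+) r ` fst \<gamma> facet_of K" "outward_normal K ((+) r ` fst \<gamma>) n"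
    by simp_all
qed

lemma one_sided_eq_cell_trace:
  assumes "is_side \<K> \<gamma> n K r"
  shows "one_sided \<K> \<gamma> n \<eta> x = cell_trace K \<eta> (r + x)"
proof -
  have "(THE (K, r). K \<in> \<K> \<and> r \<in> {0, snd \<gamma>} \<and> (+) r ` fst \<gamma> facet_of K \<and>
      outward_normal K ((+) r ` fst \<gamma>) n) = (K, r)"
    using assms unfolding is_side_def by (intro the_equality) (auto split: prod.splits)
  then show ?thesis by (simp add: one_sided_def)
qed

lemma frechet_derivative_cong_open:
  assumes "open S" "x \<in> S" "\<And>z. z \<in> S \<Longrightarrow> f z = g z"
  shows "frechet_derivative f (at x) = frechet_derivative g (at x)"
proof -
  have "(f has_derivative f') (at x) \<longleftrightarrow> (g has_derivative f') (at x)" for f'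
    using assms has_derivative_transform_within_open[of f f' x UNIV S g]
      has_derivative_transform_within_open[of g f' x UNIV S f] by auto
  then show ?thesis by (simp add: frechet_derivative_def)
qed

lemma grad_eq_gradient:
  assumes "(f has_derivative (\<lambda>u. g \<bullet> u)) (at x)"
  shows "grad f x = g"
  unfolding grad_def frechet_derivative_at[OF assms, symmetric] by (rule euclidean_representation)

lemma polys_imp_real_polynomial:
  fixes p :: "'a::euclidean_space \<Rightarrow> real"
  assumes "p \<in> polys q"
  shows "real_polynomial_function p"
proof -
  obtain c where p: "\<forall>x. p x = (\<Sum>\<alpha> | \<alpha> \<in> Basis \<rightarrow>\<^sub>E {..q} \<and> sum \<alpha> Basis \<le> q.
      c \<alpha> * (\<Prod>b\<in>Basis. (x \<bullet> b) ^ \<alpha> b))"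
    using assms unfolding polys_def by blast
  have fin: "finite {\<alpha>. \<alpha> \<in> (Basis::'a set) \<rightarrow>\<^sub>E {..q} \<and> sum \<alpha> Basis \<le> q}"
    by (rule finite_subset[of _ "Basis \<rightarrow>\<^sub>E {..q}"]) (auto intro: finite_PiE)
  have "real_polynomial_function (\<lambda>x. c \<alpha> * (\<Prod>b\<in>Basis. (x \<bullet> b) ^ \<alpha> b))" for \<alpha> :: "'a \<Rightarrow> nat"
    by (intro real_polynomial_function.intros(4)[OF real_polynomial_function.intros(2)] finite_Basis
        real_polynomial_function_prod real_polynomial_function_power
        real_polynomial_function.intros(1) bounded_linear_inner_left)
  then have "real_polynomial_function (\<lambda>x. \<Sum>\<alpha> | \<alpha> \<in> Basis \<rightarrow>\<^sub>E {..q} \<and> sum \<alpha> Basis \<le> q.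
      c \<alpha> * (\<Prod>b\<in>Basis. (x \<bullet> b) ^ \<alpha> b))"
    by (intro real_polynomial_function_sum[OF fin])
  moreover have "p = (\<lambda>x. \<Sum>\<alpha> | \<alpha> \<in> Basis \<rightarrow>\<^sub>E {..q} \<and> sum \<alpha> Basis \<le> q.
      c \<alpha> * (\<Prod>b\<in>Basis. (x \<bullet> b) ^ \<alpha> b))"
    by (rule ext) (rule p[rule_format])
  ultimately show ?thesis by (rule ssubst[rotated])
qed

section \<open>Mesh facets and the two sides of a face\<close>

locale fe_mesh =
  fixes \<Omega> :: "'a::euclidean_space set" and \<K> :: "'a set set"
    and P :: "('a set \<times> 'a) set" and D :: "'a set set" and \<nu> :: "'a set \<Rightarrow> 'a"
  assumes domain: "polyhedral_domain \<Omega>"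
    and mesh: "conforming_mesh \<Omega> \<K>"
    and bdry: "boundary_splitting \<K> P D"
    and normals: "unit_normal_field \<K> P \<nu>"
begin

lemma cell:
  assumes "K \<in> \<K>"
  shows "polytope K" "convex K" "compact K" "interior K \<noteq> {}"
  using mesh assms by (auto simp: conforming_mesh_def polytope_imp_convex polytope_imp_compact)

lemma finite_cells: "finite \<K>"
  using mesh by (simp add: conforming_mesh_def)

lemma finite_mesh_facets: "finite (mesh_facets \<K>)"
proof -
  have "mesh_facets \<K> = (\<Union>K\<in>\<K>. {F. F facet_of K})" by (auto simp: mesh_facets_def)
  then show ?thesis using finite_cells cell(1) by (auto intro: finite_polytope_facets)
qed

lemma interior_boundary_facets:
  "interior_facets \<K> \<subseteq> mesh_facets \<K>" "boundary_facets \<K> \<subseteq> mesh_facets \<K>"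
  "interior_facets \<K> \<inter> boundary_facets \<K> = {}"
  "mesh_facets \<K> = interior_facets \<K> \<union> boundary_facets \<K>"
  by (auto simp: boundary_facets_def interior_facets_def mesh_facets_def)

lemma outward_normal_cases:
  assumes K: "K \<in> \<K>" "F facet_of K" and m: "norm m = 1" "\<And>x y. x \<in> F \<Longrightarrow> y \<in> F \<Longrightarrow> m \<bullet> (x - y) = 0"
  shows "outward_normal K F m \<or> outward_normal K F (- m)"
proof -
  obtain n where n: "outward_normal K F n"
    using facet_outward_normal_exists[OF cell(1,4)[OF K(1)] K(2)] .
  have "m = n \<or> m = - n" by (rule unit_normal_cases[OF cell(4)[OF K(1)] K(2) n m])
  then show ?thesis using n by auto
qed

lemma not_both_outward:
  assumes K: "K \<in> \<K>" "F facet_of K" and "outward_normal K F m"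
  shows "\<not> outward_normal K F (- m)"
  using assms by (intro outward_normal_uminus cell) (auto simp: facet_of_def)

lemma unit_normal:
  assumes "(F, s) \<in> Gam \<K> P"
  shows "norm (\<nu> F) = 1" "\<And>x y. x \<in> F \<Longrightarrow> y \<in> F \<Longrightarrow> \<nu> F \<bullet> (x - y) = 0"
  using normals assms by (auto simp: unit_normal_field_def)

text \<open>Two cells share the facet, and on each of them the outward normal is one of the two unit
  normals. Equal orientations would identify the cells, so each orientation occurs exactly once and
  there is no third cell.\<close>

lemma interior_facet_sides:
  assumes F: "F \<in> interior_facets \<K>"
  obtains K L where "K \<noteq> L" "{C \<in> \<K>. F facet_of C} = {K, L}"
    "is_side \<K> (F, 0) (\<nu> F) K 0" "is_side \<K> (F, 0) (- \<nu> F) L 0"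
proof -
  have G: "(F, 0) \<in> Gam \<K> P" using F by (simp add: Gam_def)
  note cs = outward_normal_cases[OF _ _ unit_normal[OF G]]
  have uniq: "C = C'"
    if "C \<in> \<K>" "F facet_of C" "C' \<in> \<K>" "F facet_of C'" "outward_normal C F n" "outward_normal C' F n" for C C' n
    using same_outward_normal_imp_eq[OF mesh that(1,3,2,4,5,6)] .
  obtain K0 L0 where KL0: "K0 \<in> \<K>" "L0 \<in> \<K>" "K0 \<noteq> L0" "F facet_of K0" "F facet_of L0"
    using F by (auto simp: interior_facets_def)
  have "\<exists>K\<in>\<K>. \<exists>L\<in>\<K>. K \<noteq> L \<and> F facet_of K \<and> F facet_of L \<and>
      outward_normal K F (\<nu> F) \<and> outward_normal L F (- \<nu> F)"
    using cs[OF KL0(1,4)] cs[OF KL0(2,5)] uniq KL0 by metis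
  then obtain K L where KL: "K \<in> \<K>" "L \<in> \<K>" "K \<noteq> L" "F facet_of K" "F facet_of L"
      "outward_normal K F (\<nu> F)" "outward_normal L F (- \<nu> F)"
    by blast
  have K: "C \<in> \<K> \<and> F facet_of C \<and> outward_normal C F (\<nu> F) \<longleftrightarrow> C = K" for C
    using uniq[of C K] KL by blast
  have L: "C \<in> \<K> \<and> F facet_of C \<and> outward_normal C F (- \<nu> F) \<longleftrightarrow> C = L" for C
    using uniq[of C L] KL by blast
  show ?thesis
  proof
    show "{C \<in> \<K>. F facet_of C} = {K, L}" using K L cs by blast
    show "is_side \<K> (F, 0) (\<nu> F) K 0" using K[of K] KL(1) by (intro is_sideI) (auto simp: K[symmetric])
    show "is_side \<K> (F, 0) (- \<nu> F) L 0" using L[of L] KL(2) by (intro is_sideI) (auto simp: L[symmetric])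
  qed (rule KL)
qed

lemma boundary_roles:
  "inj_on fst P" "inj_on (\<lambda>(F, s). (+) s ` F) P"
  "fst ` P \<inter> (\<lambda>(F, s). (+) s ` F) ` P = {}" "D \<inter> fst ` P = {}" "D \<inter> (\<lambda>(F, s). (+) s ` F) ` P = {}"
  "D \<union> fst ` P \<union> (\<lambda>(F, s). (+) s ` F) ` P = boundary_facets \<K>"
proof -
  note b = bdry[unfolded boundary_splitting_def Let_def, THEN conjunct1]
  show "inj_on fst P" using b by (elim conjE)
  show "inj_on (\<lambda>(F, s). (+) s ` F) P" using b by (elim conjE)
  show "fst ` P \<inter> (\<lambda>(F, s). (+) s ` F) ` P = {}" using b by (elim conjE)
  show "D \<inter> fst ` P = {}" using b by (elim conjE)
  show "D \<inter> (\<lambda>(F, s). (+) s ` F) ` P = {}" using b by (elim conjE)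
  show "D \<union> fst ` P \<union> (\<lambda>(F, s). (+) s ` F) ` P = boundary_facets \<K>" using b by (elim conjE)
qed

lemma boundary_facet_cell:
  assumes "F \<in> boundary_facets \<K>"
  obtains K where "{C \<in> \<K>. F facet_of C} = {K}"
proof -
  obtain K where K: "K \<in> \<K>" "F facet_of K"
    using assms by (auto simp: boundary_facets_def mesh_facets_def)
  moreover have "C = K" if "C \<in> \<K>" "F facet_of C" for C
    using assms K that by (auto simp: boundary_facets_def interior_facets_def)
  ultimately have "{C \<in> \<K>. F facet_of C} = {K}" by blast
  then show ?thesis by (rule that)
qed

text \<open>A boundary facet has a single cell, and the splitting makes the outward normals at
  \<open>F\<close> and at its translate opposite. The disjunction records at which of the two
  \<open>\<nu> F\<close> points outward; \<open>K\<close> and \<open>L\<close> may be the same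
  cell.\<close>

lemma periodic_facet_sides:
  assumes FS: "(F, s) \<in> P"
  obtains K L r r' where
    "(r = 0 \<and> r' = s \<and> {C \<in> \<K>. F facet_of C} = {K} \<and> {C \<in> \<K>. (+) s ` F facet_of C} = {L}) \<or>
     (r = s \<and> r' = 0 \<and> {C \<in> \<K>. F facet_of C} = {L} \<and> {C \<in> \<K>. (+) s ` F facet_of C} = {K})"
    "is_side \<K> (F, s) (\<nu> F) K r" "is_side \<K> (F, s) (- \<nu> F) L r'"
proof -
  have G: "(F, s) \<in> Gam \<K> P" using FS by (simp add: Gam_def)
  have "F \<in> boundary_facets \<K>"
    unfolding boundary_roles(6)[symmetric] using imageI[OF FS, of fst] by simp
  then obtain K0 where K0: "{C \<in> \<K>. F facet_of C} = {K0}" by (rule boundary_facet_cell)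
  have "(+) s ` F \<in> boundary_facets \<K>"
    unfolding boundary_roles(6)[symmetric] using imageI[OF FS, of "\<lambda>(F, s). (+) s ` F"] by simp
  then obtain L0 where L0: "{C \<in> \<K>. (+) s ` F facet_of C} = {L0}" by (rule boundary_facet_cell)
  have K: "K0 \<in> \<K>" "F facet_of K0" and L: "L0 \<in> \<K>" "(+) s ` F facet_of L0"
    using K0 L0 by blast+
  have opp: "outward_normal L0 ((+) s ` F) (- n)" if "outward_normal K0 F n" for n
    using bdry FS K L that unfolding boundary_splitting_def by blast
  have side: "is_side \<K> (F, s) n K0 0" "is_side \<K> (F, s) (- n) L0 s" if n: "outward_normal K0 F n" for n
  proof -
    have "\<not> outward_normal K0 F (- n)" "\<not> outward_normal L0 ((+) s ` F) n"
      using not_both_outward[OF K n] not_both_outward[OF L opp[OF n]] by auto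
    moreover have "C \<in> \<K> \<and> F facet_of C \<longleftrightarrow> C = K0" "C \<in> \<K> \<and> (+) s ` F facet_of C \<longleftrightarrow> C = L0" for C
      using K0 L0 by auto
    ultimately show "is_side \<K> (F, s) n K0 0" "is_side \<K> (F, s) (- n) L0 s"
      using n opp[OF n] K L by (intro is_sideI; force)+
  qed
  from outward_normal_cases[OF K unit_normal[OF G]] show ?thesis
  proof
    assume "outward_normal K0 F (\<nu> F)"
    then show ?thesis using side K0 L0 by (intro that[of 0 s K0 L0]) auto
  next
    assume "outward_normal K0 F (- \<nu> F)"
    then show ?thesis using side[of "- \<nu> F"] K0 L0 by (intro that[of s 0 L0 K0]) auto
  qed
qed

section \<open>Integrals over the domain as sums over cells\<close>

lemma AE_notin_cell_frontiers: "AE x in lebesgue. x \<notin> (\<Union>K\<in>\<K>. frontier K)"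
proof -
  have "negligible (\<Union>K\<in>\<K>. frontier K)"
    using finite_cells cell(2)
    by (intro negligible_Union finite_imageI) (auto intro: negligible_convex_frontier)
  then show ?thesis unfolding negligible_iff_null_sets by (rule AE_not_in)
qed

text \<open>Off the cell frontiers the cell interiors partition the domain. They cannot leave
  \<open>\<Omega>\<close>, being open parts of \<open>closure \<Omega>\<close>, whose interior is
  \<open>\<Omega>\<close>.\<close>

lemma indicator_cells:
  assumes x: "x \<notin> (\<Union>K\<in>\<K>. frontier K)" and u: "\<And>K. K \<in> \<K> \<Longrightarrow> x \<in> interior K \<Longrightarrow> u x = U K x"
  shows "indicator \<Omega> x * u x = (\<Sum>K\<in>\<K>. indicator K x * (U K x :: real))"
proof (cases "x \<in> \<Omega>")
  case False
  have "x \<notin> K" if K: "K \<in> \<K>" for K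
  proof
    assume "x \<in> K"
    then have "x \<in> interior K"
      using x K by (auto simp: frontier_def closure_closed[OF compact_imp_closed[OF cell(3)]])
    moreover have "interior K \<subseteq> interior (closure \<Omega>)"
      using mesh K by (intro interior_mono) (auto simp: conforming_mesh_def)
    ultimately show False using False domain by (auto simp: polyhedral_domain_def)
  qed
  then show ?thesis using False by simp
next
  case True
  then have "x \<in> \<Union>\<K>"
    using mesh closure_subset[of \<Omega>] by (auto simp: conforming_mesh_def)
  then obtain K where K: "K \<in> \<K>" "x \<in> K" by blast
  then have xi: "x \<in> interior K"
    using x by (auto simp: frontier_def closure_closed[OF compact_imp_closed[OF cell(3)]])
  have "x \<notin> L" if "L \<in> \<K>" "L \<noteq> K" for L
    using cell_eqI_interior_meets[OF mesh K(1) that(1)] xi that by blast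
  then have "(\<Sum>L\<in>\<K>. indicator L x * U L x) = (\<Sum>L\<in>\<K>. if L = K then U K x else 0)"
    using K by (intro sum.cong) auto
  then show ?thesis using True K finite_cells u[OF K(1) xi] by simp
qed

text \<open>The values of \<open>u\<close> on the cell frontiers are arbitrary, so \<open>u\<close>
  agrees only almost everywhere on \<open>\<Omega>\<close> with a Borel function; completeness of
  \<open>lebesgue\<close> still makes it measurable there.\<close>

lemma integral_cells:
  fixes u :: "'a \<Rightarrow> real"
  assumes u: "\<And>K x. K \<in> \<K> \<Longrightarrow> x \<in> interior K \<Longrightarrow> u x = U K x"
    and U: "\<And>K. K \<in> \<K> \<Longrightarrow> continuous_on UNIV (U K)"
  shows "set_integrable lebesgue \<Omega> u"
    "(LINT x:\<Omega>|lebesgue. u x) = (\<Sum>K\<in>\<K>. LINT x:K|lborel. U K x)"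
proof -
  let ?S = "\<lambda>x. \<Sum>K\<in>\<K>. indicator K x * U K x"
  have int: "integrable lborel (\<lambda>x. indicator K x * U K x)" if "K \<in> \<K>" for K
    using cell(3)[OF that] U[OF that] by (rule integrable_lborel_compact)
  have intS: "integrable lborel ?S" using int by (rule Bochner_Integration.integrable_sum)
  then have Sm: "?S \<in> borel_measurable lborel" by (rule borel_measurable_integrable)
  have intS': "integrable lebesgue ?S" using intS integrable_completion[OF Sm] by blast
  have ae: "AE x in lebesgue. ?S x = indicator \<Omega> x * u x"
    using AE_notin_cell_frontiers
  proof eventually_elim
    case (elim x)
    then show ?case using u by (intro indicator_cells[symmetric]) auto
  qed
  have meas: "(\<lambda>x. indicator \<Omega> x * u x) \<in> borel_measurable lebesgue"
    by (rule borel_measurable_AE[OF borel_measurable_integrable[OF intS'] ae])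
  show "set_integrable lebesgue \<Omega> u"
    unfolding set_integrable_def
    using integrable_cong_AE_imp[OF intS' meas] ae by (simp add: eq_commute)
  have "(LINT x:\<Omega>|lebesgue. u x) = (LINT x|lebesgue. ?S x)"
    unfolding set_lebesgue_integral_def
    using integral_cong_AE[OF borel_measurable_integrable[OF intS'] meas ae] by simp
  also have "\<dots> = (LINT x|lborel. ?S x)" by (rule integral_completion[OF Sm])
  also have "\<dots> = (\<Sum>K\<in>\<K>. LINT x:K|lborel. U K x)"
    using int by (subst Bochner_Integration.integral_sum) (auto simp: set_lebesgue_integral_def)
  finally show "(LINT x:\<Omega>|lebesgue. u x) = (\<Sum>K\<in>\<K>. LINT x:K|lborel. U K x)" .
qed

end

section \<open>The transport term\<close>

context fe_mesh
begin

lemma Gam_sides: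
  assumes "(F, s) \<in> Gam \<K> P"
  obtains K r L r' where "is_side \<K> (F, s) (\<nu> F) K r" "is_side \<K> (F, s) (- \<nu> F) L r'"
proof (cases "(F, s) \<in> P")
  case True
  then show ?thesis using periodic_facet_sides that by metis
next
  case False
  then have "F \<in> interior_facets \<K>" "s = 0" using assms by (auto simp: Gam_def)
  then show ?thesis using interior_facet_sides that by metis
qed

lemma one_sided_trace:
  fixes u :: "'a \<Rightarrow> 'b::real_normed_vector"
  assumes side: "is_side \<K> (F, s) n K r" and x: "x \<in> F"
    and U: "\<And>z. z \<in> interior K \<Longrightarrow> u z = U z" "continuous_on UNIV U"
  shows "one_sided \<K> (F, s) n u x = U (r + x)"
proof -
  note sd = is_sideD[OF side, simplified]
  have "r + x \<in> K" using facet_of_imp_subset[OF sd(2)] x by blast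
  then have "cell_trace K u (r + x) = U (r + x)"
    using cell[OF sd(1)] U by (intro cell_trace_eq)
  then show ?thesis by (simp add: one_sided_eq_cell_trace[OF side])
qed

text \<open>Both fluxes are pulled back to the representative facet by the shifts \<open>r\<close>
  and \<open>r'\<close>, so internal and periodic faces are treated alike. \<open>hdiv\<close> then
  lets the common normal velocity be factored out of the difference of squares.\<close>

lemma facet_flux_pair:
  assumes \<gamma>: "(F, s) \<in> Gam \<K> P"
    and side: "is_side \<K> (F, s) (\<nu> F) K r" "is_side \<K> (F, s) (- \<nu> F) L r'"
    and p: "\<And>C x. C \<in> \<K> \<Longrightarrow> x \<in> interior C \<Longrightarrow> w x = p C x" "\<And>C. C \<in> \<K> \<Longrightarrow> continuous_on UNIV (p C)"
    and G: "\<And>C x. C \<in> \<K> \<Longrightarrow> x \<in> interior C \<Longrightarrow> v x = G C x" "\<And>C. C \<in> \<K> \<Longrightarrow> continuous_on UNIV (G C)"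
    and n: "\<And>C F. C \<in> \<K> \<Longrightarrow> F facet_of C \<Longrightarrow> outward_normal C F (n C F)"
    and hdiv: "\<And>x. x \<in> F \<Longrightarrow> upwind \<K> \<nu> (F, s) v x \<bullet> \<nu> F = downwind \<K> \<nu> (F, s) v x \<bullet> \<nu> F"
  defines "T \<equiv> \<lambda>C F. surface_integral F (n C F) (\<lambda>x. (((p C x)\<^sup>2 / 2) *\<^sub>R G C x) \<bullet> n C F)"
  shows "T K ((+) r ` F) + T L ((+) r' ` F) = surface_integral F (\<nu> F)
    (\<lambda>x. (upwind \<K> \<nu> (F, s) v x \<bullet> \<nu> F) * face_avg \<K> \<nu> (F, s) w x * face_jump \<K> \<nu> (F, s) w x)"
proof -
  let ?m = "\<nu> F"
  note sK = is_sideD[OF side(1), simplified] and sL = is_sideD[OF side(2), simplified]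
  have const: "?m \<bullet> x = ?m \<bullet> y" if "x \<in> F" "y \<in> F" for x y
    using unit_normal(2)[OF \<gamma> that] by (simp add: inner_diff_right)
  have nm: "norm ?m = 1" by (rule unit_normal(1)[OF \<gamma>])
  \<comment> \<open>Outward normals are unique, so the given choice \<open>n\<close> must be
    \<open>\<nu> F\<close> on this side and \<open>- \<nu> F\<close> on the other.\<close>
  have nK: "n K ((+) r ` F) = ?m"
    by (rule outward_normal_unique[OF cell(4)[OF sK(1)] sK(2,3) n[OF sK(1,2)]])
  have nL: "n L ((+) r' ` F) = - ?m"
    by (rule outward_normal_unique[OF cell(4)[OF sL(1)] sL(2,3) n[OF sL(1,2)]])
  have ne: "F \<noteq> {}" using sK(2) by (auto simp: facet_of_def)
  have cF: "compact F"
  proof -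
    have "compact ((+) (- r) ` (+) r ` F)"
      using polytope_facet_props(1)[OF cell(1)[OF sK(1)] sK(2)] by (rule compact_translation)
    moreover have "(+) (- r) ` (+) r ` F = F" by (simp add: image_image)
    ultimately show ?thesis by simp
  qed
  define QK where "QK x = (((p K x)\<^sup>2 / 2) *\<^sub>R G K x) \<bullet> ?m" for x
  define QL where "QL x = (((p L x)\<^sup>2 / 2) *\<^sub>R G L x) \<bullet> (- ?m)" for x
  have cont: "continuous_on UNIV QK" "continuous_on UNIV QL"
    unfolding QK_def QL_def using p(2) G(2) sK(1) sL(1) by (auto intro!: continuous_intros)
  have cont': "continuous_on UNIV (\<lambda>x. QK (r + x))" "continuous_on UNIV (\<lambda>x. QL (r' + x))"
    by (rule continuous_on_compose2[OF cont(1)] continuous_on_compose2[OF cont(2)], intro continuous_intros, simp)+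
  have "T K ((+) r ` F) = surface_integral F ?m (\<lambda>x. QK (r + x))"
    unfolding T_def nK QK_def[symmetric] using const by (intro surface_integral_translation cF ne cont)
  moreover have "T L ((+) r' ` F) = surface_integral F ?m (\<lambda>x. QL (r' + x))"
    unfolding T_def nL QL_def[symmetric] surface_integral_uminus[OF nm]
    using const by (intro surface_integral_translation cF ne cont)
  ultimately have "T K ((+) r ` F) + T L ((+) r' ` F) = surface_integral F ?m (\<lambda>x. QK (r + x) + QL (r' + x))"
    by (simp add: surface_integral_add[OF nm cF cont'])
  also have "\<dots> = surface_integral F ?m
    (\<lambda>x. (upwind \<K> \<nu> (F, s) v x \<bullet> ?m) * face_avg \<K> \<nu> (F, s) w x * face_jump \<K> \<nu> (F, s) w x)"
  proof (rule surface_integral_cong)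
    fix x assume x: "x \<in> F"
    have up: "upwind \<K> \<nu> (F, s) w x = p K (r + x)" "upwind \<K> \<nu> (F, s) v x = G K (r + x)"
      unfolding upwind_def
      using one_sided_trace[OF side(1) x, of w "p K"] one_sided_trace[OF side(1) x, of v "G K"]
        p G sK(1) by auto
    have down: "downwind \<K> \<nu> (F, s) w x = p L (r' + x)" "downwind \<K> \<nu> (F, s) v x = G L (r' + x)"
      unfolding downwind_def
      using one_sided_trace[OF side(2) x, of w "p L"] one_sided_trace[OF side(2) x, of v "G L"]
        p G sL(1) by auto
    have h: "G L (r' + x) \<bullet> ?m = G K (r + x) \<bullet> ?m"
      using hdiv[OF x] up down by simp
    show "QK (r + x) + QL (r' + x) =
      (upwind \<K> \<nu> (F, s) v x \<bullet> ?m) * face_avg \<K> \<nu> (F, s) w x * face_jump \<K> \<nu> (F, s) w x"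
      unfolding QK_def QL_def face_avg_def face_jump_def up down inner_minus_right inner_scaleR_left h
      by (simp add: field_simps power2_eq_square)
  qed
  finally show ?thesis .
qed

text \<open>Pure incidence counting, with the sum regrouped by facets. An internal facet is met by
  two cells; a boundary facet by one, and it is either Dirichlet, with zero contribution, or one
  half of a periodic pair.\<close>

lemma sum_facets_eq_sum_Gam:
  fixes T :: "'a set \<Rightarrow> 'a set \<Rightarrow> real"
  assumes D0: "\<And>F K. F \<in> D \<Longrightarrow> K \<in> \<K> \<Longrightarrow> F facet_of K \<Longrightarrow> T K F = 0"
    and pair: "\<And>F s K r L r'. (F, s) \<in> Gam \<K> P \<Longrightarrow> is_side \<K> (F, s) (\<nu> F) K r \<Longrightarrow>
        is_side \<K> (F, s) (- \<nu> F) L r' \<Longrightarrow> T K ((+) r ` F) + T L ((+) r' ` F) = J (F, s)"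
  shows "(\<Sum>K\<in>\<K>. \<Sum>F | F facet_of K. T K F) = (\<Sum>\<gamma>\<in>Gam \<K> P. J \<gamma>)"
proof -
  define S where "S F = (\<Sum>K | K \<in> \<K> \<and> F facet_of K. T K F)" for F
  define tr where "tr = (\<lambda>(F :: 'a set, s). (+) s ` F)"
  let ?I = "interior_facets \<K>" and ?B = "boundary_facets \<K>"
  have fin: "finite ?I" "finite ?B"
    using finite_mesh_facets interior_boundary_facets by (auto intro: finite_subset)
  have b: "inj_on fst P" "inj_on tr P" "fst ` P \<inter> tr ` P = {}" "D \<inter> fst ` P = {}" "D \<inter> tr ` P = {}"
    "D \<union> fst ` P \<union> tr ` P = ?B"
    unfolding tr_def by (rule boundary_roles)+
  have finP: "finite P"
    using fin(2) b(1,6) by (metis finite_Un finite_imageD)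
  have finD: "finite D" using fin(2) b(6) by (metis finite_Un)
  \<comment> \<open>Gives the facet sums a common finite range, as the exchange of summation
    requires.\<close>
  have "(\<Sum>K\<in>\<K>. \<Sum>F | F facet_of K. T K F) = (\<Sum>K\<in>\<K>. \<Sum>F | F \<in> mesh_facets \<K> \<and> F facet_of K. T K F)"
    by (intro sum.cong refl arg_cong2[where f=sum]) (auto simp: mesh_facets_def)
  also have "\<dots> = (\<Sum>F\<in>mesh_facets \<K>. S F)"
    unfolding S_def by (rule sum.swap_restrict[OF finite_cells finite_mesh_facets])
  also have "\<dots> = (\<Sum>F\<in>?I. S F) + (\<Sum>F\<in>?B. S F)"
    unfolding interior_boundary_facets(4) by (rule sum.union_disjoint[OF fin interior_boundary_facets(3)])
  also have "(\<Sum>F\<in>?I. S F) = (\<Sum>\<gamma>\<in>?I \<times> {0}. J \<gamma>)"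
  proof -
    have "S F = J (F, 0)" if F: "F \<in> ?I" for F
    proof -
      obtain K L where KL: "K \<noteq> L" "{C \<in> \<K>. F facet_of C} = {K, L}"
        "is_side \<K> (F, 0) (\<nu> F) K 0" "is_side \<K> (F, 0) (- \<nu> F) L 0"
        using interior_facet_sides[OF F] by metis
      have "(F, 0) \<in> Gam \<K> P" using F by (simp add: Gam_def)
      from pair[OF this KL(3,4)] show ?thesis
        unfolding S_def KL(2) using KL(1) by simp
    qed
    then have "(\<Sum>F\<in>?I. S F) = (\<Sum>F\<in>?I. \<Sum>s\<in>{0}. J (F, s))" by simp
    also have "\<dots> = (\<Sum>\<gamma>\<in>?I \<times> {0}. J \<gamma>)"
      by (subst sum.cartesian_product) (simp add: case_prod_unfold)
    finally show ?thesis .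
  qed
  also have "(\<Sum>F\<in>?B. S F) = (\<Sum>\<gamma>\<in>P. J \<gamma>)"
  proof -
    have "(\<Sum>F\<in>?B. S F) = (\<Sum>F\<in>D. S F) + (\<Sum>F\<in>fst ` P. S F) + (\<Sum>F\<in>tr ` P. S F)"
      unfolding b(6)[symmetric] using b(3-5) finP finD
      by (subst sum.union_disjoint, simp, simp, blast, subst sum.union_disjoint) auto
    also have "(\<Sum>F\<in>D. S F) = 0"
      using D0 by (intro sum.neutral) (auto simp: S_def intro!: sum.neutral)
    \<comment> \<open>Each periodic pair is now indexed by its entry in \<open>P\<close>, once
      through \<open>F\<close> and once through the translate; both maps are injective on
      \<open>P\<close>.\<close>
    also have "(\<Sum>F\<in>fst ` P. S F) = (\<Sum>\<gamma>\<in>P. S (fst \<gamma>))" using sum.reindex[OF b(1), of S] by simp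
    also have "(\<Sum>F\<in>tr ` P. S F) = (\<Sum>\<gamma>\<in>P. S (tr \<gamma>))" using sum.reindex[OF b(2), of S] by simp
    also have "0 + (\<Sum>\<gamma>\<in>P. S (fst \<gamma>)) + (\<Sum>\<gamma>\<in>P. S (tr \<gamma>)) = (\<Sum>\<gamma>\<in>P. J \<gamma>)"
      unfolding add_0_left sum.distrib[symmetric]
    proof (intro sum.cong refl)
      fix \<gamma> assume "\<gamma> \<in> P"
      moreover obtain F s where Fs: "\<gamma> = (F, s)" by (cases \<gamma>)
      ultimately have FP: "(F, s) \<in> P" by simp
      then have FG: "(F, s) \<in> Gam \<K> P" by (simp add: Gam_def)
      obtain K L r r' where
        cases: "(r = 0 \<and> r' = s \<and> {C \<in> \<K>. F facet_of C} = {K} \<and> {C \<in> \<K>. (+) s ` F facet_of C} = {L}) \<or>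
         (r = s \<and> r' = 0 \<and> {C \<in> \<K>. F facet_of C} = {L} \<and> {C \<in> \<K>. (+) s ` F facet_of C} = {K})"
        and sides: "is_side \<K> (F, s) (\<nu> F) K r" "is_side \<K> (F, s) (- \<nu> F) L r'"
        using periodic_facet_sides[OF FP] .
      from cases pair[OF FG sides] show "S (fst \<gamma>) + S (tr \<gamma>) = J \<gamma>"
        unfolding S_def Fs tr_def by auto
    qed
    finally show ?thesis .
  qed
  also have "(\<Sum>\<gamma>\<in>?I \<times> {0}. J \<gamma>) + (\<Sum>\<gamma>\<in>P. J \<gamma>) = (\<Sum>\<gamma>\<in>Gam \<K> P. J \<gamma>)"
  proof -
    \<comment> \<open>First components of \<open>P\<close> are boundary facets, so no face is
      counted twice.\<close>
    have "?I \<times> {0} \<inter> P = {}"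
      using b(6) interior_boundary_facets(3) by force
    then show ?thesis
      unfolding Gam_def using fin finP by (subst sum.union_disjoint) auto
  qed
  finally show ?thesis .
qed

lemma L2_fe_cell_polynomials:
  assumes "w \<in> L2_fe \<K> q"
  shows "\<exists>p. \<forall>K\<in>\<K>. p K \<in> polys q \<and> real_polynomial_function (p K) \<and> continuous_on UNIV (p K) \<and>
    (\<forall>x\<in>interior K. w x = p K x)"
proof -
  have "\<exists>p. p \<in> polys q \<and> real_polynomial_function p \<and> continuous_on UNIV p \<and> (\<forall>x\<in>interior K. w x = p x)"
    if K: "K \<in> \<K>" for K
  proof -
    obtain p where p: "p \<in> polys q" "\<forall>x\<in>interior K. w x = p x"
      using assms K unfolding L2_fe_def by blast
    have rp: "real_polynomial_function p" using p(1) by (rule polys_imp_real_polynomial)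
    then have "continuous_on UNIV p"
      by (auto simp: real_polynomial_function_eq intro: continuous_on_polynomial)
    then show ?thesis using rp p by blast
  qed
  then show ?thesis by (intro bchoice) blast
qed

lemma L2_fe_product_integrable:
  assumes "w \<in> L2_fe \<K> q" "u \<in> L2_fe \<K> q"
  shows "set_integrable lebesgue \<Omega> (\<lambda>x. w x * u x)"
proof -
  obtain p where p: "\<forall>K\<in>\<K>. p K \<in> polys q \<and> real_polynomial_function (p K) \<and> continuous_on UNIV (p K) \<and>
      (\<forall>x\<in>interior K. w x = p K x)"
    using L2_fe_cell_polynomials[OF assms(1)] by (elim exE)
  obtain p' where p': "\<forall>K\<in>\<K>. p' K \<in> polys q \<and> real_polynomial_function (p' K) \<and> continuous_on UNIV (p' K) \<and>
      (\<forall>x\<in>interior K. u x = p' K x)"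
    using L2_fe_cell_polynomials[OF assms(2)] by (elim exE)
  show ?thesis
    by (rule integral_cells(1)[where U="\<lambda>K x. p K x * p' K x"])
       (use p p' in \<open>auto intro: continuous_intros\<close>)
qed

text \<open>Integrability is recorded alongside the identity because the weak forms integrate time
  derivative and transport together, and this integral has to be split.\<close>

lemma transport_identity:
  assumes w: "w \<in> L2_fe \<K> q" and v: "v \<in> HDiv_fe \<K> P \<nu>"
    and div: "div_free \<K> v" and flux: "no_flux \<K> D v"
  shows "set_integrable lebesgue \<Omega> (\<lambda>x. w x * (v x \<bullet> grad w x))"
    "(LINT x:\<Omega>|lebesgue. w x * (v x \<bullet> grad w x)) = (\<Sum>\<gamma>\<in>Gam \<K> P. surface_integral (fst \<gamma>) (\<nu> (fst \<gamma>))
       (\<lambda>x. (upwind \<K> \<nu> \<gamma> v x \<bullet> \<nu> (fst \<gamma>)) * face_avg \<K> \<nu> \<gamma> w x * face_jump \<K> \<nu> \<gamma> w x))"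
proof -
  obtain p where "\<forall>K\<in>\<K>. p K \<in> polys q \<and> real_polynomial_function (p K) \<and> continuous_on UNIV (p K) \<and>
      (\<forall>x\<in>interior K. w x = p K x)"
    using L2_fe_cell_polynomials[OF w] by (elim exE)
  then have p: "real_polynomial_function (p K)" "continuous_on UNIV (p K)"
    "\<And>x. x \<in> interior K \<Longrightarrow> w x = p K x" if "K \<in> \<K>" for K
    using that by blast+
  have "\<forall>K\<in>\<K>. \<exists>G. polynomial_function G \<and> (\<forall>x\<in>interior K. v x = G x)"
    using v unfolding HDiv_fe_def by blast
  then obtain G where "\<forall>K\<in>\<K>. polynomial_function (G K) \<and> (\<forall>x\<in>interior K. v x = G K x)"
    by (elim bchoice[THEN exE])
  then have G: "polynomial_function (G K)" "\<And>x. x \<in> interior K \<Longrightarrow> v x = G K x" if "K \<in> \<K>" for K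
    using that by blast+
  have contG: "continuous_on UNIV (G K)" if "K \<in> \<K>" for K
    using G(1)[OF that] by (rule continuous_on_polynomial)
  have "\<forall>K\<in>\<K>. \<exists>g. polynomial_function g \<and> (\<forall>x. (p K has_derivative (\<lambda>u. g x \<bullet> u)) (at x))"
    using polynomial_gradient[OF p(1)] by metis
  then obtain g where "\<forall>K\<in>\<K>. polynomial_function (g K) \<and> (\<forall>x. (p K has_derivative (\<lambda>u. g K x \<bullet> u)) (at x))"
    by (elim bchoice[THEN exE])
  then have g: "polynomial_function (g K)" "\<And>x. (p K has_derivative (\<lambda>u. g K x \<bullet> u)) (at x)" if "K \<in> \<K>" for K
    using that by blast+
  have contg: "continuous_on UNIV (g K)" if "K \<in> \<K>" for K
    using g(1)[OF that] by (rule continuous_on_polynomial)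
  define n where "n K F = (SOME n. outward_normal K F n)" for K F :: "'a set"
  have n: "outward_normal K F (n K F)" if K: "K \<in> \<K>" "F facet_of K" for K F
    unfolding n_def using facet_outward_normal_exists[OF cell(1,4)[OF K(1)] K(2)] by (metis someI)
  define T where "T = (\<lambda>C F. surface_integral F (n C F) (\<lambda>x. (((p C x)\<^sup>2 / 2) *\<^sub>R G C x) \<bullet> n C F))"
  let ?U = "\<lambda>K x. p K x * (G K x \<bullet> g K x)"
  have wv: "w x * (v x \<bullet> grad w x) = ?U K x" if K: "K \<in> \<K>" "x \<in> interior K" for K x
  proof -
    have "grad w x = grad (p K) x"
      unfolding grad_def
      using frechet_derivative_cong_open[OF open_interior K(2), of w "p K"] p(3)[OF K(1)] by simp
    then show ?thesis
      using p(3)[OF K] G(2)[OF K] grad_eq_gradient[OF g(2)[OF K(1)]] by simp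
  qed
  have contU: "continuous_on UNIV (?U K)" if "K \<in> \<K>" for K
    by (intro continuous_intros p contG contg that)
  show "set_integrable lebesgue \<Omega> (\<lambda>x. w x * (v x \<bullet> grad w x))"
    by (rule integral_cells(1)[OF wv contU])
  have cellwise: "(LINT x:K|lborel. ?U K x) = (\<Sum>F | F facet_of K. T K F)" if K: "K \<in> \<K>" for K
  proof -
    let ?Q = "\<lambda>x. ((p K x)\<^sup>2 / 2) *\<^sub>R G K x"
    \<comment> \<open>\<open>div_free\<close> speaks of cell interiors; continuity of the polynomial
      divergence carries the zero to the closed cell, so that the integrands agree on all of
      it.\<close>
    have div0: "divergence (G K) x = 0" if "x \<in> K" for x
    proof (rule continuous_constant_on_closure[where S="interior K"])
      show "continuous_on (closure (interior K)) (divergence (G K))"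
        using continuous_on_divergence_polynomial[OF G(1)[OF K]] continuous_on_subset by blast
      show "divergence (G K) z = 0" if z: "z \<in> interior K" for z
      proof -
        have "frechet_derivative (G K) (at z) = frechet_derivative v (at z)"
          by (rule frechet_derivative_cong_open[OF open_interior z]) (simp add: G(2)[OF K])
        then have "divergence (G K) z = divergence v z" by (simp add: divergence_def)
        then show ?thesis using div K z by (simp add: div_free_def)
      qed
      show "x \<in> closure (interior K)"
        using that convex_closure_interior[OF cell(2,4)[OF K]] closure_subset by blast
    qed
    have "?U K x = divergence ?Q x" if "x \<in> K" for x
    proof -
      have D: "((\<lambda>x. (p K x)\<^sup>2 / 2) has_derivative (\<lambda>u. (p K x *\<^sub>R g K x) \<bullet> u)) (at x)"
        by (auto intro!: derivative_eq_intros g(2)[OF K])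
      then have d1: "(\<lambda>x. (p K x)\<^sup>2 / 2) differentiable (at x)" by (rule differentiableI)
      have d2: "G K differentiable (at x)"
        using G(1)[OF K] by (rule differentiable_at_polynomial_function)
      show ?thesis
        unfolding divergence_scaleR[OF d1 d2] grad_eq_gradient[OF D] div0[OF that]
        by (simp add: inner_commute)
    qed
    then have "(LINT x:K|lborel. ?U K x) = (LINT x:K|lborel. divergence ?Q x)"
      unfolding set_lebesgue_integral_def
      by (intro Bochner_Integration.integral_cong) (auto simp: indicator_def)
    also have "\<dots> = (\<Sum>F | F facet_of K. T K F)"
      unfolding T_def
    proof (rule polytope_divergence_theorem[OF cell(1,4)[OF K] n[OF K]])
      show "polynomial_function ?Q"
        using p(1)[OF K] G(1)[OF K]
        by (intro polynomial_function_mult)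
          (auto simp: real_polynomial_function_eq[symmetric] intro!: real_polynomial_function_divide real_polynomial_function_power)
    qed
    finally show ?thesis .
  qed
  have "(LINT x:\<Omega>|lebesgue. w x * (v x \<bullet> grad w x)) = (\<Sum>K\<in>\<K>. LINT x:K|lborel. ?U K x)"
    by (rule integral_cells(2)[OF wv contU])
  also have "\<dots> = (\<Sum>K\<in>\<K>. \<Sum>F | F facet_of K. T K F)"
    by (intro sum.cong refl cellwise)
  also have "\<dots> = (\<Sum>\<gamma>\<in>Gam \<K> P. surface_integral (fst \<gamma>) (\<nu> (fst \<gamma>))
       (\<lambda>x. (upwind \<K> \<nu> \<gamma> v x \<bullet> \<nu> (fst \<gamma>)) * face_avg \<K> \<nu> \<gamma> w x * face_jump \<K> \<nu> \<gamma> w x))"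
  proof (rule sum_facets_eq_sum_Gam)
    \<comment> \<open>On a Dirichlet facet the normal velocity vanishes, and with it the flux of
      half the square.\<close>
    fix F K assume F: "F \<in> D" and K: "K \<in> \<K>" "F facet_of K"
    have "(((p K x)\<^sup>2 / 2) *\<^sub>R G K x) \<bullet> n K F = 0" if x: "x \<in> F" for x
    proof -
      have "cell_trace K v x = G K x"
        using facet_of_imp_subset[OF K(2)] x
        by (intro cell_trace_eq cell K G(2) contG) auto
      moreover have "cell_trace K v x \<bullet> n K F = 0"
        using flux F K n[OF K] x unfolding no_flux_def by blast
      ultimately show ?thesis by simp
    qed
    then have "T K F = surface_integral F (n K F) (\<lambda>_. 0)"
      unfolding T_def by (rule surface_integral_cong)
    then show "T K F = 0" by (simp add: surface_integral_def set_lebesgue_integral_def)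
  next
    fix F s K r L r'
    assume \<gamma>: "(F, s) \<in> Gam \<K> P" and sides: "is_side \<K> (F, s) (\<nu> F) K r" "is_side \<K> (F, s) (- \<nu> F) L r'"
    have hdiv: "upwind \<K> \<nu> (F, s) v x \<bullet> \<nu> F = downwind \<K> \<nu> (F, s) v x \<bullet> \<nu> F" if "x \<in> F" for x
      using v \<gamma> that unfolding HDiv_fe_def by fastforce
    show "T K ((+) r ` F) + T L ((+) r' ` F) = surface_integral (fst (F, s)) (\<nu> (fst (F, s)))
       (\<lambda>x. (upwind \<K> \<nu> (F, s) v x \<bullet> \<nu> (fst (F, s))) * face_avg \<K> \<nu> (F, s) w x * face_jump \<K> \<nu> (F, s) w x)"
      unfolding T_def fst_conv
      by (rule facet_flux_pair[OF \<gamma> sides p(3,2) G(2) contG n hdiv])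
  qed
  finally show "(LINT x:\<Omega>|lebesgue. w x * (v x \<bullet> grad w x)) = (\<Sum>\<gamma>\<in>Gam \<K> P. surface_integral (fst \<gamma>) (\<nu> (fst \<gamma>))
       (\<lambda>x. (upwind \<K> \<nu> \<gamma> v x \<bullet> \<nu> (fst \<gamma>)) * face_avg \<K> \<nu> \<gamma> w x * face_jump \<K> \<nu> \<gamma> w x))" .
qed

end

section \<open>Discrete spaces and time stepping\<close>

context fe_mesh
begin

lemma polys_expand:
  fixes p :: "nat \<Rightarrow> 'a \<Rightarrow> real"
  assumes "\<And>k. k < N \<Longrightarrow> p k \<in> polys q"
  shows "expand N p y \<in> polys q"
proof -
  let ?A = "{\<alpha>. \<alpha> \<in> Basis \<rightarrow>\<^sub>E {..q} \<and> sum \<alpha> Basis \<le> q} :: ('a \<Rightarrow> nat) set"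
  have "\<forall>k\<in>{..<N}. \<exists>c. \<forall>x. p k x = (\<Sum>\<alpha>\<in>?A. c \<alpha> * (\<Prod>b\<in>Basis. (x \<bullet> b) ^ \<alpha> b))"
    using assms unfolding polys_def by blast
  from bchoice[OF this] obtain c
    where c: "\<forall>k\<in>{..<N}. \<forall>x. p k x = (\<Sum>\<alpha>\<in>?A. c k \<alpha> * (\<Prod>b\<in>Basis. (x \<bullet> b) ^ \<alpha> b))"
    by (elim exE)
  have "expand N p y x = (\<Sum>\<alpha>\<in>?A. (\<Sum>k<N. y k * c k \<alpha>) * (\<Prod>b\<in>Basis. (x \<bullet> b) ^ \<alpha> b))" for x
  proof -
    have "expand N p y x = (\<Sum>k<N. y k * (\<Sum>\<alpha>\<in>?A. c k \<alpha> * (\<Prod>b\<in>Basis. (x \<bullet> b) ^ \<alpha> b)))"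
      unfolding expand_def using c by (intro sum.cong refl arg_cong2[where f="(*)"]) blast
    also have "\<dots> = (\<Sum>k<N. \<Sum>\<alpha>\<in>?A. y k * c k \<alpha> * (\<Prod>b\<in>Basis. (x \<bullet> b) ^ \<alpha> b))"
      by (simp only: sum_distrib_left mult.assoc)
    also have "\<dots> = (\<Sum>\<alpha>\<in>?A. \<Sum>k<N. y k * c k \<alpha> * (\<Prod>b\<in>Basis. (x \<bullet> b) ^ \<alpha> b))"
      by (rule sum.swap)
    finally show ?thesis by (simp only: sum_distrib_right)
  qed
  then show ?thesis
    unfolding polys_def by (intro CollectI exI[of _ "\<lambda>\<alpha>. \<Sum>k<N. y k * c k \<alpha>"] allI)
qed

text \<open>With one polynomial per basis function and cell, the trace becomes an evaluation and
  hence linear. The second claim transfers boundary and jump conditions from the basis to its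
  combinations.\<close>

lemma expand_L2_fe:
  assumes "\<forall>k<N. \<phi> k \<in> L2_fe \<K> q"
  shows "expand N \<phi> y \<in> L2_fe \<K> q"
    and "\<And>K x. K \<in> \<K> \<Longrightarrow> x \<in> K \<Longrightarrow>
      cell_trace K (expand N \<phi> y) x = (\<Sum>k<N. y k * cell_trace K (\<phi> k) x)"
proof -
  have "\<forall>k\<in>{..<N}. \<exists>p. \<forall>K\<in>\<K>. p K \<in> polys q \<and> real_polynomial_function (p K) \<and>
      continuous_on UNIV (p K) \<and> (\<forall>x\<in>interior K. \<phi> k x = p K x)"
    using assms L2_fe_cell_polynomials by blast
  from bchoice[OF this] obtain p where p: "\<forall>k\<in>{..<N}. \<forall>K\<in>\<K>. p k K \<in> polys q \<and>
      real_polynomial_function (p k K) \<and> continuous_on UNIV (p k K) \<and> (\<forall>x\<in>interior K. \<phi> k x = p k K x)"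
    by (elim exE)
  have e: "expand N \<phi> y x = expand N (\<lambda>k. p k K) y x" if "K \<in> \<K>" "x \<in> interior K" for K x
    unfolding expand_def using p that by (intro sum.cong refl) auto
  have "expand N (\<lambda>k. p k K) y \<in> polys q" if "K \<in> \<K>" for K
    using p that by (intro polys_expand) auto
  then show "expand N \<phi> y \<in> L2_fe \<K> q"
    unfolding L2_fe_def using e by blast
  fix K x assume K: "K \<in> \<K>" and x: "x \<in> K"
  have "continuous_on UNIV (expand N (\<lambda>k. p k K) y)"
    unfolding expand_def using p K by (intro continuous_intros) auto
  then have "cell_trace K (expand N \<phi> y) x = expand N (\<lambda>k. p k K) y x"
    using e[OF K] by (intro cell_trace_eq cell K x)
  also have "\<dots> = (\<Sum>k<N. y k * cell_trace K (\<phi> k) x)"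
    unfolding expand_def
  proof (intro sum.cong refl arg_cong2[where f="(*)"])
    fix k assume "k \<in> {..<N}"
    then show "p k K x = cell_trace K (\<phi> k) x"
      using p K by (intro cell_trace_eq[symmetric] cell K x) auto
  qed
  finally show "cell_trace K (expand N \<phi> y) x = (\<Sum>k<N. y k * cell_trace K (\<phi> k) x)" .
qed

lemma expand_dirichlet0:
  assumes "\<forall>k<N. \<phi> k \<in> L2_fe \<K> q" "\<forall>k<N. dirichlet0 \<K> D (\<phi> k)"
  shows "dirichlet0 \<K> D (expand N \<phi> y)"
  unfolding dirichlet0_def
proof (intro ballI impI)
  fix F K x
  assume *: "F \<in> D" "K \<in> \<K>" "F facet_of K" "x \<in> F"
  then have "x \<in> K" using facet_of_imp_subset by blast
  then have "cell_trace K (expand N \<phi> y) x = (\<Sum>k<N. y k * cell_trace K (\<phi> k) x)"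
    using expand_L2_fe(2)[OF assms(1)] *(2) by blast
  also have "\<dots> = 0"
    using assms(2) * unfolding dirichlet0_def by (intro sum.neutral ballI) auto
  finally show "cell_trace K (expand N \<phi> y) x = 0" .
qed

lemma expand_H1_fe:
  assumes "\<forall>k<N. \<phi> k \<in> H1_fe \<Omega> \<K> P \<nu> q"
  shows "expand N \<phi> y \<in> H1_fe \<Omega> \<K> P \<nu> q"
proof -
  have L2: "\<forall>k<N. \<phi> k \<in> L2_fe \<K> q"
    using assms by (simp add: H1_fe_def)
  have "continuous_on \<Omega> (expand N \<phi> y)"
    unfolding expand_def using assms by (intro continuous_intros) (auto simp: H1_fe_def)
  moreover have "face_jump \<K> \<nu> (F, s) (expand N \<phi> y) x = 0" if \<gamma>: "(F, s) \<in> Gam \<K> P" and x: "x \<in> F" for F s x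
  proof -
    obtain K r L r' where sides: "is_side \<K> (F, s) (\<nu> F) K r" "is_side \<K> (F, s) (- \<nu> F) L r'"
      using \<gamma> by (rule Gam_sides)
    note sK = is_sideD[OF sides(1), simplified] and sL = is_sideD[OF sides(2), simplified]
    \<comment> \<open>Each side is a cell trace at a shifted point, so linearity of traces gives
      linearity of the jump.\<close>
    have j: "face_jump \<K> \<nu> (F, s) u x = cell_trace K u (r + x) - cell_trace L u (r' + x)" for u
      by (simp add: face_jump_def upwind_def downwind_def one_sided_eq_cell_trace[OF sides(1)]
          one_sided_eq_cell_trace[OF sides(2)])
    have "r + x \<in> K" "r' + x \<in> L"
      using facet_of_imp_subset[OF sK(2)] facet_of_imp_subset[OF sL(2)] x by blast+
    then have "face_jump \<K> \<nu> (F, s) (expand N \<phi> y) x = (\<Sum>k<N. y k * face_jump \<K> \<nu> (F, s) (\<phi> k) x)"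
      unfolding j
      by (simp add: expand_L2_fe(2)[OF L2 sK(1)] expand_L2_fe(2)[OF L2 sL(1)] sum_subtractf right_diff_distrib)
    also have "\<dots> = 0"
      using assms \<gamma> x unfolding H1_fe_def by (intro sum.neutral) fastforce
    finally show ?thesis .
  qed
  then have "\<forall>\<gamma>\<in>Gam \<K> P. \<forall>x\<in>fst \<gamma>. face_jump \<K> \<nu> \<gamma> (expand N \<phi> y) x = 0"
    by (metis prod.collapse)
  ultimately show ?thesis
    using expand_L2_fe(1)[OF L2] by (simp add: H1_fe_def)
qed

text \<open>\<open>w\<close> is an admissible test function, and its zero jumps remove every face
  term of the transport identity. The conclusion concerns a single state, so that it applies to
  every stage.\<close>

lemma cg_weak_orthogonal:
  assumes w: "w \<in> V" "V \<subseteq> H1_fe \<Omega> \<K> P \<nu> q" and wt: "wt \<in> L2_fe \<K> q"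
    and v: "v \<in> HDiv_fe \<K> P \<nu>" "div_free \<K> v" "no_flux \<K> D v"
    and weak: "cg_weak \<Omega> V wt v w"
  shows "(LINT x:\<Omega>|lebesgue. w x * wt x) = 0"
proof -
  have wH: "w \<in> H1_fe \<Omega> \<K> P \<nu> q" using w by blast
  then have wL: "w \<in> L2_fe \<K> q" by (simp add: H1_fe_def)
  have jump: "face_jump \<K> \<nu> \<gamma> w x = 0" if "\<gamma> \<in> Gam \<K> P" "x \<in> fst \<gamma>" for \<gamma> x
    using wH that by (simp add: H1_fe_def)
  have "(LINT x:\<Omega>|lebesgue. w x * (v x \<bullet> grad w x)) = 0"
    unfolding transport_identity(2)[OF wL v]
  proof (intro sum.neutral ballI)
    fix \<gamma> assume \<gamma>: "\<gamma> \<in> Gam \<K> P"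
    have "surface_integral (fst \<gamma>) (\<nu> (fst \<gamma>))
       (\<lambda>x. (upwind \<K> \<nu> \<gamma> v x \<bullet> \<nu> (fst \<gamma>)) * face_avg \<K> \<nu> \<gamma> w x * face_jump \<K> \<nu> \<gamma> w x) =
      surface_integral (fst \<gamma>) (\<nu> (fst \<gamma>)) (\<lambda>_. 0)"
      by (rule surface_integral_cong) (simp add: jump[OF \<gamma>])
    then show "surface_integral (fst \<gamma>) (\<nu> (fst \<gamma>))
       (\<lambda>x. (upwind \<K> \<nu> \<gamma> v x \<bullet> \<nu> (fst \<gamma>)) * face_avg \<K> \<nu> \<gamma> w x * face_jump \<K> \<nu> \<gamma> w x) = 0"
      by (simp add: surface_integral_def set_lebesgue_integral_def)
  qed
  moreover have "(LINT x:\<Omega>|lebesgue. w x * (wt x + v x \<bullet> grad w x)) =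
      (LINT x:\<Omega>|lebesgue. w x * wt x) + (LINT x:\<Omega>|lebesgue. w x * (v x \<bullet> grad w x))"
    unfolding distrib_left
    by (rule set_integral_add(2)[OF L2_fe_product_integrable[OF wL wt] transport_identity(1)[OF wL v]])
  ultimately show ?thesis using weak w(1) by (simp add: cg_weak_def)
qed

text \<open>Testing with \<open>w\<close> makes the face term of the scheme the same expression as
  the right-hand side of the transport identity, so the two cancel.\<close>

lemma dg_weak_orthogonal:
  assumes w: "w \<in> V" "V \<subseteq> L2_fe \<K> q" and wt: "wt \<in> L2_fe \<K> q"
    and v: "v \<in> HDiv_fe \<K> P \<nu>" "div_free \<K> v" "no_flux \<K> D v"
    and weak: "dg_weak \<Omega> \<K> P \<nu> V wt v w"
  shows "(LINT x:\<Omega>|lebesgue. w x * wt x) = 0"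
proof -
  have wL: "w \<in> L2_fe \<K> q" using w by blast
  have "(LINT x:\<Omega>|lebesgue. w x * (wt x + v x \<bullet> grad w x)) =
      (LINT x:\<Omega>|lebesgue. w x * wt x) + (LINT x:\<Omega>|lebesgue. w x * (v x \<bullet> grad w x))"
    unfolding distrib_left
    by (rule set_integral_add(2)[OF L2_fe_product_integrable[OF wL wt] transport_identity(1)[OF wL v]])
  moreover have "(LINT x:\<Omega>|lebesgue. w x * (wt x + v x \<bullet> grad w x)) =
      (LINT x:\<Omega>|lebesgue. w x * (v x \<bullet> grad w x))"
    using weak w(1) unfolding dg_weak_def transport_identity(2)[OF wL v] by (simp add: mult.assoc)
  ultimately show ?thesis by simp
qed

end

section \<open>Quadratic invariants of symplectic Runge-Kutta methods\<close>

definition quadratic_form :: "nat \<Rightarrow> (nat \<Rightarrow> nat \<Rightarrow> real) \<Rightarrow> (nat \<Rightarrow> real) \<Rightarrow> (nat \<Rightarrow> real) \<Rightarrow> real" where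
  "quadratic_form N M y z = (\<Sum>k<N. \<Sum>l<N. y k * z l * M k l)"

lemma quadratic_form_sym:
  assumes "\<And>k l. M k l = M l k"
  shows "quadratic_form N M y z = quadratic_form N M z y"
  unfolding quadratic_form_def
  by (subst sum.swap) (simp add: assms[of _ _] mult_ac)

text \<open>Linearity in one slot, in the shape shared by stage equations and update. Entries below
  \<open>N\<close> determine the form, so the equation is asked for only there.\<close>

lemma quadratic_form_step_left:
  assumes "\<And>k. k < N \<Longrightarrow> u k = y k + h * (\<Sum>j<m. c j * g j k)"
  shows "quadratic_form N M u z = quadratic_form N M y z + h * (\<Sum>j<m. c j * quadratic_form N M (g j) z)"
proof -
  have "quadratic_form N M u z =
     (\<Sum>k<N. \<Sum>l<N. y k * z l * M k l + h * (\<Sum>j<m. c j * (g j k * z l * M k l)))"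
    unfolding quadratic_form_def using assms
    by (intro sum.cong refl) (simp add: algebra_simps sum_distrib_left sum_distrib_right)
  also have "\<dots> = quadratic_form N M y z + h * (\<Sum>k<N. \<Sum>l<N. \<Sum>j<m. c j * (g j k * z l * M k l))"
    by (simp add: quadratic_form_def sum.distrib sum_distrib_left)
  also have "(\<Sum>k<N. \<Sum>l<N. \<Sum>j<m. c j * (g j k * z l * M k l)) =
      (\<Sum>k<N. \<Sum>j<m. \<Sum>l<N. c j * (g j k * z l * M k l))"
    by (intro sum.cong refl sum.swap)
  also have "\<dots> = (\<Sum>j<m. \<Sum>k<N. \<Sum>l<N. c j * (g j k * z l * M k l))"
    by (rule sum.swap)
  also have "\<dots> = (\<Sum>j<m. c j * quadratic_form N M (g j) z)"
    by (simp add: quadratic_form_def sum_distrib_left)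
  finally show ?thesis .
qed

text \<open>Expanding the update leaves products of \<open>y\<close> with the stage slopes, whereas
  orthogonality is given at the stages. The stage equations trade \<open>y\<close> for further
  slopes, and the resulting double sum over slopes cancels by symmetry and the symplecticity
  condition.\<close>

theorem symplectic_rk_quadratic_invariant:
  assumes sym: "\<And>k l. M k l = M l k"
    and symplectic: "symplectic_rk m a b"
    and step: "rk_step m a b c N f t h y Y y'"
    and orth: "\<And>i. i < m \<Longrightarrow> quadratic_form N M (Y i) (f (t + c i * h) (Y i)) = 0"
  shows "quadratic_form N M y' y' = quadratic_form N M y y"
proof -
  let ?B = "quadratic_form N M"
  define g where "g j = f (t + c j * h) (Y j)" for j
  have B_sym: "?B u z = ?B z u" for u z by (rule quadratic_form_sym[OF sym])
  have Y: "Y i k = y k + h * (\<Sum>j<m. a i j * g j k)" if "i < m" "k < N" for i k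
    using step that by (simp add: rk_step_def g_def)
  have y': "y' k = y k + h * (\<Sum>j<m. b j * g j k)" if "k < N" for k
    using step that by (simp add: rk_step_def g_def)
  \<comment> \<open>Orthogonality of \<open>Y i\<close> and \<open>g i\<close>, with
    \<open>Y i\<close> expanded by its stage equation and solved for the product with
    \<open>y\<close>.\<close>
  have yg: "?B y (g i) = - h * (\<Sum>j<m. a i j * ?B (g j) (g i))" if i: "i < m" for i
    using quadratic_form_step_left[OF Y[OF i], where M=M and z="g i"] orth[OF i] by (simp add: g_def)
  let ?S = "\<Sum>i<m. \<Sum>j<m. b i * b j * ?B (g i) (g j)"
  have gg: "(\<Sum>i<m. b i * ?B (g i) z) = (\<Sum>i<m. b i * ?B z (g i))" for z
    by (simp add: B_sym[of z])
  have "?B y' y' = ?B y y' + h * (\<Sum>i<m. b i * ?B (g i) y')"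
    by (rule quadratic_form_step_left[OF y'])
  also have "?B y y' = ?B y' y" by (rule B_sym)
  also have "?B y' y = ?B y y + h * (\<Sum>i<m. b i * ?B (g i) y)"
    by (rule quadratic_form_step_left[OF y'])
  also have "(\<Sum>i<m. b i * ?B (g i) y') = (\<Sum>i<m. b i * (?B y (g i) + h * (\<Sum>j<m. b j * ?B (g j) (g i))))"
    unfolding gg[of y']
    by (intro sum.cong refl arg_cong2[where f="(*)"] quadratic_form_step_left[OF y'])
  also have "\<dots> = (\<Sum>i<m. b i * ?B y (g i)) + h * ?S"
  proof -
    have "(\<Sum>i<m. b i * (\<Sum>j<m. b j * ?B (g j) (g i))) = ?S"
      by (simp add: sum_distrib_left B_sym mult.assoc)
    moreover have "(\<Sum>i<m. b i * (u i + h * v i)) = (\<Sum>i<m. b i * u i) + h * (\<Sum>i<m. b i * v i)"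
      for u v :: "nat \<Rightarrow> real"
      by (simp add: sum.distrib sum_distrib_left algebra_simps)
    ultimately show ?thesis by simp
  qed
  also have "(\<Sum>i<m. b i * ?B (g i) y) = (\<Sum>i<m. b i * ?B y (g i))" by (rule gg)
  finally have e1: "?B y' y' = ?B y y + 2 * h * (\<Sum>i<m. b i * ?B y (g i)) + h\<^sup>2 * ?S"
    by (simp add: algebra_simps power2_eq_square)
  \<comment> \<open>Symmetry of the form allows \<open>i\<close> and \<open>j\<close> to be
    exchanged; adding both versions of \<open>R\<close> produces exactly the coefficient combination
    in \<open>symplectic_rk\<close>.\<close>
  define R where "R = (\<Sum>i<m. \<Sum>j<m. b i * a i j * ?B (g i) (g j))"
  have "(\<Sum>i<m. b i * ?B y (g i)) = - h * R"
  proof -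
    have "b i * ?B y (g i) = - h * (\<Sum>j<m. b i * a i j * ?B (g i) (g j))" if "i < m" for i
      unfolding yg[OF that] by (simp add: sum_distrib_left B_sym mult_ac)
    then show ?thesis by (simp add: R_def sum_distrib_left)
  qed
  moreover have "2 * R = ?S"
  proof -
    have "R = (\<Sum>i<m. \<Sum>j<m. b j * a j i * ?B (g i) (g j))"
      unfolding R_def by (subst sum.swap) (simp add: B_sym)
    then have "2 * R = (\<Sum>i<m. \<Sum>j<m. b i * a i j * ?B (g i) (g j)) + (\<Sum>i<m. \<Sum>j<m. b j * a j i * ?B (g i) (g j))"
      by (simp add: R_def)
    also have "\<dots> = (\<Sum>i<m. \<Sum>j<m. (b i * a i j + b j * a j i) * ?B (g i) (g j))"
      by (simp add: sum.distrib distrib_right)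
    also have "\<dots> = ?S"
      using symplectic unfolding symplectic_rk_def by (intro sum.cong refl) auto
    finally show ?thesis .
  qed
  ultimately have "2 * h * (\<Sum>i<m. b i * ?B y (g i)) = - (h\<^sup>2 * ?S)"
    by (simp add: power2_eq_square)
  then show ?thesis using e1 by simp
qed

text \<open>For the mass matrix, \<open>quadratic_form\<close> is the L2 inner product of the
  expanded functions; on equal arguments it is twice the enstrophy.\<close>

lemma (in fe_mesh) integral_expand_product:
  assumes "\<forall>k<N. \<phi> k \<in> L2_fe \<K> q"
  shows "(LINT x:\<Omega>|lebesgue. expand N \<phi> y x * expand N \<phi> z x) =
    quadratic_form N (\<lambda>k l. LINT x:\<Omega>|lebesgue. \<phi> k x * \<phi> l x) y z"
proof -
  have int: "integrable lebesgue (\<lambda>x. y k * z l * (indicator \<Omega> x * (\<phi> k x * \<phi> l x)))" if "k < N" "l < N" for k l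
    using L2_fe_product_integrable[OF assms[rule_format, OF that(1)] assms[rule_format, OF that(2)]]
    by (intro integrable_mult_right) (simp add: set_integrable_def)
  have "(LINT x:\<Omega>|lebesgue. expand N \<phi> y x * expand N \<phi> z x) =
    (LINT x|lebesgue. (\<Sum>k<N. \<Sum>l<N. y k * z l * (indicator \<Omega> x * (\<phi> k x * \<phi> l x))))"
    unfolding set_lebesgue_integral_def expand_def sum_product
    by (intro Bochner_Integration.integral_cong refl) (simp add: sum_distrib_left mult_ac)
  also have "\<dots> = (\<Sum>k<N. \<Sum>l<N. LINT x|lebesgue. y k * z l * (indicator \<Omega> x * (\<phi> k x * \<phi> l x)))"
    using int by (subst Bochner_Integration.integral_sum, force, intro sum.cong refl,
        subst Bochner_Integration.integral_sum) auto
  also have "\<dots> = quadratic_form N (\<lambda>k l. LINT x:\<Omega>|lebesgue. \<phi> k x * \<phi> l x) y z"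
    unfolding quadratic_form_def set_lebesgue_integral_def by simp
  finally show ?thesis .
qed

theorem theorem3p4:
  fixes \<Omega> :: "'a::euclidean_space set"
    and \<K> :: "'a set set"
    and P :: "('a set \<times> 'a) set" and D :: "'a set set"
    and \<nu> :: "'a set \<Rightarrow> 'a"
    and q :: nat
    and V :: "('a \<Rightarrow> real) set"
    and N :: nat and \<phi> :: "nat \<Rightarrow> 'a \<Rightarrow> real"
    and v :: "real \<Rightarrow> ('a \<Rightarrow> real) \<Rightarrow> 'a \<Rightarrow> 'a"
    and f :: "real \<Rightarrow> (nat \<Rightarrow> real) \<Rightarrow> nat \<Rightarrow> real"
    and m :: nat and a :: "nat \<Rightarrow> nat \<Rightarrow> real" and b c :: "nat \<Rightarrow> real"
    and t h :: "nat \<Rightarrow> real"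
    and y :: "nat \<Rightarrow> nat \<Rightarrow> real" and Y :: "nat \<Rightarrow> nat \<Rightarrow> nat \<Rightarrow> real"
  assumes domain: "polyhedral_domain \<Omega>"
    and mesh: "conforming_mesh \<Omega> \<K>"
    and bdry: "boundary_splitting \<K> P D"
    and normals: "unit_normal_field \<K> P \<nu>"
    and velocity: "\<And>\<tau> w. w \<in> V \<Longrightarrow> v \<tau> w \<in> HDiv_fe \<K> P \<nu>"
    and basis: "fe_basis \<Omega> V N \<phi>"
    and scheme:
      "V = {w \<in> H1_fe \<Omega> \<K> P \<nu> q. dirichlet0 \<K> D w} \<and> cg_ode \<Omega> V N \<phi> v f \<or>
       V = {w \<in> L2_fe \<K> q. dirichlet0 \<K> D w} \<and> dg_ode \<Omega> \<K> P \<nu> V N \<phi> v f"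
    and symplectic: "symplectic_rk m a b"
    and time: "\<And>n. 0 < h n" "\<And>n. t (Suc n) = t n + h n"
    and steps: "\<And>n. rk_step m a b c N f (t n) (h n) (y n) (Y n) (y (Suc n))"
    and incompressible:
      "\<And>n i. i < m \<Longrightarrow> div_free \<K> (v (t n + c i * h n) (expand N \<phi> (Y n i)))"
    and no_normal_flow:
      "\<And>n i. i < m \<Longrightarrow> no_flux \<K> D (v (t n + c i * h n) (expand N \<phi> (Y n i)))"
  shows "\<forall>n. 1 / 2 * (LINT x:\<Omega>|lebesgue. (expand N \<phi> (y (Suc n)) x)\<^sup>2)
           = 1 / 2 * (LINT x:\<Omega>|lebesgue. (expand N \<phi> (y n) x)\<^sup>2)"
proof
  fix n
  interpret fe_mesh \<Omega> \<K> P D \<nu>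
    using domain mesh bdry normals by unfold_locales
  have \<phi>V: "\<phi> k \<in> V" if "k < N" for k
    using basis that by (simp add: fe_basis_def)
  have VL2: "V \<subseteq> L2_fe \<K> q"
    using scheme by (auto simp: H1_fe_def)
  then have L2: "\<forall>k<N. \<phi> k \<in> L2_fe \<K> q"
    using \<phi>V by blast
  have dir: "\<forall>k<N. dirichlet0 \<K> D (\<phi> k)"
    using scheme \<phi>V by auto
  \<comment> \<open>Every stage serves as its own test function and as an argument of the velocity,
    so linear combinations of the basis must stay in \<open>V\<close>.\<close>
  have expV: "expand N \<phi> z \<in> V" for z
    using scheme
  proof
    assume V: "V = {w \<in> H1_fe \<Omega> \<K> P \<nu> q. dirichlet0 \<K> D w} \<and> cg_ode \<Omega> V N \<phi> v f"
    then have "\<forall>k<N. \<phi> k \<in> H1_fe \<Omega> \<K> P \<nu> q"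
      using \<phi>V by blast
    then show ?thesis
      using V expand_H1_fe[where y=z] expand_dirichlet0[OF L2 dir, where y=z] by blast
  next
    assume "V = {w \<in> L2_fe \<K> q. dirichlet0 \<K> D w} \<and> dg_ode \<Omega> \<K> P \<nu> V N \<phi> v f"
    then show ?thesis
      using expand_L2_fe(1)[OF L2, where y=z] expand_dirichlet0[OF L2 dir, where y=z] by blast
  qed
  let ?M = "\<lambda>k l. LINT x:\<Omega>|lebesgue. \<phi> k x * \<phi> l x"
  note prod = integral_expand_product[OF L2]
  \<comment> \<open>The slope vector at stage \<open>i\<close> holds the coefficients of the time
    derivative in the weak form there, so L2 orthogonality becomes orthogonality for the mass
    matrix.\<close>
  have "quadratic_form N ?M (Y n i) (f (t n + c i * h n) (Y n i)) = 0" if i: "i < m" for i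
  proof -
    let ?w = "expand N \<phi> (Y n i)" and ?\<tau> = "t n + c i * h n"
    let ?wt = "expand N \<phi> (f ?\<tau> (Y n i))"
    note v = velocity[OF expV, of ?\<tau> "Y n i"] incompressible[OF i, of n] no_normal_flow[OF i, of n]
    have wt: "?wt \<in> L2_fe \<K> q" by (rule expand_L2_fe(1)[OF L2])
    have "(LINT x:\<Omega>|lebesgue. ?w x * ?wt x) = 0"
      using scheme
    proof
      assume V: "V = {w \<in> H1_fe \<Omega> \<K> P \<nu> q. dirichlet0 \<K> D w} \<and> cg_ode \<Omega> V N \<phi> v f"
      then show ?thesis
        by (intro cg_weak_orthogonal[OF expV _ wt v]) (auto simp: cg_ode_def)
    next
      assume "V = {w \<in> L2_fe \<K> q. dirichlet0 \<K> D w} \<and> dg_ode \<Omega> \<K> P \<nu> V N \<phi> v f"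
      then show ?thesis
        by (intro dg_weak_orthogonal[OF expV VL2 wt v]) (auto simp: dg_ode_def)
    qed
    then show ?thesis by (simp add: prod)
  qed
  then have "quadratic_form N ?M (y (Suc n)) (y (Suc n)) = quadratic_form N ?M (y n) (y n)"
    by (intro symplectic_rk_quadratic_invariant[OF _ symplectic steps]) (simp_all add: mult.commute)
  then show "1 / 2 * (LINT x:\<Omega>|lebesgue. (expand N \<phi> (y (Suc n)) x)\<^sup>2)
           = 1 / 2 * (LINT x:\<Omega>|lebesgue. (expand N \<phi> (y n) x)\<^sup>2)"
    by (simp add: power2_eq_square prod)
qed

end
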